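(* Let $\frac12<\gamma<1$ and let $\xi$ have $\gamma$-Hölder continuous paths. Let $\sigma$ satisfy $(H_1)$, $(H_1')$ and $(H_2)$. Suppose that either $P(\eta\in S)=1$ or $\alpha$ and $\sigma$ are autonomous. Suppose in addition that $\alpha$ is bounded and locally Lipschitz in $x$, uniformly in $t$, and that $$\sup_{(t,x)\in[0,1]\times S^n}|\partial_t\log(|\sigma(t,x)|)|\le a_n\qquad\text{for all }n\in\mathbb{N},$$ for some sequence of positive numbers $(a_n)_{n\in\mathbb{N}}$. Then the equation $$d^\circ X_t=\sigma(t,X_t)[d^\circ\xi_t+\alpha(t,X_t)\,dt],\qquad X_0=\eta,$$ has a unique solution.
   Context: All processes are continuous, indexed by $[0,1]$, with $X_t=X_{(t\vee0)\wedge1}$ for $t\in\mathbb{R}$. $(\Omega,\mathcal{F},\mathbb{F},P)$, $\mathbb{F}=(\mathcal{F}_t)_{t\in[0,1]}$, $\mathcal{F}_1=\mathcal{F}$, is a filtered probability space; $\xi$ is $\mathbb{F}$-adapted with $\xi_0=0$; $\sigma:[0,1]\times\mathbb{R}\to\mathbb{R}$ is continuous; $\alpha:[0,1]\times\mathbb{R}\times\Omega\to\mathbb{R}$ is progressively measurable and a.s. locally bounded in $x$, uniformly in $t$; $\eta$ is an $\mathcal{F}_0$-measurable random variable. A coefficient is autonomous if it does not depend on $t$. $C^{1,0}$: continuous functions on $[0,1]\times\mathbb{R}$ with derivative in $t$ continuous in $(t,x)$. The symmetric integral $\int_0^tY\,d^\circ X$ is the limit in probability uniformly in $t\in[0,1]$,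 as $\varepsilon\to0$, if it exists, of $\frac1{2\varepsilon}\int_0^tY_s(X_{s+\varepsilon}-X_{s-\varepsilon})\,ds$. Existence and uniqueness are understood for integral solutions with $\gamma$-Hölder continuous paths: processes $X$ with $\gamma$-Hölder continuous paths such that $X_t=\eta+\int_0^t\sigma(s,X_s)\,d^\circ\xi_s+\int_0^t(\sigma\alpha)(s,X_s)\,ds$, $t\in[0,1]$. $(H_1)$: $\{(t,x)\in[0,1]\times\mathbb{R}:\sigma(t,x)\ne0\}=[0,1]\times S$ with $S\subseteq\mathbb{R}$ open, $S=\bigcup_{n}S^n$, where $S^n=(a_n^-,b_n^-)$, $-\infty\le a_n^-<b_n^-\le+\infty$, $n\in\mathbb{N}$, are the connected components of $S$. Fix points $c_n\in S^n$ and set $H^n(t,x)=\int_{c_n}^x\frac{1}{\sigma(t,z)}\,dz$ on $[0,1]\times S^n$. $(H_1')$: $\sigma\in C^{1,0}$ and there are $\delta>\frac1\gamma-1$ and constants $C_n>0$ such that for every $n\in\mathbb{N}$, $|\sigma(t,x)-\sigma(t,y)|\le C_n|x-y|^\delta$ for all $t\in[0,1]$ and $|x|+|y|\le n$. $(H_2)$: for every $t\in[0,1]$ and $n\in\mathbb{N}$, $\lim_{(s,x)\to(t,a_n^-)}|H^n(s,x)|=+\infty$ and $\lim_{(s,x)\to(t,b_n^-)}|H^n(s,x)|=+\infty$. *)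

theory Defs
  imports "HOL-Probability.Probability"
begin

section \<open>Filtrations and processes indexed by the unit interval\<close>

text \<open>The time set is \<open>{0..1}\<close>, embedded in \<^typ>\<open>real\<close>; values of processes and coefficients
  at other times are never used. Times outside \<open>{0..1}\<close> are projected onto it.\<close>

definition proj01 :: "real \<Rightarrow> real" where
  "proj01 t = min (max t 0) 1"

definition filtered_prob_space :: "'w measure \<Rightarrow> (real \<Rightarrow> 'w measure) \<Rightarrow> bool" where
  "filtered_prob_space M F \<longleftrightarrow>
     prob_space M \<and> filtration (space M) (\<lambda>t. F (proj01 t)) \<and> sets (F 1) = sets M"

definition adapted :: "(real \<Rightarrow> 'w measure) \<Rightarrow> (real \<Rightarrow> 'w \<Rightarrow> real) \<Rightarrow> bool" where
  "adapted F X \<longleftrightarrow> (\<forall>t\<in>{0..1}. X t \<in> borel_measurable (F t))"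

definition progressively_measurable ::
  "(real \<Rightarrow> 'w measure) \<Rightarrow> (real \<Rightarrow> real \<Rightarrow> 'w \<Rightarrow> real) \<Rightarrow> bool" where
  "progressively_measurable F \<alpha> \<longleftrightarrow>
     (\<forall>t\<in>{0..1}. (\<lambda>(s, x, \<omega>). \<alpha> s x \<omega>) \<in>
        borel_measurable (restrict_space borel {0..t} \<Otimes>\<^sub>M (borel \<Otimes>\<^sub>M F t)))"

definition continuous_process :: "'w measure \<Rightarrow> (real \<Rightarrow> 'w \<Rightarrow> real) \<Rightarrow> bool" where
  "continuous_process M X \<longleftrightarrow>
     (\<forall>t\<in>{0..1}. X t \<in> borel_measurable M) \<and>
     (\<forall>\<omega>\<in>space M. continuous_on {0..1} (\<lambda>t. X t \<omega>))"

definition hoelder_on :: "real \<Rightarrow> real set \<Rightarrow> (real \<Rightarrow> real) \<Rightarrow> bool" where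
  "hoelder_on \<gamma> T f \<longleftrightarrow> (\<exists>C. \<forall>s\<in>T. \<forall>t\<in>T. \<bar>f s - f t\<bar> \<le> C * \<bar>s - t\<bar> powr \<gamma>)"

definition hoelder_process :: "'w measure \<Rightarrow> real \<Rightarrow> (real \<Rightarrow> 'w \<Rightarrow> real) \<Rightarrow> bool" where
  "hoelder_process M \<gamma> X \<longleftrightarrow>
     continuous_process M X \<and> (AE \<omega> in M. hoelder_on \<gamma> {0..1} (\<lambda>t. X t \<omega>))"

section \<open>The symmetric integral and integral solutions\<close>

definition sym_approx ::
  "(real \<Rightarrow> 'w \<Rightarrow> real) \<Rightarrow> (real \<Rightarrow> 'w \<Rightarrow> real) \<Rightarrow> real \<Rightarrow> real \<Rightarrow> 'w \<Rightarrow> real" where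
  "sym_approx Y X \<epsilon> t \<omega> =
     1 / (2 * \<epsilon>) *
     (LINT s:{0..t}|lborel. Y s \<omega> * (X (proj01 (s + \<epsilon>)) \<omega> - X (proj01 (s - \<epsilon>)) \<omega>))"

text \<open>The limit is in probability, uniformly in time: the event below says that the supremum
  over \<open>t \<in> {0..1}\<close> of the distance exceeds \<open>\<delta>\<close>. It is measurable because all the
  processes involved are continuous.\<close>

definition is_symmetric_integral ::
  "'w measure \<Rightarrow> (real \<Rightarrow> 'w \<Rightarrow> real) \<Rightarrow> (real \<Rightarrow> 'w \<Rightarrow> real) \<Rightarrow> (real \<Rightarrow> 'w \<Rightarrow> real) \<Rightarrow> bool" where
  "is_symmetric_integral M Y X I \<longleftrightarrow>
     continuous_process M Y \<and> continuous_process M X \<and> continuous_process M I \<and>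
     (\<forall>\<delta>>0. ((\<lambda>\<epsilon>. measure M {\<omega> \<in> space M. \<exists>t\<in>{0..1}. \<delta> < \<bar>sym_approx Y X \<epsilon> t \<omega> - I t \<omega>\<bar>})
               \<longlongrightarrow> 0) (at_right 0))"

text \<open>A solution need not be adapted. The integrability clause makes the drift integral
  well defined, since the Lebesgue integral is 0 for non-integrable functions.\<close>

definition integral_solution ::
  "'w measure \<Rightarrow> real \<Rightarrow> (real \<Rightarrow> real \<Rightarrow> real) \<Rightarrow> (real \<Rightarrow> real \<Rightarrow> 'w \<Rightarrow> real) \<Rightarrow>
   (real \<Rightarrow> 'w \<Rightarrow> real) \<Rightarrow> ('w \<Rightarrow> real) \<Rightarrow> (real \<Rightarrow> 'w \<Rightarrow> real) \<Rightarrow> bool" where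
  "integral_solution M \<gamma> \<sigma> \<alpha> \<xi> \<eta> X \<longleftrightarrow>
     hoelder_process M \<gamma> X \<and>
     (AE \<omega> in M. set_integrable lborel {0..1} (\<lambda>s. \<sigma> s (X s \<omega>) * \<alpha> s (X s \<omega>) \<omega>)) \<and>
     (\<exists>I. is_symmetric_integral M (\<lambda>s \<omega>. \<sigma> s (X s \<omega>)) \<xi> I \<and>
          (AE \<omega> in M. \<forall>t\<in>{0..1}.
             X t \<omega> = \<eta> \<omega> + I t \<omega> + (LINT s:{0..t}|lborel. \<sigma> s (X s \<omega>) * \<alpha> s (X s \<omega>) \<omega>)))"

section \<open>Conditions on the coefficients\<close>

text \<open>Bounds on the random coefficient hold almost surely, uniformly in \<open>t\<close>; the constants may
  depend on \<open>\<omega>\<close>.\<close>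

definition loc_bounded_coeff :: "'w measure \<Rightarrow> (real \<Rightarrow> real \<Rightarrow> 'w \<Rightarrow> real) \<Rightarrow> bool" where
  "loc_bounded_coeff M \<alpha> \<longleftrightarrow>
     (AE \<omega> in M. \<forall>R. \<exists>K. \<forall>t\<in>{0..1}. \<forall>x\<in>{-R..R}. \<bar>\<alpha> t x \<omega>\<bar> \<le> K)"

definition bounded_coeff :: "'w measure \<Rightarrow> (real \<Rightarrow> real \<Rightarrow> 'w \<Rightarrow> real) \<Rightarrow> bool" where
  "bounded_coeff M \<alpha> \<longleftrightarrow>
     (AE \<omega> in M. \<exists>K. \<forall>t\<in>{0..1}. \<forall>x. \<bar>\<alpha> t x \<omega>\<bar> \<le> K)"

definition loc_lipschitz_coeff :: "'w measure \<Rightarrow> (real \<Rightarrow> real \<Rightarrow> 'w \<Rightarrow> real) \<Rightarrow> bool" where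
  "loc_lipschitz_coeff M \<alpha> \<longleftrightarrow>
     (AE \<omega> in M. \<forall>R. \<exists>L. \<forall>t\<in>{0..1}. L-lipschitz_on {-R..R} (\<lambda>x. \<alpha> t x \<omega>))"

definition autonomous :: "(real \<Rightarrow> 'b) \<Rightarrow> bool" where
  "autonomous f \<longleftrightarrow> (\<forall>s\<in>{0..1}. \<forall>t\<in>{0..1}. f s = f t)"

text \<open>At the endpoints of \<open>{0..1}\<close> the time derivative is one-sided.\<close>

definition C10 :: "(real \<Rightarrow> real \<Rightarrow> real) \<Rightarrow> bool" where
  "C10 \<sigma> \<longleftrightarrow>
     continuous_on ({0..1} \<times> UNIV) (\<lambda>(t, x). \<sigma> t x) \<and>
     (\<exists>\<sigma>'. (\<forall>t\<in>{0..1}. \<forall>x. ((\<lambda>s. \<sigma> s x) has_real_derivative \<sigma>' t x) (at t within {0..1})) \<and>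
           continuous_on ({0..1} \<times> UNIV) (\<lambda>(t, x). \<sigma>' t x))"

text \<open>The real points of the interval with extended-real endpoints \<open>lo n\<close> and \<open>hi n\<close>.\<close>

definition comp_interval :: "(nat \<Rightarrow> ereal) \<Rightarrow> (nat \<Rightarrow> ereal) \<Rightarrow> nat \<Rightarrow> real set" where
  "comp_interval lo hi n = {x. lo n < ereal x \<and> ereal x < hi n}"

text \<open>The components of \<open>S\<close> are enumerated without repetition by a set \<open>N\<close> of natural numbers,
  so that \<open>S\<close> may also have only finitely many components, or none.\<close>

definition cond_H1 ::
  "(real \<Rightarrow> real \<Rightarrow> real) \<Rightarrow> real set \<Rightarrow> nat set \<Rightarrow> (nat \<Rightarrow> ereal) \<Rightarrow> (nat \<Rightarrow> ereal) \<Rightarrow> bool" where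
  "cond_H1 \<sigma> S N lo hi \<longleftrightarrow>
     open S \<and>
     {(t, x). t \<in> {0..1} \<and> \<sigma> t x \<noteq> 0} = {0..1} \<times> S \<and>
     bij_betw (comp_interval lo hi) N (components S)"

definition cond_H1' :: "real \<Rightarrow> (real \<Rightarrow> real \<Rightarrow> real) \<Rightarrow> bool" where
  "cond_H1' \<gamma> \<sigma> \<longleftrightarrow>
     C10 \<sigma> \<and>
     (\<exists>\<delta>>1 / \<gamma> - 1. \<exists>C :: nat \<Rightarrow> real. \<forall>n. C n > 0 \<and>
        (\<forall>t\<in>{0..1}. \<forall>x y. \<bar>x\<bar> + \<bar>y\<bar> \<le> real n \<longrightarrow>
           \<bar>\<sigma> t x - \<sigma> t y\<bar> \<le> C n * \<bar>x - y\<bar> powr \<delta>))"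

definition H_fun :: "(real \<Rightarrow> real \<Rightarrow> real) \<Rightarrow> real \<Rightarrow> real \<Rightarrow> real \<Rightarrow> real" where
  "H_fun \<sigma> c t x = (LBINT z=c..x. 1 / \<sigma> t z)"

text \<open>The limits are taken in \<^typ>\<open>real \<times> ereal\<close>, to allow for infinite endpoints;
  \<open>real_of_ereal\<close> is only applied to finite values.\<close>

definition cond_H2 ::
  "(real \<Rightarrow> real \<Rightarrow> real) \<Rightarrow> nat set \<Rightarrow> (nat \<Rightarrow> ereal) \<Rightarrow> (nat \<Rightarrow> ereal) \<Rightarrow> (nat \<Rightarrow> real) \<Rightarrow> bool" where
  "cond_H2 \<sigma> N lo hi c \<longleftrightarrow>
     (\<forall>t\<in>{0..1}. \<forall>n\<in>N. \<forall>e\<in>{lo n, hi n}.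
        filterlim (\<lambda>(s, x). \<bar>H_fun \<sigma> (c n) s (real_of_ereal x)\<bar>) at_top
          (at (t, e) within {0..1} \<times> {lo n<..<hi n}))"

definition dt_log_abs :: "(real \<Rightarrow> real \<Rightarrow> real) \<Rightarrow> real \<Rightarrow> real \<Rightarrow> real" where
  "dt_log_abs \<sigma> t x = vector_derivative (\<lambda>s. ln \<bar>\<sigma> s x\<bar>) (at t within {0..1})"

end

theory Submission
  imports Defs
begin

text \<open>On a component of the set \<open>S\<close> where \<open>\<sigma>\<close> does not vanish, let \<open>H t\<close> be the antiderivative of
  \<open>1 / \<sigma> t\<close>, let \<open>Ht\<close> be its time derivative and let \<open>K t\<close> be the inverse of \<open>H t\<close>. The substitution
  \<open>Z t = H t (X t)\<close> removes the coefficient in front of the noise: along almost every path, \<open>X\<close> solves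
  the equation if and only if \<open>Z\<close> solves

  \<open>Z t = Z 0 + (\<xi> t - \<xi> 0) + integral {0..t} (\<lambda>s. \<alpha> s (X s) + Ht s (X s))\<close> with \<open>X s = K s (Z s)\<close>,

  which is an ordinary integral equation with additive noise. By Cauchy's mean value theorem the
  bound on the logarithmic time derivative of \<open>\<sigma>\<close> makes \<open>Ht s (K s z)\<close> Lipschitz continuous and of
  linear growth in \<open>z\<close> (\<open>Ht_lipschitz_wrt_H\<close>), and \<open>\<alpha>\<close> is bounded and locally Lipschitz continuous.
  So Picard iteration solves the equation on the whole time interval, and Gronwall's inequality
  gives uniqueness (\<open>path_solution_exists\<close>, \<open>path_solution_unique\<close>).

  The equivalence rests on Young's estimate. Along a \<open>\<gamma>\<close>-Hoelder path \<open>\<sigma> s (X s)\<close> is Hoelder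
  continuous with exponent \<open>\<gamma> * \<delta>\<close>, and \<open>\<gamma> + \<gamma> * \<delta> > 1\<close>. Therefore the symmetric approximations
  converge uniformly for each such path, and their limit \<open>I\<close> satisfies
  \<open>I v - I u = \<sigma> u (X u) * (\<xi> v - \<xi> u)\<close> up to an error \<open>o(v - u)\<close> (\<open>young_symmetric_integral\<close>). The
  increments of \<open>H t (X t)\<close> have the first-order expansion of classical calculus up to errors of the
  same kind (\<open>chain_rule\<close>), and a function whose increments are \<open>o(v - u)\<close> is constant. Comparing
  the expansions proves both directions (\<open>sde_imp_transformed_ode\<close>, \<open>transformed_ode_imp_sde\<close>).

  A solution never crosses the boundary of a component: inside, Gronwall's inequality bounds \<open>Z\<close>,
  whereas \<open>H\<close> is infinite at the ends of the component (\<open>stays_in_component\<close>). So a solution that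
  starts in \<open>S\<close> stays in its component, where uniqueness is known, and a solution that starts
  outside \<open>S\<close> stays where \<open>\<sigma>\<close> vanishes and is constant.

  Probability enters in two places. The symmetric integral is a limit in probability, which agrees
  almost surely with the limit along paths (\<open>symmetric_integral_eq_pathwise_limit\<close>,
  \<open>symmetric_integral_of_pathwise_limit\<close>), and the solution constructed path by path has to be
  measurable, which is inherited from the Picard iterates (\<open>measurable_solution_process\<close>).\<close>

section \<open>Auxiliary facts\<close>

lemma continuous_on_case_prod_compose:
  assumes "continuous_on S (\<lambda>(t, x). f t x)" "continuous_on A g" "continuous_on A h"
    and "\<And>s. s \<in> A \<Longrightarrow> (g s, h s) \<in> S"
  shows "continuous_on A (\<lambda>s. f (g s) (h s))"
proof -
  have "continuous_on A (\<lambda>s. case (g s, h s) of (t, x) \<Rightarrow> f t x)"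
    by (rule continuous_on_compose2[OF assms(1)]) (use assms in \<open>auto intro!: continuous_intros\<close>)
  then show ?thesis by simp
qed

lemma continuous_on_section:
  assumes "continuous_on (T \<times> J) (\<lambda>(t, x). g t x)" "t \<in> T"
  shows "continuous_on J (g t)"
  by (rule continuous_on_case_prod_compose[OF assms(1), where g = "\<lambda>_. t" and h = "\<lambda>x. x"])
    (use assms(2) in auto)

lemma continuous_on_Icc_bounded:
  fixes f :: "real \<Rightarrow> real"
  assumes "continuous_on {p..q} f"
  obtains R where "0 \<le> R" "\<And>t. t \<in> {p..q} \<Longrightarrow> \<bar>f t\<bar> \<le> R"
proof -
  obtain R where R: "\<forall>x\<in>f ` {p..q}. norm x \<le> R"
    using compact_imp_bounded[OF compact_continuous_image[OF assms]] unfolding bounded_iff by auto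
  have "\<bar>f t\<bar> \<le> max R 0" if "t \<in> {p..q}" for t
    using bspec[OF R imageI[OF that]] by simp
  then show ?thesis using that[of "max R 0"] by simp
qed

lemma filterlim_inverse_Suc_at_right: "filterlim (\<lambda>n. 1 / real (Suc n)) (at_right 0) sequentially"
  using LIMSEQ_Suc[OF lim_1_over_n] by (auto simp: filterlim_at)

lemma tendsto_powr_at_right_0:
  fixes C \<kappa> :: real
  assumes "0 < \<kappa>"
  shows "((\<lambda>\<epsilon>. C * \<epsilon> powr \<kappa>) \<longlongrightarrow> 0) (at_right 0)"
proof -
  have "((\<lambda>\<epsilon>. C * \<epsilon> powr \<kappa>) \<longlongrightarrow> C * 0 powr \<kappa>) (at_right 0)"
    using assms by (intro tendsto_intros tendsto_powr') (auto simp: eventually_at_filter)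
  then show ?thesis by simp
qed

lemma limit_with_rate:
  fixes s :: "nat \<Rightarrow> real"
  assumes rate: "\<rho> \<longlonglongrightarrow> 0" and dist: "\<And>k n. k \<le> n \<Longrightarrow> \<bar>s n - s k\<bar> \<le> \<rho> k"
  shows "s \<longlonglongrightarrow> lim s" "\<bar>s k - lim s\<bar> \<le> \<rho> k"
proof -
  have "Cauchy s"
  proof (rule CauchyI)
    fix e :: real assume "e > 0"
    then have "\<forall>\<^sub>F k in sequentially. \<rho> k < e / 2"
      using order_tendstoD(2)[OF rate, of "e / 2"] by simp
    then obtain N where N: "\<rho> N < e / 2" by (auto simp: eventually_sequentially)
    have "norm (s m - s n) < e" if "m \<ge> N" "n \<ge> N" for m n
      using dist[OF that(1)] dist[OF that(2)] N by simp
    then show "\<exists>M. \<forall>m\<ge>M. \<forall>n\<ge>M. norm (s m - s n) < e" by blast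
  qed
  then show lim: "s \<longlonglongrightarrow> lim s" by (simp add: Cauchy_convergent_iff convergent_LIMSEQ_iff)
  show "\<bar>s k - lim s\<bar> \<le> \<rho> k"
  proof (rule LIMSEQ_le_const2)
    show "(\<lambda>n. \<bar>s k - s n\<bar>) \<longlonglongrightarrow> \<bar>s k - lim s\<bar>" by (intro tendsto_intros lim)
    show "\<exists>N. \<forall>n\<ge>N. \<bar>s k - s n\<bar> \<le> \<rho> k" using dist by (metis abs_minus_commute)
  qed
qed

section \<open>Young integrals as limits of symmetric approximations\<close>

lemma hoelder_imp_continuous_on:
  fixes f :: "real \<Rightarrow> real"
  assumes "0 < \<beta>" and "\<And>s t. s \<in> T \<Longrightarrow> t \<in> T \<Longrightarrow> \<bar>f s - f t\<bar> \<le> A * \<bar>s - t\<bar> powr \<beta>"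
  shows "continuous_on T f"
  unfolding continuous_on_def
proof
  fix x assume x: "x \<in> T"
  have "((\<lambda>y. A * \<bar>y - x\<bar> powr \<beta>) \<longlongrightarrow> A * \<bar>x - x\<bar> powr \<beta>) (at x within T)"
    using assms(1) by (intro tendsto_intros tendsto_powr') auto
  then have "((\<lambda>y. A * \<bar>y - x\<bar> powr \<beta>) \<longlongrightarrow> 0) (at x within T)" by simp
  then have "((\<lambda>y. f y - f x) \<longlongrightarrow> 0) (at x within T)"
    using assms(2) x by (elim Lim_null_comparison[rotated]) (auto simp: eventually_at_filter)
  then show "(f \<longlongrightarrow> f x) (at x within T)" by (simp add: Lim_null[symmetric])
qed

text \<open>Splitting \<open>{u..v}\<close> at its midpoint \<open>m\<close> changes the error of the left-point approximation by
  \<open>(f m - f u) * (h v - h m)\<close>, which is of order \<open>(v - u) powr (\<beta> + \<gamma>)\<close>. Since \<open>\<beta> + \<gamma> > 1\<close>, the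
  errors on the two halves add up to strictly less than the error allowed on the whole interval,
  so a bound of this order reproduces itself under bisection. The crude bound of order
  \<open>(v - u) powr (1 + \<beta>)\<close>, which depends on the derivative of \<open>h\<close>, shrinks by the factor
  \<open>2 powr - \<beta>\<close> with every bisection and disappears in the limit. The remaining constant involves
  only the Hoelder constants, and this is what lets the estimate survive when \<open>h\<close> approximates a
  rough path.\<close>
lemma young_smooth_integrator:
  fixes f h h' :: "real \<Rightarrow> real"
  assumes \<theta>: "1 < \<beta> + \<gamma>" and \<beta>: "0 < \<beta>" and A: "0 \<le> A" and B: "0 \<le> B"
    and f: "\<And>s t. s \<in> {a..b} \<Longrightarrow> t \<in> {a..b} \<Longrightarrow> \<bar>f s - f t\<bar> \<le> A * \<bar>s - t\<bar> powr \<beta>"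
    and h: "\<And>s t. s \<in> {a..b} \<Longrightarrow> t \<in> {a..b} \<Longrightarrow> \<bar>h s - h t\<bar> \<le> B * \<bar>s - t\<bar> powr \<gamma>"
    and h': "\<And>t. t \<in> {a..b} \<Longrightarrow> (h has_real_derivative h' t) (at t)"
    and cont: "continuous_on {a..b} h'"
    and st: "a \<le> s" "s \<le> t" "t \<le> b"
  shows "\<bar>integral {s..t} (\<lambda>r. f r * h' r) - f s * (h t - h s)\<bar>
         \<le> A * B / (2 powr (\<beta> + \<gamma>) - 2) * (t - s) powr (\<beta> + \<gamma>)"
proof -
  define \<theta> where "\<theta> = \<beta> + \<gamma>"
  define C where "C = A * B / (2 powr \<theta> - 2)"
  have \<theta>1: "2 powr \<theta> > 2"
    using \<theta> powr_less_mono[of 1 \<theta> "2::real"] by (simp add: \<theta>_def)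
  have C0: "C \<ge> 0" using A B \<theta>1 by (simp add: C_def)
  have f_cont: "continuous_on {a..b} f"
    using \<beta> f by (rule hoelder_imp_continuous_on)
  obtain D where D0: "D \<ge> 0" and D: "\<And>r. r \<in> {a..b} \<Longrightarrow> \<bar>h' r\<bar> \<le> D"
    using continuous_on_Icc_bounded[OF cont] by blast
  define E where "E u v = integral {u..v} (\<lambda>r. f r * h' r) - f u * (h v - h u)" for u v
  have int: "(\<lambda>r. f r * h' r) integrable_on {u..v}" if "a \<le> u" "v \<le> b" for u v
    using that by (intro integrable_continuous_interval continuous_intros
        continuous_on_subset[OF f_cont] continuous_on_subset[OF cont]) auto
  have split: "E u v = E u m + E m v + (f m - f u) * (h v - h m)"
    if "a \<le> u" "u \<le> m" "m \<le> v" "v \<le> b" for u m v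
    using Henstock_Kurzweil_Integration.integral_combine[OF that(2,3) int[OF that(1,4)]]
    by (simp add: E_def algebra_simps)
  have base: "\<bar>E u v\<bar> \<le> A * D * (v - u) powr (1 + \<beta>)" if uv: "a \<le> u" "u \<le> v" "v \<le> b" for u v
  proof -
    have "(h' has_integral h v - h u) {u..v}"
      using uv h' by (intro fundamental_theorem_of_calculus)
        (auto simp: has_real_derivative_iff_has_vector_derivative[symmetric] intro: has_field_derivative_at_within)
    then have "((\<lambda>r. f u * h' r) has_integral f u * (h v - h u)) {u..v}"
      by (rule has_integral_mult_right)
    moreover have "((\<lambda>r. f r * h' r) has_integral integral {u..v} (\<lambda>r. f r * h' r)) {u..v}"
      using int uv by (simp add: integrable_integral)
    ultimately have *: "((\<lambda>r. f r * h' r - f u * h' r) has_integral E u v) {u..v}"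
      unfolding E_def by (intro has_integral_diff)
    have "norm (E u v) \<le> A * D * (v - u) powr \<beta> * measure lborel (cbox u v)"
    proof (rule has_integral_bound)
      show "((\<lambda>r. f r * h' r - f u * h' r) has_integral E u v) (cbox u v)" using * by simp
      show "0 \<le> A * D * (v - u) powr \<beta>" using A D0 by simp
      fix r assume "r \<in> cbox u v"
      then have r: "r \<in> {a..b}" "u \<in> {a..b}" "u \<le> r" "r \<le> v" using uv by auto
      have "\<bar>f r - f u\<bar> \<le> A * \<bar>r - u\<bar> powr \<beta>" using f r by blast
      also have "\<dots> \<le> A * (v - u) powr \<beta>"
        using A r \<beta> by (intro mult_left_mono powr_mono2) auto
      finally have "\<bar>f r - f u\<bar> * \<bar>h' r\<bar> \<le> A * (v - u) powr \<beta> * D"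
        using D[OF r(1)] A by (intro mult_mono) auto
      then show "norm (f r * h' r - f u * h' r) \<le> A * D * (v - u) powr \<beta>"
        by (simp add: abs_mult[symmetric] algebra_simps)
    qed
    then show ?thesis using uv by (simp add: powr_add ac_simps)
  qed
  \<comment> \<open>The second summand is the crude bound after \<open>n\<close> bisections.\<close>
  have step: "\<bar>E u v\<bar> \<le> C * (v - u) powr \<theta> + 2 ^ n * (A * D) * ((v - u) / 2 ^ n) powr (1 + \<beta>)"
    if "a \<le> u" "u \<le> v" "v \<le> b" for u v n
    using that
  proof (induction n arbitrary: u v)
    case 0
    then show ?case using base[of u v] C0 by (simp add: add_increasing)
  next
    case (Suc n)
    define m where "m = (u + v) / 2"
    have m: "u \<le> m" "m \<le> v" "m - u = (v - u) / 2" "v - m = (v - u) / 2"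
      using Suc.prems by (auto simp: m_def field_simps)
    define L where "L = (v - u) / 2"
    have L0: "L \<ge> 0" using Suc.prems by (simp add: L_def)
    have abs_L: "\<bar>m - u\<bar> = L" "\<bar>v - m\<bar> = L" using m L0 by (auto simp: L_def)
    have vu: "v - u = 2 * L" by (simp add: L_def)
    have uv: "u \<in> {a..b}" "m \<in> {a..b}" "v \<in> {a..b}" using Suc.prems m by auto
    have 1: "\<bar>E u m\<bar> \<le> C * L powr \<theta> + 2 ^ n * (A * D) * (L / 2 ^ n) powr (1 + \<beta>)"
      using Suc.IH[of u m] Suc.prems m by (simp add: L_def)
    have 2: "\<bar>E m v\<bar> \<le> C * L powr \<theta> + 2 ^ n * (A * D) * (L / 2 ^ n) powr (1 + \<beta>)"
      using Suc.IH[of m v] Suc.prems m by (simp add: L_def)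
    have "\<bar>f m - f u\<bar> * \<bar>h v - h m\<bar> \<le> (A * \<bar>m - u\<bar> powr \<beta>) * (B * \<bar>v - m\<bar> powr \<gamma>)"
      using f[of m u] h[of v m] uv A by (intro mult_mono) auto
    also have "\<dots> = A * B * L powr \<theta>"
      by (simp only: abs_L) (simp add: \<theta>_def powr_add)
    finally have 3: "\<bar>(f m - f u) * (h v - h m)\<bar> \<le> A * B * L powr \<theta>" by (simp add: abs_mult)
    have "\<bar>E u v\<bar> \<le> \<bar>E u m\<bar> + \<bar>E m v\<bar> + \<bar>(f m - f u) * (h v - h m)\<bar>"
      using split[of u m v] Suc.prems m by linarith
    also have "\<dots> \<le> (2 * C + A * B) * L powr \<theta> + 2 ^ Suc n * (A * D) * (L / 2 ^ n) powr (1 + \<beta>)"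
      using 1 2 3 by (simp add: algebra_simps)
    also have "2 * C + A * B = C * 2 powr \<theta>"
      using \<theta>1 by (simp add: C_def field_simps)
    also have "C * 2 powr \<theta> * L powr \<theta> = C * (v - u) powr \<theta>"
      using L0 by (simp add: vu powr_mult)
    also have "L / 2 ^ n = (v - u) / 2 ^ Suc n" by (simp add: L_def)
    finally show ?case .
  qed
  have "(\<lambda>n. C * (t - s) powr \<theta> + 2 ^ n * (A * D) * ((t - s) / 2 ^ n) powr (1 + \<beta>))
      \<longlonglongrightarrow> C * (t - s) powr \<theta> + A * D * (t - s) powr (1 + \<beta>) * 0"
  proof (rule tendsto_add[OF tendsto_const])
    have q: "(2::real) powr (-\<beta>) < 1" using \<beta> by (simp add: powr_less_one)
    have "2 ^ n * (A * D) * ((t - s) / 2 ^ n) powr (1 + \<beta>)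
        = A * D * (t - s) powr (1 + \<beta>) * (2 powr (-\<beta>)) ^ n" for n
    proof -
      have "((t - s) / 2 ^ n) powr (1 + \<beta>) = (t - s) powr (1 + \<beta>) / (2 ^ n) powr (1 + \<beta>)"
        using st by (simp add: powr_divide)
      also have "(2 ^ n :: real) powr (1 + \<beta>) = 2 ^ n * (2 powr \<beta>) ^ n"
        by (simp add: powr_add powr_realpow[symmetric] powr_powr mult.commute)
      finally show ?thesis by (simp add: powr_minus field_simps)
    qed
    then show "(\<lambda>n. 2 ^ n * (A * D) * ((t - s) / 2 ^ n) powr (1 + \<beta>))
      \<longlonglongrightarrow> A * D * (t - s) powr (1 + \<beta>) * 0"
      using q by (simp only:) (intro tendsto_intros LIMSEQ_realpow_zero, auto)
  qed
  then have "\<bar>E s t\<bar> \<le> C * (t - s) powr \<theta> + A * D * (t - s) powr (1 + \<beta>) * 0"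
    using step[OF st] by (intro LIMSEQ_le_const) auto
  then show ?thesis by (simp add: E_def C_def \<theta>_def)
qed

lemma antiderivative_of_continuous:
  fixes g :: "real \<Rightarrow> real"
  assumes "continuous_on UNIV g"
  obtains P where "\<And>x. (P has_real_derivative g x) (at x)"
proof -
  have "\<exists>F. \<forall>x. -\<infinity> < ereal x \<longrightarrow> ereal x < \<infinity> \<longrightarrow> (F has_vector_derivative g x) (at x)"
    using assms by (intro einterval_antiderivative) (auto simp: continuous_on_eq_continuous_at)
  then show ?thesis
    using that by (auto simp: has_real_derivative_iff_has_vector_derivative)
qed

text \<open>The function \<open>m \<epsilon>\<close> is the average of \<open>g\<close> over \<open>{t - \<epsilon>..t + \<epsilon>}\<close>. Its derivative is the
  difference quotient in the symmetric approximations, which thereby become integrals against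
  smooth functions.\<close>
lemma mollification:
  fixes g :: "real \<Rightarrow> real"
  assumes \<gamma>: "0 < \<gamma>" and g: "\<And>s t. \<bar>g s - g t\<bar> \<le> B * \<bar>s - t\<bar> powr \<gamma>"
  obtains m :: "real \<Rightarrow> real \<Rightarrow> real" where
    "\<And>\<epsilon> t. \<epsilon> > 0 \<Longrightarrow> (m \<epsilon> has_real_derivative (g (t + \<epsilon>) - g (t - \<epsilon>)) / (2 * \<epsilon>)) (at t)"
    "\<And>\<epsilon> s t. \<epsilon> > 0 \<Longrightarrow> \<bar>m \<epsilon> s - m \<epsilon> t\<bar> \<le> B * \<bar>s - t\<bar> powr \<gamma>"
    "\<And>\<epsilon> t. \<epsilon> > 0 \<Longrightarrow> \<bar>m \<epsilon> t - g t\<bar> \<le> B * \<epsilon> powr \<gamma>"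
proof -
  have cont: "continuous_on UNIV g"
    using \<gamma> g by (rule hoelder_imp_continuous_on)
  have B: "B \<ge> 0" using g[of 1 0] by simp
  obtain P where P: "\<And>x. (P has_real_derivative g x) (at x)"
    using antiderivative_of_continuous[OF cont] by blast
  have P_plus: "((\<lambda>e. P (t + e)) has_real_derivative g (t + e)) (at e)" for t e
    by (rule DERIV_cong[OF DERIV_chain2[OF P]]) (auto intro!: derivative_eq_intros)
  have P_plus': "((\<lambda>t. P (t + e)) has_real_derivative g (t + e)) (at t)" for t e
    by (rule DERIV_cong[OF DERIV_chain2[OF P]]) (auto intro!: derivative_eq_intros)
  have P_minus: "((\<lambda>e. P (t - e)) has_real_derivative - g (t - e)) (at e)" for t e
    by (rule DERIV_cong[OF DERIV_chain2[OF P]]) (auto intro!: derivative_eq_intros)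
  have P_minus': "((\<lambda>t. P (t - e)) has_real_derivative g (t - e)) (at t)" for t e
    by (rule DERIV_cong[OF DERIV_chain2[OF P]]) (auto intro!: derivative_eq_intros)
  \<comment> \<open>Both bounds come from the mean value theorem in the radius \<open>\<epsilon>\<close>.\<close>
  have mvt: "\<bar>\<phi> e\<bar> \<le> D * e"
    if "e > 0" "\<phi> 0 = 0" and d: "\<And>x. (\<phi> has_real_derivative \<phi>' x) (at x)"
      and b: "\<And>x. 0 < x \<Longrightarrow> x < e \<Longrightarrow> \<bar>\<phi>' x\<bar> \<le> D"
    for \<phi> \<phi>' :: "real \<Rightarrow> real" and D e
  proof -
    obtain z where z: "0 < z" "z < e" "\<phi> e - \<phi> 0 = (e - 0) * \<phi>' z"
      using MVT2[of 0 e \<phi> \<phi>'] d \<open>e > 0\<close> by blast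
    then show ?thesis using b[of z] that(1,2) by (simp add: abs_mult mult.commute)
  qed
  define m where "m \<epsilon> t = (P (t + \<epsilon>) - P (t - \<epsilon>)) / (2 * \<epsilon>)" for \<epsilon> t
  show ?thesis
  proof (rule that[of m])
    fix \<epsilon> s t :: real assume \<epsilon>: "\<epsilon> > 0"
    show "(m \<epsilon> has_real_derivative (g (t + \<epsilon>) - g (t - \<epsilon>)) / (2 * \<epsilon>)) (at t)"
      unfolding m_def using \<epsilon> by (auto intro!: derivative_eq_intros P_plus' P_minus' simp: field_simps)
    have "\<bar>P (s + \<epsilon>) - P (s - \<epsilon>) - (P (t + \<epsilon>) - P (t - \<epsilon>))\<bar> \<le> (2 * B * \<bar>s - t\<bar> powr \<gamma>) * \<epsilon>"
    proof (rule mvt[OF \<epsilon>])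
      fix x
      show "((\<lambda>\<epsilon>. P (s + \<epsilon>) - P (s - \<epsilon>) - (P (t + \<epsilon>) - P (t - \<epsilon>))) has_real_derivative
          (g (s + x) - - g (s - x) - (g (t + x) - - g (t - x)))) (at x)"
        by (intro DERIV_diff P_plus P_minus)
      show "\<bar>g (s + x) - - g (s - x) - (g (t + x) - - g (t - x))\<bar> \<le> 2 * B * \<bar>s - t\<bar> powr \<gamma>"
        using g[of "s + x" "t + x"] g[of "s - x" "t - x"] by simp
    qed simp
    moreover have "m \<epsilon> s - m \<epsilon> t = (P (s + \<epsilon>) - P (s - \<epsilon>) - (P (t + \<epsilon>) - P (t - \<epsilon>))) / (2 * \<epsilon>)"
      by (simp add: m_def diff_divide_distrib)
    ultimately show "\<bar>m \<epsilon> s - m \<epsilon> t\<bar> \<le> B * \<bar>s - t\<bar> powr \<gamma>"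
      using \<epsilon> by (simp only: abs_divide) (simp add: divide_le_eq ac_simps)
    have "\<bar>P (t + \<epsilon>) - P (t - \<epsilon>) - 2 * \<epsilon> * g t\<bar> \<le> (2 * B * \<epsilon> powr \<gamma>) * \<epsilon>"
    proof (rule mvt[OF \<epsilon>])
      fix x
      show "((\<lambda>\<epsilon>. P (t + \<epsilon>) - P (t - \<epsilon>) - 2 * \<epsilon> * g t) has_real_derivative
          (g (t + x) - - g (t - x) - 2 * 1 * g t)) (at x)"
        by (intro DERIV_diff P_plus P_minus) (auto intro!: derivative_eq_intros)
      assume x: "0 < x" "x < \<epsilon>"
      then have "B * x powr \<gamma> \<le> B * \<epsilon> powr \<gamma>"
        using B \<gamma> by (intro mult_left_mono powr_mono2) auto
      then show "\<bar>g (t + x) - - g (t - x) - 2 * 1 * g t\<bar> \<le> 2 * B * \<epsilon> powr \<gamma>"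
        using g[of "t + x" t] g[of "t - x" t] x by simp
    qed simp
    moreover have "m \<epsilon> t - g t = (P (t + \<epsilon>) - P (t - \<epsilon>) - 2 * \<epsilon> * g t) / (2 * \<epsilon>)"
      using \<epsilon> by (simp add: m_def diff_divide_distrib)
    ultimately show "\<bar>m \<epsilon> t - g t\<bar> \<le> B * \<epsilon> powr \<gamma>"
      using \<epsilon> by (simp only: abs_divide) (simp add: divide_le_eq ac_simps)
  qed
qed

text \<open>The symmetric approximations are the integrals of \<open>f\<close> against the mollifications of \<open>g\<close>. These
  have the Hoelder constant of \<open>g\<close>, so the estimate for smooth integrators holds uniformly in
  \<open>\<epsilon>\<close>. Convergence follows from the same estimate, applied to the difference of two
  mollifications.\<close>
theorem young_symmetric_integral:
  fixes f g :: "real \<Rightarrow> real"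
  assumes \<theta>: "1 < \<beta> + \<gamma>" and \<beta>: "0 < \<beta>" and \<gamma>: "0 < \<gamma>"
    and f: "\<And>s t. s \<in> {0..1} \<Longrightarrow> t \<in> {0..1} \<Longrightarrow> \<bar>f s - f t\<bar> \<le> A * \<bar>s - t\<bar> powr \<beta>"
    and g: "\<And>s t. \<bar>g s - g t\<bar> \<le> B * \<bar>s - t\<bar> powr \<gamma>"
  obtains I C where
    "uniform_limit {0..1} (\<lambda>\<epsilon> t. 1 / (2 * \<epsilon>) * integral {0..t} (\<lambda>r. f r * (g (r + \<epsilon>) - g (r - \<epsilon>)))) I (at_right 0)"
    "\<And>u v. 0 \<le> u \<Longrightarrow> u \<le> v \<Longrightarrow> v \<le> 1 \<Longrightarrow> \<bar>I v - I u - f u * (g v - g u)\<bar> \<le> C * (v - u) powr (\<beta> + \<gamma>)"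
proof -
  have A: "A \<ge> 0" using f[of 1 0] by simp
  have B: "B \<ge> 0" using g[of 1 0] by simp
  have f_cont: "continuous_on {0..1} f"
    using \<beta> f by (rule hoelder_imp_continuous_on)
  have g_cont: "continuous_on UNIV g"
    using \<gamma> g by (rule hoelder_imp_continuous_on)
  obtain m where m': "\<And>\<epsilon> t. \<epsilon> > 0 \<Longrightarrow> (m \<epsilon> has_real_derivative (g (t + \<epsilon>) - g (t - \<epsilon>)) / (2 * \<epsilon>)) (at t)"
    and m_h: "\<And>\<epsilon> s t. \<epsilon> > 0 \<Longrightarrow> \<bar>m \<epsilon> s - m \<epsilon> t\<bar> \<le> B * \<bar>s - t\<bar> powr \<gamma>"
    and m_g: "\<And>\<epsilon> t. \<epsilon> > 0 \<Longrightarrow> \<bar>m \<epsilon> t - g t\<bar> \<le> B * \<epsilon> powr \<gamma>"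
    using mollification[OF \<gamma> g] by blast
  define d where "d \<epsilon> r = (g (r + \<epsilon>) - g (r - \<epsilon>)) / (2 * \<epsilon>)" for \<epsilon> r
  have d_cont: "continuous_on T (d \<epsilon>)" if "\<epsilon> > 0" for T \<epsilon>
    unfolding d_def using that
    by (intro continuous_intros continuous_on_compose2[OF g_cont]) auto
  define S where "S \<epsilon> t = integral {0..t} (\<lambda>r. f r * d \<epsilon> r)" for \<epsilon> t
  have S_eq: "S \<epsilon> t = 1 / (2 * \<epsilon>) * integral {0..t} (\<lambda>r. f r * (g (r + \<epsilon>) - g (r - \<epsilon>)))" for \<epsilon> t
    by (simp add: S_def d_def mult.commute flip: integral_mult_right)
  have int: "(\<lambda>r. f r * d \<epsilon> r) integrable_on {u..v}" if "\<epsilon> > 0" "0 \<le> u" "v \<le> 1" for \<epsilon> u v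
    using that by (intro integrable_continuous_interval continuous_intros d_cont
        continuous_on_subset[OF f_cont]) auto
  \<comment> \<open>A slightly smaller exponent \<open>\<kappa>\<close> still satisfies Young's condition, and in the corresponding
    Hoelder norm the mollifications converge.\<close>
  obtain \<kappa> where \<kappa>: "max 0 (1 - \<beta>) < \<kappa>" "\<kappa> < \<gamma>"
    using dense[of "max 0 (1 - \<beta>)" \<gamma>] \<theta> \<gamma> by auto
  \<comment> \<open>Interpolation: for \<open>\<bar>s - t\<bar> \<le> \<rho>\<close> the Hoelder bound is used, otherwise the distance to \<open>g\<close>.\<close>
  have m_diff: "\<bar>(m \<epsilon> s - m \<epsilon>' s) - (m \<epsilon> t - m \<epsilon>' t)\<bar> \<le> 4 * B * \<rho> powr (\<gamma> - \<kappa>) * \<bar>s - t\<bar> powr \<kappa>"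
    if e: "0 < \<epsilon>" "\<epsilon> \<le> \<rho>" "0 < \<epsilon>'" "\<epsilon>' \<le> \<rho>" for \<epsilon> \<epsilon>' \<rho> s t
  proof (cases "\<bar>s - t\<bar> \<le> \<rho>")
    case True
    have "\<bar>(m \<epsilon> s - m \<epsilon>' s) - (m \<epsilon> t - m \<epsilon>' t)\<bar> \<le> 2 * B * \<bar>s - t\<bar> powr \<gamma>"
      using m_h[OF e(1), of s t] m_h[OF e(3), of s t] by simp
    also have "\<bar>s - t\<bar> powr \<gamma> = \<bar>s - t\<bar> powr (\<gamma> - \<kappa>) * \<bar>s - t\<bar> powr \<kappa>"
      by (simp flip: powr_add)
    also have "2 * B * (\<bar>s - t\<bar> powr (\<gamma> - \<kappa>) * \<bar>s - t\<bar> powr \<kappa>) \<le> 4 * B * (\<rho> powr (\<gamma> - \<kappa>) * \<bar>s - t\<bar> powr \<kappa>)"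
      using True \<kappa> B by (intro mult_mono powr_mono2) auto
    finally show ?thesis by (simp add: mult.assoc)
  next
    case False
    have *: "B * \<epsilon> powr \<gamma> \<le> B * \<rho> powr \<gamma>" "B * \<epsilon>' powr \<gamma> \<le> B * \<rho> powr \<gamma>"
      using e \<gamma> B by (auto intro!: mult_left_mono powr_mono2)
    have "\<bar>(m \<epsilon> s - m \<epsilon>' s) - (m \<epsilon> t - m \<epsilon>' t)\<bar> \<le> 4 * B * \<rho> powr \<gamma>"
      using m_g[OF e(1), of s] m_g[OF e(3), of s] m_g[OF e(1), of t] m_g[OF e(3), of t] * by linarith
    also have "\<rho> powr \<gamma> = \<rho> powr (\<gamma> - \<kappa>) * \<rho> powr \<kappa>"
      by (simp flip: powr_add)
    also have "4 * B * (\<rho> powr (\<gamma> - \<kappa>) * \<rho> powr \<kappa>) \<le> 4 * B * (\<rho> powr (\<gamma> - \<kappa>) * \<bar>s - t\<bar> powr \<kappa>)"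
      using False \<kappa> B e by (intro mult_left_mono powr_mono2) auto
    finally show ?thesis by (simp add: mult.assoc)
  qed
  define K where "K = \<bar>f 0\<bar> * (4 * B) + A * (4 * B) / (2 powr (\<beta> + \<kappa>) - 2)"
  have S_diff: "\<bar>S \<epsilon> t - S \<epsilon>' t\<bar> \<le> K * \<rho> powr (\<gamma> - \<kappa>)"
    if e: "0 < \<epsilon>" "\<epsilon> \<le> \<rho>" "0 < \<epsilon>'" "\<epsilon>' \<le> \<rho>" and t: "t \<in> {0..1}" for \<epsilon> \<epsilon>' \<rho> t
  proof -
    define D where "D r = m \<epsilon> r - m \<epsilon>' r" for r
    define B' where "B' = 4 * B * \<rho> powr (\<gamma> - \<kappa>)"
    have B': "B' \<ge> 0" using B by (simp add: B'_def)
    have p: "(2::real) powr (\<beta> + \<kappa>) > 2"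
      using \<kappa> powr_less_mono[of 1 "\<beta> + \<kappa>" "2::real"] by simp
    have "\<bar>integral {0..t} (\<lambda>r. f r * (d \<epsilon> r - d \<epsilon>' r)) - f 0 * (D t - D 0)\<bar>
        \<le> A * B' / (2 powr (\<beta> + \<kappa>) - 2) * (t - 0) powr (\<beta> + \<kappa>)"
    proof (rule young_smooth_integrator[where a = 0 and b = 1])
      show "1 < \<beta> + \<kappa>" using \<kappa> by simp
      show "\<bar>D s - D t\<bar> \<le> B' * \<bar>s - t\<bar> powr \<kappa>" for s t
        using m_diff[OF e] by (simp add: D_def B'_def)
      show "(D has_real_derivative d \<epsilon> t - d \<epsilon>' t) (at t)" for t
        unfolding D_def d_def using e by (intro DERIV_diff m') auto
    qed (use \<beta> A B' f t e in \<open>auto intro!: continuous_intros d_cont\<close>)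
    also have "\<dots> \<le> A * B' / (2 powr (\<beta> + \<kappa>) - 2) * 1"
      using A B' p t \<beta> \<kappa> by (intro mult_left_mono powr_le1) auto
    finally have 1: "\<bar>integral {0..t} (\<lambda>r. f r * (d \<epsilon> r - d \<epsilon>' r)) - f 0 * (D t - D 0)\<bar>
        \<le> A * B' / (2 powr (\<beta> + \<kappa>) - 2)" by simp
    have "\<bar>D t - D 0\<bar> \<le> B' * \<bar>t - 0\<bar> powr \<kappa>"
      using m_diff[OF e, of t 0] by (simp add: D_def B'_def)
    also have "\<dots> \<le> B' * 1"
      using B' t \<kappa> by (intro mult_left_mono powr_le1) auto
    finally have 2: "\<bar>f 0 * (D t - D 0)\<bar> \<le> \<bar>f 0\<bar> * B'"
      by (simp add: abs_mult mult_left_mono)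
    have "S \<epsilon> t - S \<epsilon>' t = integral {0..t} (\<lambda>r. f r * (d \<epsilon> r - d \<epsilon>' r))"
      unfolding S_def using int[of \<epsilon> 0 t] int[of \<epsilon>' 0 t] e t
      by (subst Henstock_Kurzweil_Integration.integral_diff[symmetric]) (auto simp: algebra_simps)
    then have "\<bar>S \<epsilon> t - S \<epsilon>' t\<bar> \<le> \<bar>f 0\<bar> * B' + A * B' / (2 powr (\<beta> + \<kappa>) - 2)"
      using 1 2 by linarith
    also have "\<dots> = K * \<rho> powr (\<gamma> - \<kappa>)" by (simp add: K_def B'_def field_simps)
    finally show ?thesis .
  qed
  have rate: "((\<lambda>\<epsilon>. K * \<epsilon> powr (\<gamma> - \<kappa>)) \<longlongrightarrow> 0) (at_right 0)"
    using \<kappa> by (intro tendsto_powr_at_right_0) simp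
  define I where "I t = lim (\<lambda>n. S (1 / real (Suc n)) t)" for t
  have S_I: "\<bar>S \<epsilon> t - I t\<bar> \<le> K * \<epsilon> powr (\<gamma> - \<kappa>)" if e: "\<epsilon> > 0" and t: "t \<in> {0..1}" for \<epsilon> t
  proof (rule tendsto_upperbound)
    have "\<bar>S (1 / real (Suc n)) t - S (1 / real (Suc k)) t\<bar> \<le> K * (1 / real (Suc k)) powr (\<gamma> - \<kappa>)"
      if "k \<le> n" for k n
      using that by (intro S_diff t) (auto simp: frac_le)
    from limit_with_rate(1)[OF filterlim_compose[OF rate filterlim_inverse_Suc_at_right] this]
    have "(\<lambda>n. S (1 / real (Suc n)) t) \<longlonglongrightarrow> I t" by (simp add: I_def)
    then show "(\<lambda>n. \<bar>S \<epsilon> t - S (1 / real (Suc n)) t\<bar>) \<longlonglongrightarrow> \<bar>S \<epsilon> t - I t\<bar>"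
      by (intro tendsto_intros)
    have "\<forall>\<^sub>F n in sequentially. 1 / real (Suc n) < \<epsilon>"
      using order_tendstoD(2)[OF LIMSEQ_Suc[OF lim_1_over_n]] e by blast
    then show "\<forall>\<^sub>F n in sequentially. \<bar>S \<epsilon> t - S (1 / real (Suc n)) t\<bar> \<le> K * \<epsilon> powr (\<gamma> - \<kappa>)"
      by eventually_elim (use S_diff e t in auto)
  qed simp
  have ulim: "uniform_limit {0..1} S I (at_right 0)"
  proof (rule uniform_limitI)
    fix e :: real assume "e > 0"
    then have "\<forall>\<^sub>F \<epsilon> in at_right 0. K * \<epsilon> powr (\<gamma> - \<kappa>) < e"
      using rate by (auto dest: order_tendstoD)
    moreover have "\<forall>\<^sub>F \<epsilon> in at_right 0. \<epsilon> > (0::real)"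
      by (simp add: eventually_at_filter)
    ultimately show "\<forall>\<^sub>F \<epsilon> in at_right 0. \<forall>x\<in>{0..1}. dist (S \<epsilon> x) (I x) < e"
      by eventually_elim (use S_I in \<open>force simp: dist_real_def\<close>)
  qed
  define C where "C = A * B / (2 powr (\<beta> + \<gamma>) - 2)"
  have est: "\<bar>I v - I u - f u * (g v - g u)\<bar> \<le> C * (v - u) powr (\<beta> + \<gamma>)"
    if uv: "0 \<le> u" "u \<le> v" "v \<le> 1" for u v
  proof (rule tendsto_upperbound)
    have m_lim: "((\<lambda>\<epsilon>. m \<epsilon> t) \<longlongrightarrow> g t) (at_right 0)" for t
    proof -
      have "((\<lambda>\<epsilon>. m \<epsilon> t - g t) \<longlongrightarrow> 0) (at_right 0)"
        using m_g by (intro Lim_null_comparison[OF _ tendsto_powr_at_right_0[OF \<gamma>, where C = B]])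
          (auto simp: eventually_at_filter intro!: always_eventually)
      then show ?thesis by (simp add: Lim_null[symmetric])
    qed
    show "((\<lambda>\<epsilon>. \<bar>S \<epsilon> v - S \<epsilon> u - f u * (m \<epsilon> v - m \<epsilon> u)\<bar>) \<longlongrightarrow> \<bar>I v - I u - f u * (g v - g u)\<bar>) (at_right 0)"
      using uv by (intro tendsto_intros m_lim tendsto_uniform_limitI[OF ulim]) auto
    show "\<forall>\<^sub>F \<epsilon> in at_right 0. \<bar>S \<epsilon> v - S \<epsilon> u - f u * (m \<epsilon> v - m \<epsilon> u)\<bar> \<le> C * (v - u) powr (\<beta> + \<gamma>)"
      unfolding eventually_at_filter
    proof (intro always_eventually allI impI)
      fix \<epsilon> :: real assume "\<epsilon> \<in> {0<..}"
      then have e: "\<epsilon> > 0" by simp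
      have "S \<epsilon> v - S \<epsilon> u = integral {u..v} (\<lambda>r. f r * d \<epsilon> r)"
        using Henstock_Kurzweil_Integration.integral_combine[OF uv(1,2) int[OF e order_refl uv(3)]]
        by (simp add: S_def)
      moreover have "\<bar>integral {u..v} (\<lambda>r. f r * d \<epsilon> r) - f u * (m \<epsilon> v - m \<epsilon> u)\<bar>
        \<le> A * B / (2 powr (\<beta> + \<gamma>) - 2) * (v - u) powr (\<beta> + \<gamma>)"
        by (rule young_smooth_integrator[where a = 0 and b = 1])
          (use \<theta> \<beta> A B f m_h[OF e] m'[OF e] uv e in \<open>auto simp: d_def[symmetric] intro!: d_cont\<close>)
      ultimately show "\<bar>S \<epsilon> v - S \<epsilon> u - f u * (m \<epsilon> v - m \<epsilon> u)\<bar> \<le> C * (v - u) powr (\<beta> + \<gamma>)"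
        by (simp add: C_def)
    qed
  qed simp
  show ?thesis
    using ulim est by (intro that[of I C]) (simp_all add: S_eq[abs_def])
qed

section \<open>Negligible increments\<close>

text \<open>Errors of order \<open>o(v - u)\<close>, uniformly on \<open>{p..q}\<close>. Both the stochastic equation and its
  transformed version are compared with first-order expansions up to such errors.\<close>
definition negligible_incr :: "real \<Rightarrow> real \<Rightarrow> (real \<Rightarrow> real \<Rightarrow> real) \<Rightarrow> bool" where
  "negligible_incr p q R \<longleftrightarrow>
     (\<forall>e>0. \<exists>d>0. \<forall>u v. p \<le> u \<and> u \<le> v \<and> v \<le> q \<and> v - u < d \<longrightarrow> \<bar>R u v\<bar> \<le> e * (v - u))"

lemma negligible_incrD:
  assumes "negligible_incr p q R" "e > 0"
  obtains d where "d > 0"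
    "\<And>u v. p \<le> u \<Longrightarrow> u \<le> v \<Longrightarrow> v \<le> q \<Longrightarrow> v - u < d \<Longrightarrow> \<bar>R u v\<bar> \<le> e * (v - u)"
  using assms unfolding negligible_incr_def by meson

lemma negligible_incr_add:
  assumes "negligible_incr p q R" "negligible_incr p q R'"
  shows "negligible_incr p q (\<lambda>u v. R u v + R' u v)"
  unfolding negligible_incr_def
proof (intro allI impI)
  fix e :: real assume e: "e > 0"
  obtain d where d: "d > 0"
    "\<And>u v. p \<le> u \<Longrightarrow> u \<le> v \<Longrightarrow> v \<le> q \<Longrightarrow> v - u < d \<Longrightarrow> \<bar>R u v\<bar> \<le> e / 2 * (v - u)"
    using negligible_incrD[OF assms(1), of "e / 2"] e by auto
  obtain d' where d': "d' > 0"
    "\<And>u v. p \<le> u \<Longrightarrow> u \<le> v \<Longrightarrow> v \<le> q \<Longrightarrow> v - u < d' \<Longrightarrow> \<bar>R' u v\<bar> \<le> e / 2 * (v - u)"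
    using negligible_incrD[OF assms(2), of "e / 2"] e by auto
  have "\<bar>R u v + R' u v\<bar> \<le> e * (v - u)" if "p \<le> u \<and> u \<le> v \<and> v \<le> q \<and> v - u < min d d'" for u v
    using d(2)[of u v] d'(2)[of u v] that by (simp add: field_simps)
  then show "\<exists>d>0. \<forall>u v. p \<le> u \<and> u \<le> v \<and> v \<le> q \<and> v - u < d \<longrightarrow> \<bar>R u v + R' u v\<bar> \<le> e * (v - u)"
    using d(1) d'(1) by (intro exI[of _ "min d d'"]) auto
qed

lemma negligible_incr_cmult:
  assumes R: "negligible_incr p q R"
    and k: "\<And>u v. p \<le> u \<Longrightarrow> u \<le> v \<Longrightarrow> v \<le> q \<Longrightarrow> \<bar>k u v\<bar> \<le> B"
  shows "negligible_incr p q (\<lambda>u v. k u v * R u v)"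
  unfolding negligible_incr_def
proof (intro allI impI)
  fix e :: real assume e: "e > 0"
  define B' where "B' = \<bar>B\<bar> + 1"
  have B': "B' > 0" "B \<le> B'" by (auto simp: B'_def)
  obtain d where d: "d > 0"
    "\<And>u v. p \<le> u \<Longrightarrow> u \<le> v \<Longrightarrow> v \<le> q \<Longrightarrow> v - u < d \<Longrightarrow> \<bar>R u v\<bar> \<le> e / B' * (v - u)"
    using negligible_incrD[OF R, of "e / B'"] e B' by auto
  have "\<bar>k u v * R u v\<bar> \<le> e * (v - u)" if uv: "p \<le> u \<and> u \<le> v \<and> v \<le> q \<and> v - u < d" for u v
  proof -
    have "\<bar>k u v\<bar> * \<bar>R u v\<bar> \<le> B' * (e / B' * (v - u))"
      using k[of u v] d(2)[of u v] uv B' by (intro mult_mono) auto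
    then show ?thesis using B' by (simp add: abs_mult)
  qed
  then show "\<exists>d>0. \<forall>u v. p \<le> u \<and> u \<le> v \<and> v \<le> q \<and> v - u < d \<longrightarrow> \<bar>k u v * R u v\<bar> \<le> e * (v - u)"
    using d(1) by blast
qed

lemma negligible_incr_diff:
  assumes "negligible_incr p q R" "negligible_incr p q R'"
  shows "negligible_incr p q (\<lambda>u v. R u v - R' u v)"
  using negligible_incr_add[OF assms(1) negligible_incr_cmult[OF assms(2), of "\<lambda>_ _. -1" 1]] by simp

lemma negligible_incr_cong:
  assumes "negligible_incr p q R"
    and "\<And>u v. p \<le> u \<Longrightarrow> u \<le> v \<Longrightarrow> v \<le> q \<Longrightarrow> R' u v = R u v"
  shows "negligible_incr p q R'"
  using assms unfolding negligible_incr_def by (metis (no_types, lifting))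

lemma negligible_incr_powr:
  assumes \<theta>: "\<theta> > 1"
    and R: "\<And>u v. p \<le> u \<Longrightarrow> u \<le> v \<Longrightarrow> v \<le> q \<Longrightarrow> \<bar>R u v\<bar> \<le> C * (v - u) powr \<theta>"
  shows "negligible_incr p q R"
  unfolding negligible_incr_def
proof (intro allI impI)
  fix e :: real assume e: "e > 0"
  define C' where "C' = \<bar>C\<bar> + 1"
  have C': "C' > 0" "C \<le> C'" by (auto simp: C'_def)
  define d where "d = (e / C') powr (1 / (\<theta> - 1))"
  have d: "d > 0" using e C' by (simp add: d_def)
  have "\<bar>R u v\<bar> \<le> e * (v - u)" if uv: "p \<le> u \<and> u \<le> v \<and> v \<le> q \<and> v - u < d" for u v
  proof -
    have "(v - u) powr (\<theta> - 1) \<le> d powr (\<theta> - 1)"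
      using uv \<theta> by (intro powr_mono2) auto
    also have "\<dots> = e / C'" using \<theta> e C' by (simp add: d_def powr_powr)
    finally have 1: "C' * (v - u) powr (\<theta> - 1) \<le> e" using C' by (simp add: field_simps)
    have "\<bar>R u v\<bar> \<le> C' * (v - u) powr \<theta>"
      using R[of u v] uv mult_right_mono[OF C'(2), of "(v - u) powr \<theta>"] by auto
    also have "(v - u) powr \<theta> = (v - u) powr (\<theta> - 1) * (v - u)"
    proof (cases "v = u")
      case False
      then show ?thesis using uv powr_mult_base[of "v - u" "\<theta> - 1"] by (simp add: mult.commute)
    qed simp
    also have "C' * ((v - u) powr (\<theta> - 1) * (v - u)) \<le> e * (v - u)"
      using mult_right_mono[OF 1, of "v - u"] uv by (simp add: mult.assoc)
    finally show ?thesis .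
  qed
  then show "\<exists>d>0. \<forall>u v. p \<le> u \<and> u \<le> v \<and> v \<le> q \<and> v - u < d \<longrightarrow> \<bar>R u v\<bar> \<le> e * (v - u)"
    using d by blast
qed

text \<open>An increment \<open>D v - D u\<close> that is negligible says that \<open>D\<close> has derivative zero. This turns
  expansions up to negligible errors into identities.\<close>
lemma negligible_incr_imp_constant:
  assumes "negligible_incr p q (\<lambda>u v. D v - D u)" and t: "t \<in> {p..q}"
  shows "D t = D p"
proof -
  have "(D has_real_derivative 0) (at x within {p..q})" if x: "x \<in> {p..q}" for x
    unfolding has_field_derivative_iff tendsto_iff eventually_at
  proof (intro allI impI)
    fix e :: real assume e: "e > 0"
    obtain d where d: "d > 0"
      "\<And>u v. p \<le> u \<Longrightarrow> u \<le> v \<Longrightarrow> v \<le> q \<Longrightarrow> v - u < d \<Longrightarrow> \<bar>D v - D u\<bar> \<le> e / 2 * (v - u)"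
      using negligible_incrD[OF assms(1), of "e / 2"] e by auto
    have "dist ((D y - D x) / (y - x)) 0 < e"
      if y: "y \<in> {p..q}" "y \<noteq> x" "dist y x < d" for y
    proof -
      have "\<bar>D y - D x\<bar> \<le> e / 2 * \<bar>y - x\<bar>"
        using d(2)[of x y] d(2)[of y x] x y by (cases "x \<le> y") (auto simp: dist_real_def abs_minus_commute)
      also have "\<dots> < e * \<bar>y - x\<bar>" using e y by simp
      finally show ?thesis using y by (simp add: dist_real_def divide_less_eq)
    qed
    then show "\<exists>d>0. \<forall>y\<in>{p..q}. y \<noteq> x \<and> dist y x < d \<longrightarrow> dist ((D y - D x) / (y - x)) 0 < e"
      using d(1) by blast
  qed
  then have "\<exists>c. \<forall>x\<in>{p..q}. D x = c"
    by (intro has_field_derivative_zero_constant) auto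
  then show ?thesis using t by fastforce
qed

section \<open>Integral inequalities and Picard iteration\<close>

lemma bounded_measurable_integral:
  fixes f :: "real \<Rightarrow> real"
  assumes f: "f \<in> borel_measurable borel"
    and B: "\<And>s. s \<in> {p..q} \<Longrightarrow> \<bar>f s\<bar> \<le> B"
  shows "set_integrable lborel {p..q} f" "f integrable_on {p..q}"
    "(LINT s:{p..q}|lborel. f s) = integral {p..q} f"
    "p \<le> q \<Longrightarrow> \<bar>integral {p..q} f\<bar> \<le> B * (q - p)"
proof -
  show *: "set_integrable lborel {p..q} f"
    unfolding set_integrable_def
  proof (rule integrableI_bounded_set[where A = "{p..q}" and B = B])
    show "(\<lambda>x. indicat_real {p..q} x *\<^sub>R f x) \<in> borel_measurable lborel"
      using f by simp
    show "AE x in lborel. x \<in> {p..q} \<longrightarrow> norm (indicat_real {p..q} x *\<^sub>R f x) \<le> B"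
      using B by auto
  qed (auto simp: emeasure_lborel_Icc_eq)
  show i: "f integrable_on {p..q}" and "(LINT s:{p..q}|lborel. f s) = integral {p..q} f"
    using set_borel_integral_eq_integral[OF *] by auto
  show "\<bar>integral {p..q} f\<bar> \<le> B * (q - p)" if "p \<le> q"
    using integral_norm_bound_integral[OF i integrable_const_ivl, of B] B that by (simp add: mult.commute)
qed

lemma exp_integral:
  fixes a p t :: real
  assumes "p \<le> t"
  shows "((\<lambda>s. a * exp (a * (s - p))) has_integral (exp (a * (t - p)) - 1)) {p..t}"
proof -
  have "((\<lambda>s. a * exp (a * (s - p))) has_integral (exp (a * (t - p)) - exp (a * (p - p)))) {p..t}"
    using assms by (intro fundamental_theorem_of_calculus)
      (auto simp: has_real_derivative_iff_has_vector_derivative[symmetric] intro!: derivative_eq_intros)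
  then show ?thesis by simp
qed

text \<open>Inserting the bound into its own integral reproduces the term \<open>A * exp (a * (t - p))\<close> exactly and
  halves a remainder of the form \<open>exp (2 * a * (t - p))\<close>, so that the remainder can be iterated
  away, starting from any upper bound of \<open>f\<close>.\<close>
lemma gronwall:
  fixes f :: "real \<Rightarrow> real"
  assumes int: "f integrable_on {p..q}" and bd: "\<And>t. t \<in> {p..q} \<Longrightarrow> f t \<le> B"
    and A: "0 \<le> A" and a: "0 \<le> a"
    and ineq: "\<And>t. t \<in> {p..q} \<Longrightarrow> f t \<le> A + a * integral {p..t} f"
    and t: "t \<in> {p..q}"
  shows "f t \<le> A * exp (a * (t - p))"
proof -
  define B' where "B' = max B 0"
  have step: "f t \<le> A * exp (a * (t - p)) + B' * (1 / 2) ^ k * exp (2 * a * (t - p))"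
    if "t \<in> {p..q}" for t k
    using that
  proof (induction k arbitrary: t)
    case 0
    have "f t \<le> B'" using bd[OF 0] by (simp add: B'_def)
    also have "B' \<le> B' * exp (2 * a * (t - p))"
      using 0 a by (intro mult_right_mono[of 1, simplified] mult_le_cancel_left1[THEN iffD2]) (auto simp: B'_def)
    finally show ?case using A by (simp add: add_increasing)
  next
    case (Suc k)
    let ?g = "\<lambda>s. A * (a * exp (a * (s - p))) + B' * (1 / 2) ^ Suc k * ((2 * a) * exp ((2 * a) * (s - p)))"
    have g: "(?g has_integral A * (exp (a * (t - p)) - 1)
        + B' * (1 / 2) ^ Suc k * (exp ((2 * a) * (t - p)) - 1)) {p..t}"
      using Suc.prems by (intro has_integral_add has_integral_mult_right exp_integral) auto
    have "integral {p..t} (\<lambda>s. a * f s) \<le> integral {p..t} ?g"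
    proof (rule integral_le)
      have "f integrable_on {p..t}"
        using int Suc.prems by (intro integrable_subinterval_real[OF int]) auto
      then show "(\<lambda>s. a * f s) integrable_on {p..t}" by (rule integrable_on_mult_right)
      show "?g integrable_on {p..t}" using g by blast
      fix s assume "s \<in> {p..t}"
      then have "a * f s \<le> a * (A * exp (a * (s - p)) + B' * (1 / 2) ^ k * exp (2 * a * (s - p)))"
        using Suc a by (intro mult_left_mono) auto
      then show "a * f s \<le> ?g s" by (simp add: algebra_simps)
    qed
    also have "integral {p..t} ?g = A * (exp (a * (t - p)) - 1)
        + B' * (1 / 2) ^ Suc k * (exp ((2 * a) * (t - p)) - 1)"
      using g by (rule integral_unique)
    finally have "a * integral {p..t} f \<le> A * (exp (a * (t - p)) - 1)
        + B' * (1 / 2) ^ Suc k * (exp ((2 * a) * (t - p)) - 1)" by simp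
    moreover have "0 \<le> B' * (1 / 2) ^ Suc k" by (simp add: B'_def)
    ultimately show ?case using ineq[OF Suc.prems] by (simp only: right_diff_distrib mult_1_right)
  qed
  have "(\<lambda>k. A * exp (a * (t - p)) + B' * (1 / 2) ^ k * exp (2 * a * (t - p)))
      \<longlonglongrightarrow> A * exp (a * (t - p)) + B' * 0 * exp (2 * a * (t - p))"
    by (intro tendsto_intros LIMSEQ_realpow_zero) auto
  then have "f t \<le> A * exp (a * (t - p)) + B' * 0 * exp (2 * a * (t - p))"
    using step[OF t] by (intro LIMSEQ_le_const) auto
  then show ?thesis by simp
qed

lemma gronwall_backward:
  fixes f :: "real \<Rightarrow> real"
  assumes int: "f integrable_on {p..q}" and bd: "\<And>t. t \<in> {p..q} \<Longrightarrow> f t \<le> B"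
    and A: "0 \<le> A" and a: "0 \<le> a"
    and ineq: "\<And>t. t \<in> {p..q} \<Longrightarrow> f t \<le> A + a * integral {t..q} f"
    and t: "t \<in> {p..q}"
  shows "f t \<le> A * exp (a * (q - t))"
proof -
  have "f (- (- t)) \<le> A * exp (a * (- t - (- q)))"
  proof (rule gronwall[where q = "- p" and B = B])
    show "(\<lambda>t. f (- t)) integrable_on {- q..- p}"
      using int by (simp add: integrable_reflect_real)
    show "f (- s) \<le> A + a * integral {- q..s} (\<lambda>t. f (- t))" if "s \<in> {- q..- p}" for s
      using ineq[of "- s"] that Henstock_Kurzweil_Integration.integral_reflect_real[of "q" "- s" f] by simp
  qed (use bd A a t in auto)
  then show ?thesis by (simp add: algebra_simps)
qed

text \<open>Iteration for \<open>Y t = z t + integral {0..t} (\<lambda>s. b s (Y s))\<close>. The projected upper limit makes every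
  iterate a function on the whole line, so that it can be fed into Borel measurable functions.\<close>
primrec picard :: "(real \<Rightarrow> real) \<Rightarrow> (real \<Rightarrow> real \<Rightarrow> real) \<Rightarrow> nat \<Rightarrow> real \<Rightarrow> real" where
  "picard z b 0 t = 0"
| "picard z b (Suc k) t = z t + (LINT s:{0..proj01 t}|lborel. b s (picard z b k s))"

lemma proj01_in [simp]: "0 \<le> proj01 t" "proj01 t \<le> 1"
  by (auto simp: proj01_def)

lemma proj01_id: "t \<in> {0..1} \<Longrightarrow> proj01 t = t"
  by (auto simp: proj01_def)

lemma continuous_on_proj01: "continuous_on T proj01"
  unfolding proj01_def[abs_def] by (intro continuous_intros)

lemma continuous_on_comp_proj01:
  "continuous_on {0..1} f \<Longrightarrow> continuous_on T (\<lambda>t. f (proj01 t))"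
  by (rule continuous_on_compose2[OF _ continuous_on_proj01]) auto

text \<open>Local Lipschitz continuity is enough because the linear growth confines all iterates to one ball:
  if \<open>A\<close> bounds \<open>K + \<bar>z t\<bar>\<close>, then the bound \<open>A * exp (a * t)\<close> is inherited from one iterate to the
  next. The statement names the iterates because the measurability of solutions with respect to a
  random parameter is read off from them.\<close>
lemma picard_converges:
  fixes z :: "real \<Rightarrow> real" and b :: "real \<Rightarrow> real \<Rightarrow> real"
  assumes z: "continuous_on UNIV z"
    and meas: "\<And>y. y \<in> borel_measurable borel \<Longrightarrow> (\<lambda>s. b s (y s)) \<in> borel_measurable borel"
    and a: "0 \<le> a"
    and growth: "\<And>s y. s \<in> {0..1} \<Longrightarrow> \<bar>b s y\<bar> \<le> K + a * \<bar>y\<bar>"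
    and lip: "\<And>R. \<exists>L. \<forall>s\<in>{0..1}. \<forall>y y'. \<bar>y\<bar> \<le> R \<longrightarrow> \<bar>y'\<bar> \<le> R \<longrightarrow> \<bar>b s y - b s y'\<bar> \<le> L * \<bar>y - y'\<bar>"
  obtains Y where "\<And>t. t \<in> {0..1} \<Longrightarrow> (\<lambda>k. picard z b k t) \<longlonglongrightarrow> Y t"
    "Y \<in> borel_measurable borel" "continuous_on {0..1} Y"
    "\<And>t. t \<in> {0..1} \<Longrightarrow> Y t = z t + integral {0..t} (\<lambda>s. b s (Y s))"
proof -
  have K: "K \<ge> 0" using growth[of 0 0] by simp
  obtain Z where Z0: "Z \<ge> 0" and Z: "\<And>t. t \<in> {0..1} \<Longrightarrow> \<bar>z t\<bar> \<le> Z"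
    using continuous_on_Icc_bounded[OF continuous_on_subset[OF z]] by (metis subset_UNIV)
  define A where "A = Z + K"
  have A0: "A \<ge> 0" using Z0 K by (simp add: A_def)
  define R where "R = A * exp a"
  have A_R: "A * exp (a * t) \<le> R" if "t \<in> {0..1}" for t
    unfolding R_def using A0 a that by (intro mult_left_mono) (auto intro: mult_left_le)
  let ?Y = "picard z b"
  \<comment> \<open>The iterates stay in a fixed ball, on which \<open>b\<close> is Lipschitz continuous.\<close>
  have Y: "continuous_on UNIV (?Y k) \<and> (\<forall>t\<in>{0..1}. \<bar>?Y k t\<bar> \<le> A * exp (a * t))" for k
  proof (induction k)
    case 0
    then show ?case using A0 by simp
  next
    case (Suc k)
    let ?f = "\<lambda>s. b s (?Y k s)"
    have m: "?f \<in> borel_measurable borel"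
      using Suc by (intro meas borel_measurable_continuous_onI) auto
    have bd: "\<bar>?f s\<bar> \<le> K + a * (A * exp (a * s))" if "s \<in> {0..1}" for s
      using growth[OF that, of "?Y k s"] Suc that a by (smt (verit) mult_left_mono)
    have bd': "\<bar>?f s\<bar> \<le> K + a * R" if "s \<in> {0..1}" for s
      using bd[OF that] A_R[OF that] a by (smt (verit) mult_left_mono)
    note I = bounded_measurable_integral[OF m bd']
    have eq: "?Y (Suc k) = (\<lambda>t. z t + integral {0..proj01 t} ?f)"
    proof
      fix t
      show "?Y (Suc k) t = z t + integral {0..proj01 t} ?f"
        using bounded_measurable_integral(3)[OF m, of 0 "proj01 t" "K + a * R"] bd' proj01_in(2)[of t] by simp
    qed
    have "continuous_on {0..1} (\<lambda>t. integral {0..t} ?f)"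
      by (intro indefinite_integral_continuous_1 I(2)) auto
    then have "continuous_on UNIV (?Y (Suc k))"
      unfolding eq by (intro continuous_intros z continuous_on_comp_proj01)
    moreover have "\<bar>?Y (Suc k) t\<bar> \<le> A * exp (a * t)" if t: "t \<in> {0..1}" for t
    proof -
      have g: "((\<lambda>s. K + A * (a * exp (a * (s - 0)))) has_integral
          K * (t - 0) + A * (exp (a * (t - 0)) - 1)) {0..t}"
        using t has_integral_const_real[of K 0 t]
        by (intro has_integral_add has_integral_mult_right exp_integral) (auto simp: mult.commute)
      have "norm (integral {0..t} ?f) \<le> integral {0..t} (\<lambda>s. K + A * (a * exp (a * (s - 0))))"
      proof (rule integral_norm_bound_integral)
        show "?f integrable_on {0..t}"
          using bounded_measurable_integral(2)[OF m, of 0 t "K + a * R"] bd' t by simp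
        show "(\<lambda>s. K + A * (a * exp (a * (s - 0)))) integrable_on {0..t}" using g by blast
        show "norm (?f s) \<le> K + A * (a * exp (a * (s - 0)))" if "s \<in> {0..t}" for s
          using bd[of s] that t by (simp add: ac_simps)
      qed
      also have "\<dots> = K * t + A * (exp (a * t) - 1)" using integral_unique[OF g] by simp
      also have "\<dots> \<le> K * 1 + A * (exp (a * t) - 1)" using K t by (intro add_right_mono mult_left_mono) auto
      finally show ?thesis using Z[OF t] proj01_id[OF t] unfolding eq
        by (simp add: A_def algebra_simps)
    qed
    ultimately show ?case by blast
  qed
  have Y_R: "\<bar>?Y k t\<bar> \<le> R" if "t \<in> {0..1}" for k t
    using Y[of k] A_R[OF that] that by fastforce
  obtain L where L: "L > 0" "\<And>s y y'. s \<in> {0..1} \<Longrightarrow> \<bar>y\<bar> \<le> R \<Longrightarrow> \<bar>y'\<bar> \<le> R \<Longrightarrow> \<bar>b s y - b s y'\<bar> \<le> L * \<bar>y - y'\<bar>"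
  proof -
    obtain L where L: "\<forall>s\<in>{0..1}. \<forall>y y'. \<bar>y\<bar> \<le> R \<longrightarrow> \<bar>y'\<bar> \<le> R \<longrightarrow> \<bar>b s y - b s y'\<bar> \<le> L * \<bar>y - y'\<bar>"
      using lip by blast
    have "\<bar>b s y - b s y'\<bar> \<le> (\<bar>L\<bar> + 1) * \<bar>y - y'\<bar>" if "s \<in> {0..1}" "\<bar>y\<bar> \<le> R" "\<bar>y'\<bar> \<le> R" for s y y'
      using L that by (smt (verit) mult_right_mono abs_ge_self abs_ge_zero)
    then show ?thesis by (intro that[of "\<bar>L\<bar> + 1"]) auto
  qed
  have diff_int: "\<bar>integral {0..t} (\<lambda>s. b s (y s)) - integral {0..t} (\<lambda>s. b s (y' s))\<bar>
      \<le> integral {0..t} (\<lambda>s. L * g s)"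
    if t: "t \<in> {0..1}" and y: "y \<in> borel_measurable borel" "y' \<in> borel_measurable borel"
      and bd: "\<And>s. s \<in> {0..1} \<Longrightarrow> \<bar>y s\<bar> \<le> R" "\<And>s. s \<in> {0..1} \<Longrightarrow> \<bar>y' s\<bar> \<le> R"
      and g: "g integrable_on {0..t}" "\<And>s. s \<in> {0..t} \<Longrightarrow> \<bar>y s - y' s\<bar> \<le> g s" for t y y' g
  proof -
    have bd': "\<bar>b s (w s)\<bar> \<le> K + a * R" if "s \<in> {0..t}" "\<And>s. s \<in> {0..1} \<Longrightarrow> \<bar>w s\<bar> \<le> R" for s w
      using growth[of s "w s"] that t a by (smt (verit) mult_left_mono atLeastAtMost_iff)
    have i: "(\<lambda>s. b s (w s)) integrable_on {0..t}"
      if "w \<in> borel_measurable borel" "\<And>s. s \<in> {0..1} \<Longrightarrow> \<bar>w s\<bar> \<le> R" for w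
      using bounded_measurable_integral(2)[OF meas[OF that(1)], of 0 t "K + a * R"] bd' that(2) by blast
    have "norm (integral {0..t} (\<lambda>s. b s (y s) - b s (y' s))) \<le> integral {0..t} (\<lambda>s. L * g s)"
    proof (rule integral_norm_bound_integral)
      show "(\<lambda>s. b s (y s) - b s (y' s)) integrable_on {0..t}"
        by (intro integrable_diff i y bd)
      show "(\<lambda>s. L * g s) integrable_on {0..t}" using g(1) by (rule integrable_on_mult_right)
      fix s assume s: "s \<in> {0..t}"
      then have "\<bar>b s (y s) - b s (y' s)\<bar> \<le> L * \<bar>y s - y' s\<bar>" using t by (intro L bd) auto
      also have "\<dots> \<le> L * g s" using g(2)[OF s] L(1) by simp
      finally show "norm (b s (y s) - b s (y' s)) \<le> L * g s" by simp
    qed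
    then show ?thesis
      using Henstock_Kurzweil_Integration.integral_diff[OF i[OF y(1) bd(1)] i[OF y(2) bd(2)]] by simp
  qed
  have Y_meas: "?Y k \<in> borel_measurable borel" for k
    using Y by (intro borel_measurable_continuous_onI) auto
  have Y_Suc: "?Y (Suc k) t = z t + integral {0..t} (\<lambda>s. b s (?Y k s))" if t: "t \<in> {0..1}" for k t
  proof -
    have "\<bar>b s (?Y k s)\<bar> \<le> K + a * R" if "s \<in> {0..1}" for s
      using growth[OF that, of "?Y k s"] Y_R[OF that, of k] a by (smt (verit) mult_left_mono)
    then show ?thesis
      using bounded_measurable_integral(3)[OF meas[OF Y_meas[of k]], of 0 t "K + a * R"] t
      by (simp add: proj01_id)
  qed
  have R0: "R \<ge> 0" using A0 by (simp add: R_def)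
  \<comment> \<open>The weight \<open>exp (2 * L * t)\<close> makes the Picard map a contraction with factor \<open>1/2\<close>.\<close>
  have contr: "\<bar>?Y (Suc k) t - ?Y k t\<bar> \<le> R * (1 / 2) ^ k * exp ((2 * L) * (t - 0))" if "t \<in> {0..1}" for k t
    using that
  proof (induction k arbitrary: t)
    case 0
    have "1 \<le> exp ((2 * L) * (t - 0))" using 0 L(1) by simp
    then have "R * 1 \<le> R * exp ((2 * L) * (t - 0))" using R0 by (intro mult_left_mono)
    then show ?case using Y_R[OF 0, of 1] by simp
  next
    case (Suc k)
    have g: "((\<lambda>s. R * (1 / 2) ^ Suc k * ((2 * L) * exp ((2 * L) * (s - 0)))) has_integral
        R * (1 / 2) ^ Suc k * (exp ((2 * L) * (t - 0)) - 1)) {0..t}"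
      using Suc.prems by (intro has_integral_mult_right exp_integral) auto
    have "\<bar>?Y (Suc (Suc k)) t - ?Y (Suc k) t\<bar>
        \<le> integral {0..t} (\<lambda>s. L * (R * (1 / 2) ^ k * exp ((2 * L) * (s - 0))))"
      unfolding Y_Suc[OF Suc.prems] add_diff_cancel_left
      using Suc by (intro diff_int Y_meas Y_R) (auto intro!: integrable_continuous_interval continuous_intros)
    also have "(\<lambda>s. L * (R * (1 / 2) ^ k * exp ((2 * L) * (s - 0))))
        = (\<lambda>s. R * (1 / 2) ^ Suc k * ((2 * L) * exp ((2 * L) * (s - 0))))"
      by (auto simp: field_simps)
    also have "integral {0..t} \<dots> = R * (1 / 2) ^ Suc k * (exp ((2 * L) * (t - 0)) - 1)"
      using g by (rule integral_unique)
    also have "\<dots> \<le> R * (1 / 2) ^ Suc k * exp ((2 * L) * (t - 0))"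
      using R0 by (intro mult_left_mono) auto
    finally show ?case .
  qed
  define Q where "Q = R * exp (2 * L)"
  have Q0: "Q \<ge> 0" using R0 by (simp add: Q_def)
  have contr': "\<bar>?Y (Suc k) t - ?Y k t\<bar> \<le> Q * (1 / 2) ^ k" if t: "t \<in> {0..1}" for k t
  proof -
    have "R * (1 / 2) ^ k * exp ((2 * L) * (t - 0)) \<le> R * (1 / 2) ^ k * exp (2 * L)"
      using R0 L(1) t by (intro mult_left_mono) (auto intro: mult_left_le)
    then show ?thesis using contr[OF t, of k] by (simp add: Q_def ac_simps)
  qed
  have dist: "\<bar>?Y n t - ?Y k t\<bar> \<le> 2 * Q * (1 / 2) ^ k - 2 * Q * (1 / 2) ^ n"
    if t: "t \<in> {0..1}" and "k \<le> n" for n k t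
    using that(2)
  proof (induction n rule: dec_induct)
    case (step n)
    have "2 * Q * (1 / 2) ^ Suc n = 2 * Q * (1 / 2) ^ n - Q * (1 / 2) ^ n" by simp
    then show ?case using contr'[OF t, of n] step.IH by linarith
  qed simp
  have dist': "\<bar>?Y n t - ?Y k t\<bar> \<le> 2 * Q * (1 / 2) ^ k" if t: "t \<in> {0..1}" and "k \<le> n" for n k t
  proof -
    have "2 * Q * (1 / 2) ^ n \<ge> 0" using Q0 by simp
    then show ?thesis using dist[OF that] by linarith
  qed
  have rate: "(\<lambda>k. C * (1 / 2) ^ k) \<longlonglongrightarrow> 0" for C :: real
    using tendsto_mult[OF tendsto_const LIMSEQ_realpow_zero[of "1 / 2"], of C] by simp
  define Y0 where "Y0 t = lim (\<lambda>k. ?Y k (proj01 t))" for t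
  have lim: "(\<lambda>k. ?Y k t) \<longlonglongrightarrow> Y0 t" and Y0_dist: "\<bar>?Y k t - Y0 t\<bar> \<le> 2 * Q * (1 / 2) ^ k"
    if t: "t \<in> {0..1}" for k t
    using limit_with_rate[OF rate dist'[OF t]] by (simp_all add: Y0_def proj01_id[OF t])
  have Y0_meas: "Y0 \<in> borel_measurable borel"
    unfolding Y0_def[abs_def]
    by (intro borel_measurable_lim_metric measurable_compose[OF _ Y_meas]
        borel_measurable_continuous_onI continuous_on_proj01)
  have Y0_R: "\<bar>Y0 t\<bar> \<le> R" if "t \<in> {0..1}" for t
    by (rule LIMSEQ_le_const2[OF tendsto_rabs[OF lim[OF that]]]) (use Y_R[OF that] in auto)
  have eq: "Y0 t = z t + integral {0..t} (\<lambda>s. b s (Y0 s))" if t: "t \<in> {0..1}" for t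
  proof (rule LIMSEQ_unique)
    show "(\<lambda>k. ?Y (Suc k) t) \<longlonglongrightarrow> Y0 t" using lim[OF t] by (rule LIMSEQ_Suc)
    have "(\<lambda>k. integral {0..t} (\<lambda>s. b s (?Y k s)) - integral {0..t} (\<lambda>s. b s (Y0 s))) \<longlonglongrightarrow> 0"
    proof (rule Lim_null_comparison[OF always_eventually[OF allI] rate[of "t * L * (2 * Q)"]])
      fix k
      have "\<bar>integral {0..t} (\<lambda>s. b s (?Y k s)) - integral {0..t} (\<lambda>s. b s (Y0 s))\<bar>
          \<le> integral {0..t} (\<lambda>s. L * (2 * Q * (1 / 2) ^ k))"
        using t by (intro diff_int Y_meas Y0_meas Y_R Y0_R Y0_dist) auto
      then show "norm (integral {0..t} (\<lambda>s. b s (?Y k s)) - integral {0..t} (\<lambda>s. b s (Y0 s)))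
          \<le> t * L * (2 * Q) * (1 / 2) ^ k" using t by (simp add: ac_simps)
    qed
    then show "(\<lambda>k. ?Y (Suc k) t) \<longlonglongrightarrow> z t + integral {0..t} (\<lambda>s. b s (Y0 s))"
      unfolding Y_Suc[OF t] by (intro tendsto_intros) (simp add: Lim_null[symmetric])
  qed
  have "continuous_on {0..1} (\<lambda>t. z t + integral {0..t} (\<lambda>s. b s (Y0 s)))"
  proof (intro continuous_intros indefinite_integral_continuous_1 continuous_on_subset[OF z])
    have "\<bar>b s (Y0 s)\<bar> \<le> K + a * R" if "s \<in> {0..1}" for s
      using growth[OF that, of "Y0 s"] Y0_R[OF that] a by (smt (verit) mult_left_mono)
    then show "(\<lambda>s. b s (Y0 s)) integrable_on {0..1}"
      by (intro bounded_measurable_integral(2)[OF meas[OF Y0_meas]])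
  qed auto
  then have "continuous_on {0..1} Y0"
    by (rule continuous_on_eq) (simp add: eq)
  then show ?thesis using that lim Y0_meas eq by blast
qed

section \<open>The transformation H on a component\<close>

text \<open>The antiderivative of \<open>g t\<close> that vanishes at \<open>c\<close>. Rescaling to the fixed interval \<open>{0..1}\<close>
  gives continuity in both variables and differentiation in \<open>t\<close> from the theorems on parameter
  integrals, and treats \<open>x < c\<close> and \<open>x > c\<close> alike.\<close>
definition param_antideriv :: "real \<Rightarrow> (real \<Rightarrow> real \<Rightarrow> real) \<Rightarrow> real \<Rightarrow> real \<Rightarrow> real" where
  "param_antideriv c g t x = (x - c) * integral {0..1} (\<lambda>r. g t (c + r * (x - c)))"

lemma segment_in_convex:
  fixes c x r :: real
  assumes "convex J" "c \<in> J" "x \<in> J" "r \<in> {0..1}"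
  shows "c + r * (x - c) \<in> J"
  using convexD_alt[OF assms(1,2,3), of r] assms(4) by (simp add: algebra_simps)

context
  fixes J :: "real set" and c :: real and g :: "real \<Rightarrow> real \<Rightarrow> real"
  assumes J: "convex J" "open J" and c: "c \<in> J"
    and g: "continuous_on ({0..1} \<times> J) (\<lambda>(t, x). g t x)"
begin

lemma continuous_on_param_antideriv:
  "continuous_on ({0..1} \<times> J) (\<lambda>(t, x). param_antideriv c g t x)"
proof -
  have "continuous_on (({0..1} \<times> J) \<times> cbox 0 1) (\<lambda>(p, r). g (fst p) (c + r * (snd p - c)))"
    unfolding case_prod_beta by (rule continuous_on_case_prod_compose[OF g])
      (auto intro!: continuous_intros segment_in_convex[OF J(1) c])
  then have "continuous_on ({0..1} \<times> J) (\<lambda>p. integral (cbox 0 1) (\<lambda>r. g (fst p) (c + r * (snd p - c))))"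
    by (rule integral_continuous_on_param)
  then show ?thesis
    unfolding param_antideriv_def case_prod_beta by (intro continuous_intros) simp_all
qed

lemma param_antideriv_deriv_x:
  assumes t: "t \<in> {0..1}" and x: "x \<in> J"
  shows "(param_antideriv c g t has_real_derivative g t x) (at x)"
proof -
  define P where "P = param_antideriv c g t"
  have cont: "continuous_on J (g t)" using continuous_on_section[OF g t] .
  obtain e where e: "e > 0" "cball x e \<subseteq> J" using J(2) x open_contains_cball by blast
  define l where "l = min c (x - e)"
  define r where "r = max c (x + e)"
  have "x - e \<in> J" "x + e \<in> J" using e by (auto intro!: subsetD[OF e(2)] simp: dist_real_def)
  then have lr: "l \<in> J" "r \<in> J" using c by (auto simp: l_def r_def min_def max_def)
  have sub: "{l..r} \<subseteq> J"
    using lr J(1) by (metis closed_segment_eq_real_ivl closed_segment_subset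
        atLeastatMost_empty_iff empty_subsetI)
  have lx: "l < x" "x < r" "l \<le> c" "c \<le> r" using e by (auto simp: l_def r_def)
  define F where "F y = integral {l..y} (g t)" for y
  have F: "(F has_real_derivative g t y) (at y within {l..r})" if "y \<in> {l..r}" for y
    unfolding F_def using integral_has_real_derivative[OF continuous_on_subset[OF cont sub] that] .
  have P_F: "P y = F y - F c" if y: "y \<in> {l..r}" for y
  proof -
    have seg: "c + s * (y - c) \<in> {l..r}" if "s \<in> {0..1}" for s
      using segment_in_convex[OF _ _ y that, of c] lx by (simp add: convex_real_interval)
    have "((\<lambda>s. g t (c + s * (y - c)) * (y - c)) has_integral F (c + 1 * (y - c)) - F (c + 0 * (y - c))) {0..1}"
    proof (rule fundamental_theorem_of_calculus)
      fix s :: real assume s: "s \<in> {0..1}"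
      have "((\<lambda>s. F (c + s * (y - c))) has_real_derivative g t (c + s * (y - c)) * (y - c)) (at s within {0..1})"
        using F[OF seg[OF s]] seg
        by (intro DERIV_image_chain[unfolded o_def] has_field_derivative_subset[OF F[OF seg[OF s]]])
          (auto intro!: derivative_eq_intros)
      then show "((\<lambda>s. F (c + s * (y - c))) has_vector_derivative g t (c + s * (y - c)) * (y - c)) (at s within {0..1})"
        by (simp add: has_real_derivative_iff_has_vector_derivative)
    qed simp
    then show ?thesis
      by (simp add: P_def param_antideriv_def integral_unique mult.commute flip: integral_mult_right)
  qed
  have "(F has_real_derivative g t x) (at x)"
    using F[of x] lx at_within_interior[of x "{l..r}"] by (simp add: interior_atLeastAtMost_real)
  then have "((\<lambda>y. F y - F c) has_real_derivative g t x) (at x)"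
    by (auto intro!: derivative_eq_intros)
  then have "(P has_real_derivative g t x) (at x)"
  proof (rule DERIV_cong_ev[THEN iffD1, OF refl _ refl, rotated])
    have "\<forall>\<^sub>F y in nhds x. y \<in> {l<..<r}"
      using lx by (intro eventually_nhds_in_open) auto
    then show "\<forall>\<^sub>F y in nhds x. F y - F c = P y" by eventually_elim (simp add: P_F)
  qed
  then show ?thesis by (simp add: P_def)
qed

lemma param_antideriv_eq_LBINT:
  assumes t: "t \<in> {0..1}" and x: "x \<in> J"
  shows "(LBINT z=c..x. g t z) = param_antideriv c g t x"
proof -
  have sub: "{min c x..max c x} \<subseteq> J"
    using J(1) c x closed_segment_subset[of c J x] by (auto simp: closed_segment_eq_real_ivl split: if_splits)
  have "(LBINT z=c..x. g t z) = param_antideriv c g t x - param_antideriv c g t c"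
    by (intro interval_integral_FTC_finite continuous_on_subset[OF continuous_on_section[OF g t] sub])
      (use sub in \<open>auto simp: has_real_derivative_iff_has_vector_derivative[symmetric]
        intro!: has_field_derivative_at_within param_antideriv_deriv_x[OF t]\<close>)
  then show ?thesis by (simp add: param_antideriv_def)
qed

lemma param_antideriv_deriv_t:
  assumes g': "continuous_on ({0..1} \<times> J) (\<lambda>(t, x). g' t x)"
    and d: "\<And>t x. t \<in> {0..1} \<Longrightarrow> x \<in> J \<Longrightarrow> ((\<lambda>s. g s x) has_real_derivative g' t x) (at t within {0..1})"
    and t: "t \<in> {0..1}" and x: "x \<in> J"
  shows "((\<lambda>s. param_antideriv c g s x) has_real_derivative param_antideriv c g' t x) (at t within {0..1})"
proof -
  have cont: "continuous_on ({0..1} \<times> cbox 0 1) (\<lambda>(s, r). f s (c + r * (x - c)))"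
    if f: "continuous_on ({0..1} \<times> J) (\<lambda>(t, x). f t x)" for f :: "real \<Rightarrow> real \<Rightarrow> real"
    unfolding case_prod_beta by (rule continuous_on_case_prod_compose[OF f])
      (auto intro!: continuous_intros segment_in_convex[OF J(1) c x])
  have "((\<lambda>s. integral (cbox 0 1) (\<lambda>r. g s (c + r * (x - c)))) has_real_derivative
      integral (cbox 0 1) (\<lambda>r. g' t (c + r * (x - c)))) (at t within {0..1})"
  proof (rule leibniz_rule_field_derivative)
    show "(\<lambda>r. g s (c + r * (x - c))) integrable_on cbox 0 1" if "s \<in> {0..1}" for s
      using continuous_on_section[OF cont[OF g] that] by (intro integrable_continuous) auto
    show "continuous_on ({0..1} \<times> cbox 0 1) (\<lambda>(s, r). g' s (c + r * (x - c)))"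
      using cont[OF g'] .
  qed (use t x in \<open>auto intro!: d segment_in_convex[OF J(1) c]\<close>)
  then show ?thesis
    unfolding param_antideriv_def by (auto intro!: derivative_eq_intros)
qed

end

lemma param_antideriv_base [simp]: "param_antideriv c g t c = 0"
  by (simp add: param_antideriv_def)

text \<open>Here \<open>\<sigma>'\<close> is the time derivative of \<open>\<sigma>\<close>. Along a \<open>\<gamma>\<close>-Hoelder path the coefficient is Hoelder
  continuous with exponent \<open>\<gamma> * \<delta>\<close>, and \<open>young\<close> is Young's condition for integrating it against
  another such path.\<close>
locale young_coefficient =
  fixes \<sigma> \<sigma>' :: "real \<Rightarrow> real \<Rightarrow> real" and \<gamma> \<delta> :: real
  assumes \<sigma>_cont: "continuous_on ({0..1} \<times> UNIV) (\<lambda>(t, x). \<sigma> t x)"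
    and \<sigma>'_cont: "continuous_on ({0..1} \<times> UNIV) (\<lambda>(t, x). \<sigma>' t x)"
    and \<sigma>_deriv: "\<And>t x. t \<in> {0..1} \<Longrightarrow> ((\<lambda>s. \<sigma> s x) has_real_derivative \<sigma>' t x) (at t within {0..1})"
    and \<gamma>: "0 < \<gamma>" "\<gamma> \<le> 1" and \<delta>: "0 < \<delta>" "\<delta> \<le> 1" and young: "1 < \<gamma> + \<gamma> * \<delta>"
    and \<sigma>_hoelder: "\<And>R. \<exists>C. \<forall>t\<in>{0..1}. \<forall>x y. \<bar>x\<bar> \<le> R \<longrightarrow> \<bar>y\<bar> \<le> R \<longrightarrow>
      \<bar>\<sigma> t x - \<sigma> t y\<bar> \<le> C * \<bar>x - y\<bar> powr \<delta>"

text \<open>One connected component \<open>einterval lo hi\<close> of the set where \<open>\<sigma>\<close> does not vanish. The condition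
  \<open>log_deriv\<close> is the bound on the logarithmic time derivative of \<open>\<sigma>\<close>, multiplied out.\<close>
locale component = young_coefficient +
  fixes lo hi :: ereal and c a :: real
  assumes nonzero: "\<And>t x. t \<in> {0..1} \<Longrightarrow> x \<in> einterval lo hi \<Longrightarrow> \<sigma> t x \<noteq> 0"
    and c: "c \<in> einterval lo hi"
    and a: "0 \<le> a"
    and log_deriv: "\<And>t x. t \<in> {0..1} \<Longrightarrow> x \<in> einterval lo hi \<Longrightarrow> \<bar>\<sigma>' t x\<bar> \<le> a * \<bar>\<sigma> t x\<bar>"
    and H_fun_blowup: "\<And>t e. t \<in> {0..1} \<Longrightarrow> e \<in> {lo, hi} \<Longrightarrow>
       filterlim (\<lambda>(s, x). \<bar>H_fun \<sigma> c s (real_of_ereal x)\<bar>) at_top (at (t, e) within {0..1} \<times> {lo<..<hi})"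
begin

abbreviation "J \<equiv> einterval lo hi"

text \<open>On the component, \<open>H\<close> agrees with \<open>H_fun \<sigma> c\<close>, and \<open>Ht\<close> is its time derivative.\<close>
definition "H = param_antideriv c (\<lambda>t x. 1 / \<sigma> t x)"
definition "Ht = param_antideriv c (\<lambda>t x. - \<sigma>' t x / (\<sigma> t x)\<^sup>2)"

lemma closed_interval_subset_J: "x \<in> J \<Longrightarrow> y \<in> J \<Longrightarrow> {x..y} \<subseteq> J"
  by (auto simp: einterval_iff) (meson ereal_less_eq(3) less_le_trans le_less_trans)+

lemma J_convex: "convex J" and J_open: "open J"
  using closed_interval_subset_J by (auto simp: convex_contains_segment closed_segment_eq_real_ivl)

lemma \<sigma>_cont_J: "continuous_on ({0..1} \<times> J) (\<lambda>(t, x). \<sigma> t x)"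
  using \<sigma>_cont by (rule continuous_on_subset) auto

lemma \<sigma>'_cont_J: "continuous_on ({0..1} \<times> J) (\<lambda>(t, x). \<sigma>' t x)"
  using \<sigma>'_cont by (rule continuous_on_subset) auto

lemma inv_\<sigma>_cont: "continuous_on ({0..1} \<times> J) (\<lambda>(t, x). 1 / \<sigma> t x)"
  using \<sigma>_cont_J nonzero unfolding case_prod_beta by (intro continuous_intros) auto

lemma inv_\<sigma>_dt_cont: "continuous_on ({0..1} \<times> J) (\<lambda>(t, x). - \<sigma>' t x / (\<sigma> t x)\<^sup>2)"
  using \<sigma>_cont_J \<sigma>'_cont_J nonzero unfolding case_prod_beta by (intro continuous_intros) auto

lemma H_base [simp]: "H t c = 0" and Ht_base [simp]: "Ht t c = 0"
  by (simp_all add: H_def Ht_def)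

lemma H_cont: "continuous_on ({0..1} \<times> J) (\<lambda>(t, x). H t x)"
  unfolding H_def by (rule continuous_on_param_antideriv[OF J_convex J_open c inv_\<sigma>_cont])

lemma Ht_cont: "continuous_on ({0..1} \<times> J) (\<lambda>(t, x). Ht t x)"
  unfolding Ht_def by (rule continuous_on_param_antideriv[OF J_convex J_open c inv_\<sigma>_dt_cont])

lemma H_deriv_x: "t \<in> {0..1} \<Longrightarrow> x \<in> J \<Longrightarrow> (H t has_real_derivative 1 / \<sigma> t x) (at x)"
  unfolding H_def by (rule param_antideriv_deriv_x[OF J_convex J_open c inv_\<sigma>_cont])

lemma Ht_deriv_x:
  "t \<in> {0..1} \<Longrightarrow> x \<in> J \<Longrightarrow> (Ht t has_real_derivative - \<sigma>' t x / (\<sigma> t x)\<^sup>2) (at x)"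
  unfolding Ht_def by (rule param_antideriv_deriv_x[OF J_convex J_open c inv_\<sigma>_dt_cont])

lemma H_deriv_t:
  assumes "t \<in> {0..1}" "x \<in> J"
  shows "((\<lambda>s. H s x) has_real_derivative Ht t x) (at t within {0..1})"
  unfolding H_def Ht_def
proof (rule param_antideriv_deriv_t[OF J_convex J_open c inv_\<sigma>_cont inv_\<sigma>_dt_cont])
  show "((\<lambda>s. 1 / \<sigma> s x) has_real_derivative - \<sigma>' t x / (\<sigma> t x)\<^sup>2) (at t within {0..1})"
    if "t \<in> {0..1}" "x \<in> J" for t x
    using nonzero[OF that] by (auto intro!: derivative_eq_intros \<sigma>_deriv[OF that(1)] simp: power2_eq_square)
qed fact+

lemma H_fun_eq: "t \<in> {0..1} \<Longrightarrow> x \<in> J \<Longrightarrow> H_fun \<sigma> c t x = H t x"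
  unfolding H_def H_fun_def by (rule param_antideriv_eq_LBINT[OF J_convex J_open c inv_\<sigma>_cont])

text \<open>In space, \<open>Ht t\<close> has the derivative \<open>- \<sigma>' / \<sigma>\<^sup>2\<close>, which is the derivative \<open>1 / \<sigma>\<close> of \<open>H t\<close> times
  \<open>- \<sigma>' / \<sigma>\<close>, a factor bounded by \<open>a\<close>; Cauchy's mean value theorem integrates this comparison.
  So \<open>Ht\<close> is a Lipschitz function of the value of \<open>H\<close>, although it need not be Lipschitz
  continuous in \<open>x\<close> uniformly on the component. This makes the transformed equation an ordinary
  differential equation with Lipschitz coefficients.\<close>
lemma Ht_lipschitz_wrt_H:
  assumes t: "t \<in> {0..1}" and x: "x \<in> J" and y: "y \<in> J"
  shows "\<bar>Ht t x - Ht t y\<bar> \<le> a * \<bar>H t x - H t y\<bar>"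
proof -
  have *: "\<bar>Ht t y - Ht t x\<bar> \<le> a * \<bar>H t y - H t x\<bar>" if xy: "x < y" "x \<in> J" "y \<in> J" for x y
  proof -
    have sub: "z \<in> J" if "x \<le> z" "z \<le> y" for z
      using closed_interval_subset_J[OF xy(2,3)] that by auto
    obtain z where z: "x < z" "z < y"
      "(H t y - H t x) * (- \<sigma>' t z / (\<sigma> t z)\<^sup>2) = (Ht t y - Ht t x) * (1 / \<sigma> t z)"
      using GMVT'[OF xy(1), of "H t" "Ht t" "\<lambda>z. - \<sigma>' t z / (\<sigma> t z)\<^sup>2" "\<lambda>z. 1 / \<sigma> t z"]
        DERIV_isCont[OF H_deriv_x[OF t sub]] DERIV_isCont[OF Ht_deriv_x[OF t sub]]
        H_deriv_x[OF t sub] Ht_deriv_x[OF t sub] by auto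
    have z': "z \<in> J" using sub z by auto
    have "Ht t y - Ht t x = (H t y - H t x) * (- \<sigma>' t z / \<sigma> t z)"
    proof -
      have "Ht t y - Ht t x = (Ht t y - Ht t x) * (1 / \<sigma> t z) * \<sigma> t z"
        using nonzero[OF t z'] by simp
      also have "\<dots> = (H t y - H t x) * (- \<sigma>' t z / \<sigma> t z)"
        unfolding z(3)[symmetric] using nonzero[OF t z'] by (simp add: power2_eq_square)
      finally show ?thesis .
    qed
    moreover have "\<bar>- \<sigma>' t z / \<sigma> t z\<bar> \<le> a"
      using log_deriv[OF t z'] nonzero[OF t z'] by (simp add: divide_le_eq)
    ultimately show ?thesis
      using mult_right_mono[of "\<bar>- \<sigma>' t z / \<sigma> t z\<bar>" a "\<bar>H t y - H t x\<bar>"]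
      by (simp only: abs_mult abs_ge_zero mult.commute)
  qed
  show ?thesis
    using *[of x y] *[of y x] x y by (cases x y rule: linorder_cases) (auto simp: abs_minus_commute)
qed

lemma Ht_bound: "t \<in> {0..1} \<Longrightarrow> x \<in> J \<Longrightarrow> \<bar>Ht t x\<bar> \<le> a * \<bar>H t x\<bar>"
  using Ht_lipschitz_wrt_H[of t x c] c by simp

lemma sign_\<sigma>:
  obtains s where "s = 1 \<or> s = - (1 :: real)" "\<And>t x. t \<in> {0..1} \<Longrightarrow> x \<in> J \<Longrightarrow> s * \<sigma> t x > 0"
proof -
  have conn: "connected ((\<lambda>(t, x). \<sigma> t x) ` ({0..1} \<times> J))"
    using J_convex by (intro connected_continuous_image \<sigma>_cont_J connected_Times convex_connected) auto
  define s where "s = sgn (\<sigma> 0 c)"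
  have s: "s = 1 \<or> s = -1" using nonzero[of 0 c] c by (auto simp: s_def sgn_if)
  have pos: "s * \<sigma> t x > 0" if tx: "t \<in> {0..1}" "x \<in> J" for t x
  proof (rule ccontr)
    assume neg: "\<not> s * \<sigma> t x > 0"
    have in_img: "\<sigma> t x \<in> (\<lambda>(t, x). \<sigma> t x) ` ({0..1} \<times> J)" "\<sigma> 0 c \<in> (\<lambda>(t, x). \<sigma> t x) ` ({0..1} \<times> J)"
      using tx c by (auto simp: image_iff intro!: bexI[of _ "(t, x)"] bexI[of _ "(0, c)"])
    have "0 \<in> (\<lambda>(t, x). \<sigma> t x) ` ({0..1} \<times> J)"
    proof (cases "\<sigma> 0 c > 0")
      case True
      then have "\<sigma> t x \<le> 0" using neg by (simp add: s_def)
      then show ?thesis using connectedD_interval[OF conn in_img, of 0] True by simp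
    next
      case False
      then have "\<sigma> 0 c < 0" using nonzero[of 0 c] c by auto
      moreover from this have "\<sigma> t x \<ge> 0" using neg by (simp add: s_def)
      ultimately show ?thesis using connectedD_interval[OF conn in_img(2,1), of 0] by simp
    qed
    then show False using nonzero by fastforce
  qed
  show ?thesis using that[OF s pos] .
qed

lemma H_mono:
  assumes s: "s = 1 \<or> s = - (1 :: real)" "\<And>t x. t \<in> {0..1} \<Longrightarrow> x \<in> J \<Longrightarrow> s * \<sigma> t x > 0"
    and t: "t \<in> {0..1}" and xy: "x \<in> J" "y \<in> J" "x < y"
  shows "s * H t x < s * H t y"
proof -
  have "\<exists>z. x < z \<and> z < y \<and> H t y - H t x = (y - x) * (1 / \<sigma> t z)"
    using closed_interval_subset_J[OF xy(1,2)] H_deriv_x[OF t] by (intro MVT2[OF xy(3)]) auto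
  then obtain z where z: "x < z" "z < y" "H t y - H t x = (y - x) * (1 / \<sigma> t z)" by blast
  have "s * \<sigma> t z > 0" using closed_interval_subset_J[OF xy(1,2)] z by (intro s t) auto
  then have "s * (1 / \<sigma> t z) > 0" using s(1) by (auto simp: zero_less_divide_iff)
  then have "(y - x) * (s * (1 / \<sigma> t z)) > 0" using xy(3) by (intro mult_pos_pos[of "y - x"]) simp_all
  then have "s * (H t y - H t x) > 0" unfolding z(3) by (simp only: mult.left_commute)
  then show ?thesis by (simp add: algebra_simps)
qed

lemma H_inj: "t \<in> {0..1} \<Longrightarrow> inj_on (H t) J"
  using H_mono sign_\<sigma> by (smt (verit, best) inj_onI)

lemma H_blowup:
  assumes t: "\<And>n. t n \<in> {0..1}" "t \<longlonglongrightarrow> p" and x: "\<And>n. x n \<in> J" "(\<lambda>n. ereal (x n)) \<longlonglongrightarrow> e"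
    and e: "e \<in> {lo, hi}"
  shows "filterlim (\<lambda>n. \<bar>H (t n) (x n)\<bar>) at_top sequentially"
proof -
  have p: "p \<in> {0..1}"
    using closed_sequentially[OF closed_atLeastAtMost] t by blast
  have "filterlim (\<lambda>n. (t n, ereal (x n))) (at (p, e) within {0..1} \<times> {lo<..<hi}) sequentially"
    unfolding filterlim_at
  proof
    show "(\<lambda>n. (t n, ereal (x n))) \<longlonglongrightarrow> (p, e)" by (intro tendsto_Pair t x)
    have "ereal (x n) \<noteq> e" for n using x(1)[of n] e by (auto simp: einterval_iff)
    then show "\<forall>\<^sub>F n in sequentially. (t n, ereal (x n)) \<in> {0..1} \<times> {lo<..<hi} \<and> (t n, ereal (x n)) \<noteq> (p, e)"
      using t(1) x(1) by (auto simp: einterval_iff)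
  qed
  from filterlim_compose[OF H_fun_blowup[OF p e] this]
  have "filterlim (\<lambda>n. \<bar>H_fun \<sigma> c (t n) (x n)\<bar>) at_top sequentially" by simp
  then show ?thesis using t(1) x(1) by (simp add: H_fun_eq)
qed

text \<open>The function \<open>H t\<close> is strictly monotone with a zero at \<open>c\<close>, and its absolute value is unbounded at
  both ends, so it takes arbitrarily large values of either sign.\<close>
lemma H_surj:
  assumes t: "t \<in> {0..1}"
  shows "\<exists>x\<in>J. H t x = y"
proof -
  obtain s where s: "s = 1 \<or> s = - (1 :: real)" "\<And>t x. t \<in> {0..1} \<Longrightarrow> x \<in> J \<Longrightarrow> s * \<sigma> t x > 0"
    using sign_\<sigma> by blast
  have "lo < hi" using c by (auto simp: einterval_iff)
  then obtain u l :: "nat \<Rightarrow> real" where lu: "\<And>i. l i < u i" "\<And>i. lo < l i" "\<And>i. u i < hi"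
    "(\<lambda>i. ereal (l i)) \<longlonglongrightarrow> lo" "(\<lambda>i. ereal (u i)) \<longlonglongrightarrow> hi"
    by (rule einterval_Icc_approximation) blast
  have lJ: "l i \<in> J" for i using lu by (auto simp: einterval_iff) (meson less_trans ereal_less(3) less_ereal.simps(1))
  have uJ: "u i \<in> J" for i using lu by (auto simp: einterval_iff) (meson less_trans less_ereal.simps(1))
  have "\<forall>\<^sub>F i in sequentially. \<bar>H t (l i)\<bar> > \<bar>y\<bar>"
    using H_blowup[of "\<lambda>_. t" t l lo] t lu lJ by (auto simp: filterlim_at_top_dense)
  moreover have "\<forall>\<^sub>F i in sequentially. ereal (l i) < ereal c"
    using lu(4) c by (intro order_tendstoD(2)) (auto simp: einterval_iff)
  moreover have "\<forall>\<^sub>F i in sequentially. \<bar>H t (u i)\<bar> > \<bar>y\<bar>"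
    using H_blowup[of "\<lambda>_. t" t u hi] t lu uJ by (auto simp: filterlim_at_top_dense)
  moreover have "\<forall>\<^sub>F i in sequentially. ereal (u i) > ereal c"
    using lu(5) c by (intro order_tendstoD(1)) (auto simp: einterval_iff)
  ultimately have "\<forall>\<^sub>F i in sequentially. \<bar>H t (l i)\<bar> > \<bar>y\<bar> \<and> l i < c \<and> \<bar>H t (u i)\<bar> > \<bar>y\<bar> \<and> c < u i"
    by eventually_elim auto
  then obtain i where i: "\<bar>H t (l i)\<bar> > \<bar>y\<bar>" "l i < c" "\<bar>H t (u i)\<bar> > \<bar>y\<bar>" "c < u i"
    by (auto simp: eventually_sequentially)
  have "s * H t (l i) < 0" "0 < s * H t (u i)"
    using H_mono[OF s t lJ c i(2)] H_mono[OF s t c uJ i(4)] by simp_all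
  then have "s * H t (l i) \<le> s * y" "s * y \<le> s * H t (u i)" using i(1,3) s(1) by auto
  moreover have "continuous_on {l i..u i} (\<lambda>x. s * H t x)"
    by (intro continuous_intros continuous_on_subset[OF continuous_on_section[OF H_cont t]]
        closed_interval_subset_J lJ uJ)
  ultimately obtain x where "l i \<le> x" "x \<le> u i" "s * H t x = s * y"
    using IVT'[of "\<lambda>x. s * H t x" "l i" "s * y" "u i"] lu(1)[of i] by auto
  moreover from this have "x \<in> J" using closed_interval_subset_J[OF lJ[of i] uJ[of i]] by auto
  ultimately show ?thesis using s(1) by auto
qed

definition "K t y = inv_into J (H t) y"

lemma K_in: "t \<in> {0..1} \<Longrightarrow> K t y \<in> J" and H_K: "t \<in> {0..1} \<Longrightarrow> H t (K t y) = y"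
  unfolding K_def using H_surj[of t y] by (auto intro!: inv_into_into f_inv_into_f)

lemma K_H: "t \<in> {0..1} \<Longrightarrow> x \<in> J \<Longrightarrow> K t (H t x) = x"
  unfolding K_def by (simp add: H_inj)

text \<open>By monotonicity of \<open>H t\<close>, the inequalities \<open>x < K t y\<close> and \<open>K t y < x\<close> compare \<open>H t x\<close> with \<open>y\<close>,
  and such comparisons are stable under small changes of \<open>t\<close> and \<open>y\<close>.\<close>
lemma K_cont: "continuous_on ({0..1} \<times> UNIV) (\<lambda>(t, y). K t y)"
  unfolding continuous_on_def
proof (clarify)
  fix t y :: real assume t: "t \<in> {0..1}"
  obtain s where s: "s = 1 \<or> s = - (1 :: real)" "\<And>t x. t \<in> {0..1} \<Longrightarrow> x \<in> J \<Longrightarrow> s * \<sigma> t x > 0"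
    using sign_\<sigma> by blast
  let ?F = "at (t, y) within {0..1} \<times> UNIV"
  have K_less: "K t' y' < x \<longleftrightarrow> s * y' < s * H t' x" if "t' \<in> {0..1}" "x \<in> J" for t' y' x
    using H_mono[OF s that(1) K_in[OF that(1)] that(2), of y'] H_mono[OF s that(1) that(2) K_in[OF that(1)], of y']
      H_K[OF that(1)] by (metis linorder_neqE_linordered_idom order_less_asym order_less_irrefl)
  have less_K: "x < K t' y' \<longleftrightarrow> s * H t' x < s * y'" if "t' \<in> {0..1}" "x \<in> J" for t' y' x
    using H_mono[OF s that(1) K_in[OF that(1)] that(2), of y'] H_mono[OF s that(1) that(2) K_in[OF that(1)], of y']
      H_K[OF that(1)] by (metis linorder_neqE_linordered_idom order_less_asym order_less_irrefl)
  have lim: "((\<lambda>q. s * snd q - s * H (fst q) x) \<longlongrightarrow> s * y - s * H t x) ?F" if x: "x \<in> J" for x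
  proof -
    have "continuous_on ({0..1} \<times> UNIV) (\<lambda>q :: real \<times> real. H (fst q) x)"
      by (rule continuous_on_case_prod_compose[OF H_cont]) (use x in \<open>auto intro!: continuous_intros\<close>)
    then have "continuous_on ({0..1} \<times> UNIV) (\<lambda>q. s * snd q - s * H (fst q) x)"
      by (auto intro!: continuous_intros)
    then show ?thesis using t unfolding continuous_on_def by fastforce
  qed
  have ev: "\<forall>\<^sub>F q in ?F. fst q \<in> {0..1}" by (auto simp: eventually_at_filter mem_Times_iff intro!: always_eventually)
  have KJ: "K t y \<in> J" using K_in t .
  show "((\<lambda>(t, y). K t y) \<longlongrightarrow> K t y) ?F"
  proof (rule order_tendstoI)
    fix w assume w: "w < K t y"
    obtain x where x: "x \<in> J" "w \<le> x" "x < K t y"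
    proof -
      obtain e where e: "e > 0" "cball (K t y) e \<subseteq> J" using J_open KJ open_contains_cball by blast
      have "max w (K t y - e) \<in> J" using e w by (intro subsetD[OF e(2)]) (auto simp: dist_real_def)
      then show ?thesis using e w by (intro that[of "max w (K t y - e)"]) auto
    qed
    have "0 < s * y - s * H t x" using less_K[OF t x(1)] x(3) by simp
    then have "\<forall>\<^sub>F q in ?F. 0 < s * snd q - s * H (fst q) x"
      using order_tendstoD(1)[OF lim[OF x(1)]] by blast
    with ev show "\<forall>\<^sub>F q in ?F. w < (case q of (t, y) \<Rightarrow> K t y)"
      by eventually_elim (use less_K x in \<open>auto simp: case_prod_beta intro: le_less_trans\<close>)
  next
    fix w assume w: "K t y < w"
    obtain x where x: "x \<in> J" "x \<le> w" "K t y < x"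
    proof -
      obtain e where e: "e > 0" "cball (K t y) e \<subseteq> J" using J_open KJ open_contains_cball by blast
      have "min w (K t y + e) \<in> J" using e w by (intro subsetD[OF e(2)]) (auto simp: dist_real_def)
      then show ?thesis using e w by (intro that[of "min w (K t y + e)"]) auto
    qed
    have "s * y - s * H t x < 0" using K_less[OF t x(1)] x(3) by simp
    then have "\<forall>\<^sub>F q in ?F. s * snd q - s * H (fst q) x < 0"
      using order_tendstoD(2)[OF lim[OF x(1)]] by blast
    with ev show "\<forall>\<^sub>F q in ?F. (case q of (t, y) \<Rightarrow> K t y) < w"
      by eventually_elim (use K_less x in \<open>auto simp: case_prod_beta intro: less_le_trans\<close>)
  qed
qed

end

section \<open>The chain rule along a path\<close>

lemma integrable_continuous_mult_bounded:
  fixes f b :: "real \<Rightarrow> real"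
  assumes f: "continuous_on {p..q} f" and b: "b \<in> borel_measurable borel"
    and B: "\<And>r. r \<in> {p..q} \<Longrightarrow> \<bar>b r\<bar> \<le> B"
  shows "(\<lambda>r. f r * b r) integrable_on {p..q}"
proof -
  obtain F where F: "\<And>r. r \<in> {p..q} \<Longrightarrow> \<bar>f r\<bar> \<le> F"
    using continuous_on_Icc_bounded[OF f] by metis
  define g where "g r = (indicat_real {p..q} r *\<^sub>R f r) * b r" for r
  have "g \<in> borel_measurable borel"
    unfolding g_def[abs_def]
    using borel_measurable_continuous_on_indicator[OF _ f] b by (intro borel_measurable_times) auto
  moreover have "\<bar>g r\<bar> \<le> F * B" if "r \<in> {p..q}" for r
  proof -
    have "\<bar>f r\<bar> \<le> F" using F that by auto
    then have "\<bar>f r\<bar> * \<bar>b r\<bar> \<le> F * B" using B[OF that] by (intro mult_mono) auto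
    then show ?thesis using that by (simp add: g_def abs_mult)
  qed
  ultimately have "g integrable_on {p..q}" by (rule bounded_measurable_integral(2))
  then show ?thesis by (rule integrable_eq) (simp add: g_def)
qed

text \<open>Freezing the Hoelder continuous factor at the left end of \<open>{u..v}\<close> costs an error of order
  \<open>(v - u) powr (1 + \<beta>)\<close>.\<close>
lemma negligible_incr_integral:
  fixes f b :: "real \<Rightarrow> real"
  assumes \<beta>: "0 < \<beta>"
    and f: "\<And>s t. s \<in> {p..q} \<Longrightarrow> t \<in> {p..q} \<Longrightarrow> \<bar>f s - f t\<bar> \<le> A * \<bar>s - t\<bar> powr \<beta>"
    and b: "b \<in> borel_measurable borel" and B: "\<And>r. r \<in> {p..q} \<Longrightarrow> \<bar>b r\<bar> \<le> B"
  shows "negligible_incr p q (\<lambda>u v. integral {u..v} (\<lambda>r. f r * b r) - f u * integral {u..v} b)"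
proof (rule negligible_incr_powr)
  show "1 < 1 + \<beta>" using \<beta> by simp
  fix u v assume uv: "p \<le> u" "u \<le> v" "v \<le> q"
  have sub: "{u..v} \<subseteq> {p..q}" using uv by auto
  have f_cont: "continuous_on {u..v} f"
    using hoelder_imp_continuous_on[OF \<beta> f] continuous_on_subset sub by blast
  have i1: "(\<lambda>r. f r * b r) integrable_on {u..v}"
    using B sub by (intro integrable_continuous_mult_bounded[OF f_cont b]) blast
  have i2: "(\<lambda>r. f u * b r) integrable_on {u..v}"
    using bounded_measurable_integral(2)[OF b, of u v B] B sub by (intro integrable_on_mult_right) blast
  have A: "A \<ge> 0 \<or> u = v"
  proof (cases "u = v")
    case False
    then have "0 \<le> A * \<bar>u - v\<bar> powr \<beta>" using f[of u v] uv by (smt (verit) atLeastAtMost_iff)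
    then show ?thesis using False by (simp add: zero_le_mult_iff)
  qed simp
  have "norm (integral {u..v} (\<lambda>r. f r * b r - f u * b r)) \<le> integral {u..v} (\<lambda>r. A * B * (v - u) powr \<beta>)"
  proof (rule integral_norm_bound_integral)
    show "(\<lambda>r. f r * b r - f u * b r) integrable_on {u..v}" using i1 i2 by (rule integrable_diff)
    fix r assume r: "r \<in> {u..v}"
    have "\<bar>f r - f u\<bar> \<le> A * \<bar>r - u\<bar> powr \<beta>" using r uv by (intro f) auto
    also have "\<dots> \<le> A * (v - u) powr \<beta>"
      using A r \<beta> by (cases "u = v") (auto intro!: mult_left_mono powr_mono2)
    finally have "\<bar>f r - f u\<bar> * \<bar>b r\<bar> \<le> (A * (v - u) powr \<beta>) * B"
      using B[of r] r sub A by (intro mult_mono) auto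
    then show "norm (f r * b r - f u * b r) \<le> A * B * (v - u) powr \<beta>"
      by (simp add: abs_mult[symmetric] algebra_simps)
  qed (rule integrable_const_ivl)
  moreover have "integral {u..v} (\<lambda>r. f r * b r - f u * b r)
      = integral {u..v} (\<lambda>r. f r * b r) - f u * integral {u..v} b"
    using i1 i2 by (simp add: Henstock_Kurzweil_Integration.integral_diff)
  ultimately show "\<bar>integral {u..v} (\<lambda>r. f r * b r) - f u * integral {u..v} b\<bar> \<le> A * B * (v - u) powr (1 + \<beta>)"
    using uv by (simp add: powr_add ac_simps)
qed

lemma path_in_compact_subinterval:
  fixes X :: "real \<Rightarrow> real"
  assumes X: "continuous_on T X" "compact T" "T \<noteq> {}" and XJ: "\<And>t. t \<in> T \<Longrightarrow> X t \<in> J"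
    and J: "\<And>x y. x \<in> J \<Longrightarrow> y \<in> J \<Longrightarrow> {x..y} \<subseteq> J"
  obtains l r where "{l..r} \<subseteq> J" "\<And>t. t \<in> T \<Longrightarrow> X t \<in> {l..r}"
proof -
  obtain t1 where t1: "t1 \<in> T" "\<And>t. t \<in> T \<Longrightarrow> X t1 \<le> X t"
    using continuous_attains_inf[OF X(2,3,1)] by blast
  obtain t2 where t2: "t2 \<in> T" "\<And>t. t \<in> T \<Longrightarrow> X t \<le> X t2"
    using continuous_attains_sup[OF X(2,3,1)] by blast
  show ?thesis
    using that[of "X t1" "X t2"] J[OF XJ[OF t1(1)] XJ[OF t2(1)]] t1 t2 by auto
qed

lemma bounded_on_rectangle:
  fixes f :: "real \<Rightarrow> real \<Rightarrow> real"
  assumes "continuous_on ({0..1} \<times> {l..r}) (\<lambda>(t, x). f t x)"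
  obtains M where "M > 0" "\<And>t x. t \<in> {0..1} \<Longrightarrow> x \<in> {l..r} \<Longrightarrow> \<bar>f t x\<bar> \<le> M"
proof -
  have "bounded ((\<lambda>(t, x). f t x) ` ({0..1} \<times> {l..r}))"
    by (intro compact_imp_bounded compact_continuous_image assms compact_Times) auto
  then obtain M where "\<forall>y\<in>(\<lambda>(t, x). f t x) ` ({0..1} \<times> {l..r}). norm y \<le> M" unfolding bounded_iff by blast
  then have "\<bar>f t x\<bar> \<le> M" if "t \<in> {0..1}" "x \<in> {l..r}" for t x using that by fastforce
  then have "\<bar>f t x\<bar> \<le> max M 1" if "t \<in> {0..1}" "x \<in> {l..r}" for t x using that by (meson max.coboundedI1)
  then show ?thesis by (intro that[of "max M 1"]) auto
qed

context young_coefficient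
begin

lemma \<sigma>_along_path_hoelder:
  assumes pq: "0 \<le> p" "q \<le> 1"
    and X: "\<And>s t. s \<in> {p..q} \<Longrightarrow> t \<in> {p..q} \<Longrightarrow> \<bar>X s - X t\<bar> \<le> B * \<bar>s - t\<bar> powr \<gamma>"
  obtains A where "\<And>s t. s \<in> {p..q} \<Longrightarrow> t \<in> {p..q} \<Longrightarrow>
    \<bar>\<sigma> s (X s) - \<sigma> t (X t)\<bar> \<le> A * \<bar>s - t\<bar> powr (\<gamma> * \<delta>)"
proof -
  obtain R where R: "\<And>t. t \<in> {p..q} \<Longrightarrow> \<bar>X t\<bar> \<le> R"
    using continuous_on_Icc_bounded[OF hoelder_imp_continuous_on[OF \<gamma>(1) X]] by blast
  obtain C0 where C0: "\<forall>t\<in>{0..1}. \<forall>x y. \<bar>x\<bar> \<le> R \<longrightarrow> \<bar>y\<bar> \<le> R \<longrightarrow> \<bar>\<sigma> t x - \<sigma> t y\<bar> \<le> C0 * \<bar>x - y\<bar> powr \<delta>"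
    using \<sigma>_hoelder by blast
  define C where "C = \<bar>C0\<bar>"
  have C: "\<bar>\<sigma> t x - \<sigma> t y\<bar> \<le> C * \<bar>x - y\<bar> powr \<delta>" if "t \<in> {0..1}" "\<bar>x\<bar> \<le> R" "\<bar>y\<bar> \<le> R" for t x y
  proof -
    have "\<bar>\<sigma> t x - \<sigma> t y\<bar> \<le> C0 * \<bar>x - y\<bar> powr \<delta>" using C0 that by blast
    also have "\<dots> \<le> C * \<bar>x - y\<bar> powr \<delta>" by (intro mult_right_mono) (auto simp: C_def)
    finally show ?thesis .
  qed
  obtain D where D: "D > 0" "\<And>t x. t \<in> {0..1} \<Longrightarrow> x \<in> {-R..R} \<Longrightarrow> \<bar>\<sigma>' t x\<bar> \<le> D"
    using bounded_on_rectangle[OF continuous_on_subset[OF \<sigma>'_cont]] by (metis Sigma_mono order_refl subset_UNIV)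
  define B' where "B' = \<bar>B\<bar>"
  have "\<bar>\<sigma> s (X s) - \<sigma> t (X t)\<bar> \<le> (D + C * B' powr \<delta>) * \<bar>s - t\<bar> powr (\<gamma> * \<delta>)"
    if st: "s \<in> {p..q}" "t \<in> {p..q}" for s t
  proof -
    have st': "s \<in> {0..1}" "t \<in> {0..1}" using st pq by auto
    have "norm (\<sigma> s (X s) - \<sigma> t (X s)) \<le> D * norm (s - t)"
      using st' R[OF st(1)] by (intro field_differentiable_bound[OF _ \<sigma>_deriv]) (auto intro!: D(2))
    also have "norm (s - t) = \<bar>s - t\<bar> powr 1" by simp
    also have "\<bar>s - t\<bar> powr 1 \<le> \<bar>s - t\<bar> powr (\<gamma> * \<delta>)"
      using st' \<gamma> \<delta> by (intro powr_mono') (auto simp: mult_le_one)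
    finally have 1: "\<bar>\<sigma> s (X s) - \<sigma> t (X s)\<bar> \<le> D * \<bar>s - t\<bar> powr (\<gamma> * \<delta>)" using D(1) by simp
    have "\<bar>X s - X t\<bar> powr \<delta> \<le> (B' * \<bar>s - t\<bar> powr \<gamma>) powr \<delta>"
    proof (intro powr_mono2)
      have "B * \<bar>s - t\<bar> powr \<gamma> \<le> B' * \<bar>s - t\<bar> powr \<gamma>" by (intro mult_right_mono) (auto simp: B'_def)
      then show "\<bar>X s - X t\<bar> \<le> B' * \<bar>s - t\<bar> powr \<gamma>" using X[OF st] by simp
    qed (use \<delta> in auto)
    also have "\<dots> = B' powr \<delta> * \<bar>s - t\<bar> powr (\<gamma> * \<delta>)"
      by (simp add: powr_mult powr_powr B'_def)
    finally have "C * \<bar>X s - X t\<bar> powr \<delta> \<le> C * (B' powr \<delta> * \<bar>s - t\<bar> powr (\<gamma> * \<delta>))"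
      by (intro mult_left_mono) (auto simp: C_def)
    then have 2: "\<bar>\<sigma> t (X s) - \<sigma> t (X t)\<bar> \<le> C * B' powr \<delta> * \<bar>s - t\<bar> powr (\<gamma> * \<delta>)"
      using C[OF st'(2) R[OF st(1)] R[OF st(2)]] by (simp add: mult.assoc)
    show ?thesis using 1 2 by (simp add: distrib_right)
  qed
  then show ?thesis using that by blast
qed

end

context component
begin

lemma \<sigma>_bounds:
  assumes "{l..r} \<subseteq> J"
  obtains m M where "m > 0" "M > 0" "\<And>t x. t \<in> {0..1} \<Longrightarrow> x \<in> {l..r} \<Longrightarrow> \<bar>1 / \<sigma> t x\<bar> \<le> m"
    "\<And>t x. t \<in> {0..1} \<Longrightarrow> x \<in> {l..r} \<Longrightarrow> \<bar>\<sigma> t x\<bar> \<le> M"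
proof -
  have sub: "{0..1} \<times> {l..r} \<subseteq> {0..1} \<times> J" using assms by auto
  obtain m where "m > 0" "\<And>t x. t \<in> {0..1} \<Longrightarrow> x \<in> {l..r} \<Longrightarrow> \<bar>1 / \<sigma> t x\<bar> \<le> m"
    using bounded_on_rectangle[OF continuous_on_subset[OF inv_\<sigma>_cont sub]] by metis
  moreover obtain M where "M > 0" "\<And>t x. t \<in> {0..1} \<Longrightarrow> x \<in> {l..r} \<Longrightarrow> \<bar>\<sigma> t x\<bar> \<le> M"
    using bounded_on_rectangle[OF continuous_on_subset[OF \<sigma>_cont_J sub]] by metis
  ultimately show ?thesis using that by blast
qed

lemma H_mvt_x:
  assumes t: "t \<in> {0..1}" and lr: "{l..r} \<subseteq> J" and x: "x \<in> {l..r}" and y: "y \<in> {l..r}"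
  obtains z where "z \<in> {l..r}" "\<bar>z - x\<bar> \<le> \<bar>y - x\<bar>" "H t y - H t x = (y - x) / \<sigma> t z"
proof -
  have *: "\<exists>z. x < z \<and> z < y \<and> H t y - H t x = (y - x) * (1 / \<sigma> t z)"
    if "x \<in> {l..r}" "y \<in> {l..r}" "x < y" for x y
    using that by (intro MVT2[OF that(3)] H_deriv_x[OF t] subsetD[OF lr]) auto
  show ?thesis
  proof (cases x y rule: linorder_cases)
    case less
    then obtain z where z: "x < z" "z < y" "H t y - H t x = (y - x) * (1 / \<sigma> t z)"
      using *[OF x y] by blast
    then show ?thesis using x y by (intro that[of z]) auto
  next
    case equal
    then show ?thesis using that[of x] x by simp
  next
    case greater
    then obtain z where z: "y < z" "z < x" "H t x - H t y = (x - y) * (1 / \<sigma> t z)"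
      using *[OF y x] by blast
    then have "H t y - H t x = (y - x) / \<sigma> t z" by (simp add: diff_divide_distrib)
    then show ?thesis using z x y by (intro that[of z]) auto
  qed
qed

lemma dist_le_H_dist:
  assumes t: "t \<in> {0..1}" and lr: "{l..r} \<subseteq> J" and x: "x \<in> {l..r}" and y: "y \<in> {l..r}"
    and M: "\<And>x. x \<in> {l..r} \<Longrightarrow> \<bar>\<sigma> t x\<bar> \<le> M"
  shows "\<bar>x - y\<bar> \<le> M * \<bar>H t x - H t y\<bar>"
proof -
  obtain z where z: "z \<in> {l..r}" "H t x - H t y = (x - y) / \<sigma> t z"
    using H_mvt_x[OF t lr y x] by blast
  have "\<sigma> t z \<noteq> 0" using nonzero t z(1) lr by auto
  then have "x - y = \<sigma> t z * (H t x - H t y)" using z(2) by simp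
  then show ?thesis using M[OF z(1)] by (simp add: abs_mult mult_right_mono)
qed

context
  fixes p q :: real and X :: "real \<Rightarrow> real" and B :: real
  assumes pq: "0 \<le> p" "p \<le> q" "q \<le> 1"
    and X: "\<And>s t. s \<in> {p..q} \<Longrightarrow> t \<in> {p..q} \<Longrightarrow> \<bar>X s - X t\<bar> \<le> B * \<bar>s - t\<bar> powr \<gamma>"
    and XJ: "\<And>t. t \<in> {p..q} \<Longrightarrow> X t \<in> J"
begin

lemma X_cont: "continuous_on {p..q} X"
  using \<gamma>(1) X by (rule hoelder_imp_continuous_on)

lemma X_hull: obtains l r where "{l..r} \<subseteq> J" "\<And>t. t \<in> {p..q} \<Longrightarrow> X t \<in> {l..r}"
  using path_in_compact_subinterval[OF X_cont _ _ XJ closed_interval_subset_J] pq by auto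

lemma along_path_cont:
  assumes "continuous_on ({0..1} \<times> J) (\<lambda>(t, x). f t x)"
  shows "continuous_on {p..q} (\<lambda>t. f t (X t))"
  by (rule continuous_on_case_prod_compose[OF assms]) (use XJ pq X_cont in \<open>auto intro!: continuous_intros\<close>)

lemma chain_rule_time:
  "negligible_incr p q (\<lambda>u v. H v (X v) - H u (X v) - integral {u..v} (\<lambda>r. Ht r (X r)))"
  unfolding negligible_incr_def
proof (intro allI impI)
  fix e :: real assume e: "e > 0"
  obtain l r where lr: "{l..r} \<subseteq> J" "\<And>t. t \<in> {p..q} \<Longrightarrow> X t \<in> {l..r}" using X_hull by blast
  have "uniformly_continuous_on ({0..1} \<times> {l..r}) (\<lambda>(t, x). Ht t x)"
    using lr(1) by (intro compact_uniformly_continuous continuous_on_subset[OF Ht_cont] compact_Times) auto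
  then obtain d1 where d1: "d1 > 0" "\<And>y z. y \<in> {0..1} \<times> {l..r} \<Longrightarrow> z \<in> {0..1} \<times> {l..r} \<Longrightarrow> dist z y < d1 \<Longrightarrow>
      dist (case z of (t, x) \<Rightarrow> Ht t x) (case y of (t, x) \<Rightarrow> Ht t x) < e"
    unfolding uniformly_continuous_on_def using e by metis
  have "uniformly_continuous_on {p..q} X" by (intro compact_uniformly_continuous X_cont) auto
  then obtain d2 where d2: "d2 > 0" "\<And>s t. s \<in> {p..q} \<Longrightarrow> t \<in> {p..q} \<Longrightarrow> dist t s < d2 \<Longrightarrow> dist (X t) (X s) < d1 / 2"
    unfolding uniformly_continuous_on_def using d1 half_gt_zero by metis
  define d where "d = min (d1 / 2) d2"
  have "\<bar>H v (X v) - H u (X v) - integral {u..v} (\<lambda>r. Ht r (X r))\<bar> \<le> e * (v - u)"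
    if uv: "p \<le> u \<and> u \<le> v \<and> v \<le> q \<and> v - u < d" for u v
  proof (cases "u = v")
    case False
    define x where "x = X v"
    have x: "x \<in> {l..r}" using lr(2) uv by (simp add: x_def)
    have deriv: "((\<lambda>s. H s x) has_real_derivative Ht s x) (at s)" if "u < s" "s < v" for s
    proof -
      have "at s within {0..1} = at s" using that uv pq by (intro at_within_Icc_at) auto
      then show ?thesis using H_deriv_t[of s x] that uv pq x lr(1) by auto
    qed
    have cont: "continuous_on {u..v} (\<lambda>s. H s x)"
      by (rule continuous_on_case_prod_compose[OF H_cont]) (use x lr(1) uv pq in \<open>auto intro!: continuous_intros\<close>)
    obtain \<zeta> where \<zeta>: "u < \<zeta>" "\<zeta> < v" "H v x - H u x = Ht \<zeta> x * (v - u)"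
    proof -
      have "\<exists>l z. u < z \<and> z < v \<and> ((\<lambda>s. H s x) has_real_derivative l) (at z) \<and> H v x - H u x = (v - u) * l"
      proof (intro MVT cont)
        show "(\<lambda>s. H s x) differentiable (at s)" if "u < s" "s < v" for s
          using deriv[OF that] real_differentiable_def by blast
      qed (use False uv in auto)
      then obtain l z where z: "u < z" "z < v" "((\<lambda>s. H s x) has_real_derivative l) (at z)"
        "H v x - H u x = (v - u) * l" by blast
      then have "l = Ht z x" using DERIV_unique deriv by blast
      then show ?thesis using z by (intro that[of z]) auto
    qed
    have close: "\<bar>Ht r (X r) - Ht \<zeta> x\<bar> \<le> e" if r: "r \<in> {u..v}" for r
    proof -
      have "dist (X r) x < d1 / 2" unfolding x_def
        using r uv by (intro d2) (auto simp: d_def dist_real_def)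
      moreover have "dist r \<zeta> < d1 / 2"
      proof -
        have "\<bar>r - \<zeta>\<bar> \<le> v - u" using r \<zeta> by auto
        then show ?thesis using uv by (simp add: d_def dist_real_def)
      qed
      ultimately have "dist (r, X r) (\<zeta>, x) < d1"
        using sqrt_sum_squares_le_sum[of "dist r \<zeta>" "dist (X r) x"] by (simp add: dist_prod_def)
      then have "dist (Ht r (X r)) (Ht \<zeta> x) < e"
        using d1(2)[of "(\<zeta>, x)" "(r, X r)"] r \<zeta> x lr(2)[of r] uv pq by auto
      then show ?thesis by (simp add: dist_real_def)
    qed
    have int: "(\<lambda>r. Ht r (X r)) integrable_on {u..v}"
      using uv by (intro integrable_continuous_interval continuous_on_subset[OF along_path_cont[OF Ht_cont]]) auto
    have "norm (integral {u..v} (\<lambda>r. Ht r (X r) - Ht \<zeta> x)) \<le> integral {u..v} (\<lambda>r. e)"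
      using close int by (intro integral_norm_bound_integral integrable_diff) auto
    moreover have "integral {u..v} (\<lambda>r. Ht r (X r) - Ht \<zeta> x) = integral {u..v} (\<lambda>r. Ht r (X r)) - Ht \<zeta> x * (v - u)"
      using Henstock_Kurzweil_Integration.integral_diff[OF int integrable_const_ivl[of "Ht \<zeta> x" u v]] uv
      by (simp add: mult.commute)
    ultimately show ?thesis using \<zeta>(3) uv unfolding x_def by (simp add: abs_minus_commute mult.commute)
  qed simp
  moreover have "d > 0" using d1 d2 by (simp add: d_def)
  ultimately show "\<exists>d>0. \<forall>u v. p \<le> u \<and> u \<le> v \<and> v \<le> q \<and> v - u < d \<longrightarrow>
      \<bar>H v (X v) - H u (X v) - integral {u..v} (\<lambda>r. Ht r (X r))\<bar> \<le> e * (v - u)" by blast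
qed

text \<open>The spatial derivative \<open>1 / \<sigma>\<close> of \<open>H\<close> is \<open>\<delta>\<close>-Hoelder continuous on compact parts of the component.
  Hence the first-order Taylor remainder is of order \<open>1 + \<delta>\<close> in \<open>X v - X u\<close>, that is, of order
  \<open>\<gamma> + \<gamma> * \<delta> > 1\<close> in \<open>v - u\<close>: a rough path obeys the classical chain rule.\<close>
lemma chain_rule_space:
  "negligible_incr p q (\<lambda>u v. H u (X v) - H u (X u) - (X v - X u) / \<sigma> u (X u))"
proof -
  obtain l r where lr: "{l..r} \<subseteq> J" "\<And>t. t \<in> {p..q} \<Longrightarrow> X t \<in> {l..r}" using X_hull by blast
  obtain m M where m: "m > 0" "\<And>t x. t \<in> {0..1} \<Longrightarrow> x \<in> {l..r} \<Longrightarrow> \<bar>1 / \<sigma> t x\<bar> \<le> m"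
    using \<sigma>_bounds[OF lr(1)] by metis
  obtain C0 where C0: "\<forall>t\<in>{0..1}. \<forall>x y. \<bar>x\<bar> \<le> max \<bar>l\<bar> \<bar>r\<bar> \<longrightarrow> \<bar>y\<bar> \<le> max \<bar>l\<bar> \<bar>r\<bar> \<longrightarrow>
      \<bar>\<sigma> t x - \<sigma> t y\<bar> \<le> C0 * \<bar>x - y\<bar> powr \<delta>"
    using \<sigma>_hoelder by blast
  define C where "C = \<bar>C0\<bar>"
  define B' where "B' = \<bar>B\<bar>"
  show ?thesis
  proof (rule negligible_incr_powr)
    show "1 < \<gamma> + \<gamma> * \<delta>" by (rule young)
    fix u v assume uv: "p \<le> u" "u \<le> v" "v \<le> q"
    have u: "u \<in> {0..1}" using uv pq by auto
    have xu: "X u \<in> {l..r}" and xv: "X v \<in> {l..r}" using lr(2) uv by auto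
    obtain z where z: "z \<in> {l..r}" "\<bar>z - X u\<bar> \<le> \<bar>X v - X u\<bar>" "H u (X v) - H u (X u) = (X v - X u) / \<sigma> u z"
      using H_mvt_x[OF u lr(1) xu xv] by blast
    have nz: "\<sigma> u z \<noteq> 0" "\<sigma> u (X u) \<noteq> 0" using nonzero[OF u] z(1) xu lr(1) by auto
    have "\<bar>X v - X u\<bar> \<le> B * \<bar>v - u\<bar> powr \<gamma>" using uv by (intro X) auto
    also have "\<dots> \<le> B' * \<bar>v - u\<bar> powr \<gamma>" by (intro mult_right_mono) (auto simp: B'_def)
    finally have dX: "\<bar>X v - X u\<bar> \<le> B' * (v - u) powr \<gamma>" using uv by simp
    have "\<bar>\<sigma> u (X u) - \<sigma> u z\<bar> \<le> C0 * \<bar>X u - z\<bar> powr \<delta>"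
      using C0 u z(1) xu by auto
    also have "\<dots> \<le> C * \<bar>X u - z\<bar> powr \<delta>" by (intro mult_right_mono) (auto simp: C_def)
    also have "\<dots> \<le> C * (B' * (v - u) powr \<gamma>) powr \<delta>"
      using z(2) dX \<delta> by (intro mult_left_mono powr_mono2) (auto simp: C_def)
    also have "(B' * (v - u) powr \<gamma>) powr \<delta> = B' powr \<delta> * (v - u) powr (\<gamma> * \<delta>)"
      by (simp add: powr_mult powr_powr B'_def)
    finally have d\<sigma>: "\<bar>\<sigma> u (X u) - \<sigma> u z\<bar> \<le> C * (B' powr \<delta> * (v - u) powr (\<gamma> * \<delta>))" .
    have "H u (X v) - H u (X u) - (X v - X u) / \<sigma> u (X u)
        = (X v - X u) * ((\<sigma> u (X u) - \<sigma> u z) * (1 / \<sigma> u z * (1 / \<sigma> u (X u))))"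
      unfolding z(3) using nz by (simp add: divide_simps) (simp add: algebra_simps)
    also have "\<bar>\<dots>\<bar> \<le> (B' * (v - u) powr \<gamma>) * ((C * (B' powr \<delta> * (v - u) powr (\<gamma> * \<delta>))) * (m * m))"
      unfolding abs_mult using dX d\<sigma> m(2)[OF u z(1)] m(2)[OF u xu] m(1)
      by (intro mult_mono) (auto simp: C_def B'_def)
    also have "\<dots> = B' * C * B' powr \<delta> * (m * m) * (v - u) powr (\<gamma> + \<gamma> * \<delta>)"
      by (simp add: powr_add)
    finally show "\<bar>H u (X v) - H u (X u) - (X v - X u) / \<sigma> u (X u)\<bar>
      \<le> B' * C * B' powr \<delta> * (m * m) * (v - u) powr (\<gamma> + \<gamma> * \<delta>)" .
  qed
qed

lemma chain_rule:
  "negligible_incr p q (\<lambda>u v. H v (X v) - H u (X u) - (X v - X u) / \<sigma> u (X u)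
     - integral {u..v} (\<lambda>r. Ht r (X r)))"
  using negligible_incr_add[OF chain_rule_time chain_rule_space]
  by (rule negligible_incr_cong) simp

context
  fixes I \<xi> b :: "real \<Rightarrow> real" and K0 :: real
  assumes I: "negligible_incr p q (\<lambda>u v. I v - I u - \<sigma> u (X u) * (\<xi> v - \<xi> u))"
    and b: "b \<in> borel_measurable borel" "\<And>t. t \<in> {p..q} \<Longrightarrow> \<bar>b t\<bar> \<le> K0"
begin

lemma drift_integrals:
  assumes "p \<le> u" "u \<le> v" "v \<le> q"
  shows "integral {p..v} b - integral {p..u} b = integral {u..v} b"
    "integral {p..v} (\<lambda>r. \<sigma> r (X r) * b r) - integral {p..u} (\<lambda>r. \<sigma> r (X r) * b r) = integral {u..v} (\<lambda>r. \<sigma> r (X r) * b r)"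
    "integral {p..v} (\<lambda>r. Ht r (X r)) - integral {p..u} (\<lambda>r. Ht r (X r)) = integral {u..v} (\<lambda>r. Ht r (X r))"
proof -
  have *: "integral {p..v} f - integral {p..u} f = integral {u..v} f" if "f integrable_on {p..q}" for f :: "real \<Rightarrow> real"
  proof -
    have "f integrable_on {p..v}" using assms by (intro integrable_subinterval_real[OF that]) auto
    from Henstock_Kurzweil_Integration.integral_combine[OF assms(1,2) this] show ?thesis by simp
  qed
  show "integral {p..v} b - integral {p..u} b = integral {u..v} b"
    by (intro * bounded_measurable_integral(2)[OF b])
  show "integral {p..v} (\<lambda>r. \<sigma> r (X r) * b r) - integral {p..u} (\<lambda>r. \<sigma> r (X r) * b r) = integral {u..v} (\<lambda>r. \<sigma> r (X r) * b r)"
    by (intro * integrable_continuous_mult_bounded[OF along_path_cont[OF \<sigma>_cont_J] b])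
  show "integral {p..v} (\<lambda>r. Ht r (X r)) - integral {p..u} (\<lambda>r. Ht r (X r)) = integral {u..v} (\<lambda>r. Ht r (X r))"
    by (intro * integrable_continuous_interval along_path_cont Ht_cont)
qed

lemma drift_negligible:
  "negligible_incr p q (\<lambda>u v. integral {u..v} (\<lambda>r. \<sigma> r (X r) * b r) - \<sigma> u (X u) * integral {u..v} b)"
proof -
  obtain A where A: "\<And>s t. s \<in> {p..q} \<Longrightarrow> t \<in> {p..q} \<Longrightarrow>
    \<bar>\<sigma> s (X s) - \<sigma> t (X t)\<bar> \<le> A * \<bar>s - t\<bar> powr (\<gamma> * \<delta>)"
    using \<sigma>_along_path_hoelder[OF pq(1,3) X] by blast
  show ?thesis using \<gamma> \<delta> by (intro negligible_incr_integral[OF _ A b]) auto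
qed

text \<open>By Young's estimate the equation gives \<open>X v - X u\<close>, up to negligible errors, as
  \<open>\<sigma> u (X u)\<close> times \<open>\<xi> v - \<xi> u + integral {u..v} b\<close>. The chain rule divides by \<open>\<sigma> u (X u)\<close> again,
  which leaves additive noise.\<close>
lemma sde_imp_transformed_ode:
  assumes eq: "\<And>t. t \<in> {p..q} \<Longrightarrow> X t = X p + (I t - I p) + integral {p..t} (\<lambda>r. \<sigma> r (X r) * b r)"
    and t: "t \<in> {p..q}"
  shows "H t (X t) = H p (X p) + (\<xi> t - \<xi> p) + integral {p..t} b + integral {p..t} (\<lambda>r. Ht r (X r))"
proof -
  obtain l r where lr: "{l..r} \<subseteq> J" "\<And>t. t \<in> {p..q} \<Longrightarrow> X t \<in> {l..r}" using X_hull by blast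
  obtain m M where m: "\<And>t x. t \<in> {0..1} \<Longrightarrow> x \<in> {l..r} \<Longrightarrow> \<bar>1 / \<sigma> t x\<bar> \<le> m"
    using \<sigma>_bounds[OF lr(1)] by metis
  define D where "D t = H t (X t) - \<xi> t - integral {p..t} b - integral {p..t} (\<lambda>r. Ht r (X r))" for t
  have "negligible_incr p q (\<lambda>u v. 1 / \<sigma> u (X u) * ((I v - I u - \<sigma> u (X u) * (\<xi> v - \<xi> u))
      + (integral {u..v} (\<lambda>r. \<sigma> r (X r) * b r) - \<sigma> u (X u) * integral {u..v} b)))"
    using m lr(2) pq by (intro negligible_incr_cmult[where B = m] negligible_incr_add I drift_negligible) auto
  from negligible_incr_add[OF chain_rule this]
  have "negligible_incr p q (\<lambda>u v. D v - D u)"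
  proof (rule negligible_incr_cong)
    fix u v assume uv: "p \<le> u" "u \<le> v" "v \<le> q"
    note ints = drift_integrals[OF uv]
    have nz: "\<sigma> u (X u) \<noteq> 0" using nonzero[of u "X u"] XJ[of u] uv pq by auto
    have dX: "X v - X u = (I v - I u) + integral {u..v} (\<lambda>r. \<sigma> r (X r) * b r)"
      using eq[of u] eq[of v] ints(2) uv by auto
    have "1 / \<sigma> u (X u) * ((I v - I u - \<sigma> u (X u) * (\<xi> v - \<xi> u))
      + (integral {u..v} (\<lambda>r. \<sigma> r (X r) * b r) - \<sigma> u (X u) * integral {u..v} b))
      = (X v - X u) / \<sigma> u (X u) - (\<xi> v - \<xi> u) - integral {u..v} b"
      unfolding dX using nz by (simp add: field_simps)
    then show "D v - D u = H v (X v) - H u (X u) - (X v - X u) / \<sigma> u (X u) - integral {u..v} (\<lambda>r. Ht r (X r))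
      + 1 / \<sigma> u (X u) * ((I v - I u - \<sigma> u (X u) * (\<xi> v - \<xi> u))
      + (integral {u..v} (\<lambda>r. \<sigma> r (X r) * b r) - \<sigma> u (X u) * integral {u..v} b))"
      using ints(1,3) by (simp add: D_def)
  qed
  from negligible_incr_imp_constant[OF this t] show ?thesis by (simp add: D_def)
qed

text \<open>The same expansions, multiplied by \<open>\<sigma> u (X u)\<close> instead of divided by it.\<close>
lemma transformed_ode_imp_sde:
  assumes eq: "\<And>t. t \<in> {p..q} \<Longrightarrow> H t (X t) = H p (X p) + (\<xi> t - \<xi> p) + integral {p..t} b + integral {p..t} (\<lambda>r. Ht r (X r))"
    and t: "t \<in> {p..q}"
  shows "X t = X p + (I t - I p) + integral {p..t} (\<lambda>r. \<sigma> r (X r) * b r)"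
proof -
  obtain l r where lr: "{l..r} \<subseteq> J" "\<And>t. t \<in> {p..q} \<Longrightarrow> X t \<in> {l..r}" using X_hull by blast
  obtain M where M: "\<And>t x. t \<in> {0..1} \<Longrightarrow> x \<in> {l..r} \<Longrightarrow> \<bar>\<sigma> t x\<bar> \<le> M"
    using \<sigma>_bounds[OF lr(1)] by metis
  define D where "D t = X t - I t - integral {p..t} (\<lambda>r. \<sigma> r (X r) * b r)" for t
  have "negligible_incr p q (\<lambda>u v. - \<sigma> u (X u) * (H v (X v) - H u (X u) - (X v - X u) / \<sigma> u (X u)
     - integral {u..v} (\<lambda>r. Ht r (X r))))"
    using M lr(2) pq by (intro negligible_incr_cmult[where B = M] chain_rule) auto
  from negligible_incr_diff[OF negligible_incr_diff[OF this I] drift_negligible]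
  have "negligible_incr p q (\<lambda>u v. D v - D u)"
  proof (rule negligible_incr_cong)
    fix u v assume uv: "p \<le> u" "u \<le> v" "v \<le> q"
    note ints = drift_integrals[OF uv]
    have nz: "\<sigma> u (X u) \<noteq> 0" using nonzero[of u "X u"] XJ[of u] uv pq by auto
    have dH: "H v (X v) - H u (X u) = (\<xi> v - \<xi> u) + integral {u..v} b + integral {u..v} (\<lambda>r. Ht r (X r))"
      using eq[of u] eq[of v] ints(1,3) uv by auto
    have "- \<sigma> u (X u) * (H v (X v) - H u (X u) - (X v - X u) / \<sigma> u (X u) - integral {u..v} (\<lambda>r. Ht r (X r)))
      = (X v - X u) - \<sigma> u (X u) * (\<xi> v - \<xi> u) - \<sigma> u (X u) * integral {u..v} b"
      unfolding dH using nz by (simp add: field_simps)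
    then show "D v - D u = - \<sigma> u (X u) * (H v (X v) - H u (X u) - (X v - X u) / \<sigma> u (X u)
        - integral {u..v} (\<lambda>r. Ht r (X r))) - (I v - I u - \<sigma> u (X u) * (\<xi> v - \<xi> u))
        - (integral {u..v} (\<lambda>r. \<sigma> r (X r) * b r) - \<sigma> u (X u) * integral {u..v} b)"
      using ints(2) by (simp add: D_def)
  qed
  from negligible_incr_imp_constant[OF this t] show ?thesis by (simp add: D_def)
qed

end

end

end

section \<open>Pathwise solutions\<close>

lemma negligible_incr_subinterval:
  "negligible_incr p q R \<Longrightarrow> p \<le> p' \<Longrightarrow> q' \<le> q \<Longrightarrow> negligible_incr p' q' R"
  unfolding negligible_incr_def by (meson order_trans)

lemma le_powr_of_le_one:
  fixes x \<gamma> :: real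
  assumes "0 \<le> x" "x \<le> 1" "\<gamma> \<le> 1"
  shows "x \<le> x powr \<gamma>"
  using powr_mono'[OF assms(3,1,2)] assms(1) by simp

context young_coefficient
begin

text \<open>The equation along one path, where \<open>b\<close> stands for the random drift coefficient evaluated along \<open>X\<close>.
  Of the symmetric integral \<open>I\<close> only its expansion is recorded, which determines it up to an
  additive constant.\<close>
definition path_solution :: "(real \<Rightarrow> real) \<Rightarrow> (real \<Rightarrow> real) \<Rightarrow> (real \<Rightarrow> real) \<Rightarrow> bool" where
  "path_solution \<xi> b X \<longleftrightarrow>
     (\<exists>B. \<forall>s\<in>{0..1}. \<forall>t\<in>{0..1}. \<bar>X s - X t\<bar> \<le> B * \<bar>s - t\<bar> powr \<gamma>) \<and>
     (\<exists>I. negligible_incr 0 1 (\<lambda>u v. I v - I u - \<sigma> u (X u) * (\<xi> v - \<xi> u)) \<and>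
        (\<forall>t\<in>{0..1}. X t = X 0 + (I t - I 0) + integral {0..t} (\<lambda>r. \<sigma> r (X r) * b r)))"

end

context component
begin

context
  fixes \<xi> b X :: "real \<Rightarrow> real" and K0 :: real
  assumes sol: "path_solution \<xi> b X"
    and b: "b \<in> borel_measurable borel" "\<And>t. t \<in> {0..1} \<Longrightarrow> \<bar>b t\<bar> \<le> K0"
begin

lemma path_cont: "continuous_on {0..1} X"
  using sol hoelder_imp_continuous_on[OF \<gamma>(1)] unfolding path_solution_def by metis

lemma transformed_increment:
  assumes pq: "0 \<le> p" "p \<le> q" "q \<le> 1" and XJ: "\<And>t. t \<in> {p..q} \<Longrightarrow> X t \<in> J"
  shows "H q (X q) - H p (X p) = (\<xi> q - \<xi> p) + integral {p..q} b + integral {p..q} (\<lambda>r. Ht r (X r))"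
proof -
  obtain B where B: "\<And>s t. s \<in> {0..1} \<Longrightarrow> t \<in> {0..1} \<Longrightarrow> \<bar>X s - X t\<bar> \<le> B * \<bar>s - t\<bar> powr \<gamma>"
    using sol unfolding path_solution_def by blast
  obtain I where I: "negligible_incr 0 1 (\<lambda>u v. I v - I u - \<sigma> u (X u) * (\<xi> v - \<xi> u))"
    and eq: "\<And>t. t \<in> {0..1} \<Longrightarrow> X t = X 0 + (I t - I 0) + integral {0..t} (\<lambda>r. \<sigma> r (X r) * b r)"
    using sol unfolding path_solution_def by blast
  have sub: "{p..q} \<subseteq> {0..1}" using pq by auto
  have B': "\<bar>X s - X t\<bar> \<le> B * \<bar>s - t\<bar> powr \<gamma>" if "s \<in> {p..q}" "t \<in> {p..q}" for s t
    using that sub by (intro B) blast+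
  have I': "negligible_incr p q (\<lambda>u v. I v - I u - \<sigma> u (X u) * (\<xi> v - \<xi> u))"
    using negligible_incr_subinterval[OF I] pq by simp
  have b': "\<bar>b t\<bar> \<le> K0" if "t \<in> {p..q}" for t
    using that sub by (intro b) blast
  have "continuous_on {0..1} (\<lambda>t. \<sigma> t (X t))"
    by (rule continuous_on_case_prod_compose[OF \<sigma>_cont]) (use path_cont in \<open>auto intro!: continuous_intros\<close>)
  then have i: "(\<lambda>r. \<sigma> r (X r) * b r) integrable_on {0..1}"
    using b by (intro integrable_continuous_mult_bounded[of 0 1 _ _ K0]) auto
  have eq': "X t = X p + (I t - I p) + integral {p..t} (\<lambda>r. \<sigma> r (X r) * b r)" if t: "t \<in> {p..q}" for t
  proof -
    have "(\<lambda>r. \<sigma> r (X r) * b r) integrable_on {0..t}"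
      using t pq by (intro integrable_subinterval_real[OF i]) auto
    then have "integral {0..p} (\<lambda>r. \<sigma> r (X r) * b r) + integral {p..t} (\<lambda>r. \<sigma> r (X r) * b r)
        = integral {0..t} (\<lambda>r. \<sigma> r (X r) * b r)"
      using t pq by (intro Henstock_Kurzweil_Integration.integral_combine) auto
    moreover have "t \<in> {0..1}" "p \<in> {0..1}" using t pq by auto
    ultimately show ?thesis using eq[of t] eq[of p] by linarith
  qed
  have "q \<in> {p..q}" using pq by simp
  from sde_imp_transformed_ode[OF pq B' XJ I' b(1) b' eq' this] show ?thesis by simp
qed

context
  fixes K\<xi> :: real
  assumes K\<xi>: "\<And>s t. s \<in> {0..1} \<Longrightarrow> t \<in> {0..1} \<Longrightarrow> \<bar>\<xi> s - \<xi> t\<bar> \<le> K\<xi>"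
begin

text \<open>As long as \<open>X\<close> stays in the component, its transform solves an integral equation with linearly
  growing right-hand side, so Gronwall's inequality bounds it in both time directions by constants
  that do not depend on how close the path comes to the boundary.\<close>
lemma transformed_path_bound:
  assumes pq: "0 \<le> p" "p \<le> q" "q \<le> 1" and XJ: "\<And>t. t \<in> {p..q} \<Longrightarrow> X t \<in> J"
  shows "\<bar>H q (X q)\<bar> \<le> (\<bar>H p (X p)\<bar> + K\<xi> + K0) * exp a"
    "\<bar>H p (X p)\<bar> \<le> (\<bar>H q (X q)\<bar> + K\<xi> + K0) * exp a"
proof -
  define Z where "Z t = \<bar>H t (X t)\<bar>" for t
  have Xc: "continuous_on {p..q} X" using path_cont pq by (elim continuous_on_subset) auto
  have comp: "continuous_on {p..q} (\<lambda>t. f t (X t))"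
    if "continuous_on ({0..1} \<times> J) (\<lambda>(t, x). f t x)" for f :: "real \<Rightarrow> real \<Rightarrow> real"
    by (rule continuous_on_case_prod_compose[OF that]) (use XJ pq Xc in \<open>auto intro!: continuous_intros\<close>)
  have Zc: "continuous_on {p..q} Z"
    unfolding Z_def[abs_def] by (intro continuous_intros comp H_cont)
  have Zi: "Z integrable_on {p..q}" using Zc by (rule integrable_continuous_interval)
  obtain W where W: "\<And>t. t \<in> {p..q} \<Longrightarrow> \<bar>Z t\<bar> \<le> W"
    using continuous_on_Icc_bounded[OF Zc] by metis
  have K0: "0 \<le> K0" "0 \<le> K\<xi>" using b(2)[of 0] K\<xi>[of 0 0] by auto
  have incr: "\<bar>H t (X t) - H s (X s)\<bar> \<le> K\<xi> + K0 + a * integral {s..t} Z"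
    if st: "p \<le> s" "s \<le> t" "t \<le> q" for s t
  proof -
    have "H t (X t) - H s (X s) = (\<xi> t - \<xi> s) + integral {s..t} b + integral {s..t} (\<lambda>r. Ht r (X r))"
      using st pq XJ by (intro transformed_increment) auto
    moreover have "\<bar>\<xi> t - \<xi> s\<bar> \<le> K\<xi>" using st pq by (intro K\<xi>) auto
    moreover have "\<bar>integral {s..t} b\<bar> \<le> K0 * (t - s)"
      using st pq b by (intro bounded_measurable_integral(4)) auto
    moreover have "K0 * (t - s) \<le> K0 * 1" using st pq K0 by (intro mult_left_mono) auto
    moreover have "norm (integral {s..t} (\<lambda>r. Ht r (X r))) \<le> integral {s..t} (\<lambda>r. a * Z r)"
    proof (rule integral_norm_bound_integral)
      show "(\<lambda>r. Ht r (X r)) integrable_on {s..t}"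
        using st by (intro integrable_continuous_interval continuous_on_subset[OF comp[OF Ht_cont]]) auto
      show "(\<lambda>r. a * Z r) integrable_on {s..t}"
        using st by (intro integrable_on_mult_right integrable_subinterval_real[OF Zi]) auto
      show "norm (Ht r (X r)) \<le> a * Z r" if "r \<in> {s..t}" for r
        unfolding Z_def using Ht_bound[of r "X r"] XJ[of r] that st pq by auto
    qed
    ultimately show ?thesis by simp
  qed
  have exp_le: "C * exp (a * (q - p)) \<le> C * exp a" if "C \<ge> 0" for C
    using that a pq by (intro mult_left_mono) (auto intro: mult_left_le)
  have "Z q \<le> (Z p + K\<xi> + K0) * exp (a * (q - p))"
  proof (rule gronwall[OF Zi abs_le_D1[OF W]])
    show "Z t \<le> Z p + K\<xi> + K0 + a * integral {p..t} Z" if "t \<in> {p..q}" for t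
      using incr[of p t] that unfolding Z_def by auto
  qed (use K0 a pq in \<open>auto simp: Z_def\<close>)
  then show "\<bar>H q (X q)\<bar> \<le> (\<bar>H p (X p)\<bar> + K\<xi> + K0) * exp a"
    using exp_le[of "Z p + K\<xi> + K0"] K0 by (simp add: Z_def)
  have "Z p \<le> (Z q + K\<xi> + K0) * exp (a * (q - p))"
  proof (rule gronwall_backward[OF Zi abs_le_D1[OF W]])
    show "Z t \<le> Z q + K\<xi> + K0 + a * integral {t..q} Z" if "t \<in> {p..q}" for t
      using incr[of t q] that unfolding Z_def by auto
  qed (use K0 a pq in \<open>auto simp: Z_def\<close>)
  then show "\<bar>H p (X p)\<bar> \<le> (\<bar>H q (X q)\<bar> + K\<xi> + K0) * exp a"
    using exp_le[of "Z q + K\<xi> + K0"] K0 by (simp add: Z_def)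
qed

text \<open>A path that is approached from inside the component with bounded transforms cannot sit at an end
  of the component, because \<open>H\<close> blows up there.\<close>
lemma no_exit:
  assumes e: "e \<in> {0..1}" and t: "\<And>n. t n \<in> {0..1}" "t \<longlonglongrightarrow> e"
    and XJ: "\<And>n. X (t n) \<in> J" and W: "\<And>n. \<bar>H (t n) (X (t n))\<bar> \<le> W"
  shows "X e \<in> J"
proof (rule ccontr)
  assume "X e \<notin> J"
  have lim: "(\<lambda>n. ereal (X (t n))) \<longlonglongrightarrow> ereal (X e)"
    using path_cont e t unfolding continuous_on_sequentially by (auto simp: o_def)
  have "lo \<le> ereal (X e)"
    by (rule LIMSEQ_le_const[OF lim]) (use XJ in \<open>auto simp: einterval_iff intro: less_imp_le\<close>)
  moreover have "ereal (X e) \<le> hi"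
    by (rule LIMSEQ_le_const2[OF lim]) (use XJ in \<open>auto simp: einterval_iff intro: less_imp_le\<close>)
  ultimately have "ereal (X e) \<in> {lo, hi}" using \<open>X e \<notin> J\<close> by (auto simp: einterval_iff)
  from H_blowup[OF t XJ lim this] have "\<forall>\<^sub>F n in sequentially. W < \<bar>H (t n) (X (t n))\<bar>"
    by (auto simp: filterlim_at_top_dense)
  then obtain n where "W < \<bar>H (t n) (X (t n))\<bar>" by (auto simp: eventually_sequentially)
  then show False using W[of n] by simp
qed

text \<open>Apply \<open>no_exit\<close> to the first time after \<open>t0\<close>, or the last time before \<open>t0\<close>, at which the path is
  outside the component. In particular no solution enters the component from outside.\<close>
lemma stays_in_component:
  assumes t0: "t0 \<in> {0..1}" "X t0 \<in> J" and t: "t \<in> {0..1}"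
  shows "X t \<in> J"
proof (rule ccontr)
  assume nt: "X t \<notin> J"
  define W where "W = (\<bar>H t0 (X t0)\<bar> + K\<xi> + K0) * exp a"
  have closed: "closed {s \<in> {p..q}. X s \<notin> J}" if "{p..q} \<subseteq> {0..1}" for p q
  proof -
    have "closed ({p..q} \<inter> X -` (- J))"
      using that J_open by (intro continuous_closed_preimage continuous_on_subset[OF path_cont]) auto
    moreover have "{s \<in> {p..q}. X s \<notin> J} = {p..q} \<inter> X -` (- J)" by auto
    ultimately show ?thesis by simp
  qed
  have inv: "(\<lambda>n. 1 / real (Suc n)) \<longlonglongrightarrow> 0" by (rule LIMSEQ_Suc[OF lim_1_over_n])
  show False
  proof (cases "t0 \<le> t")
    case True
    define E where "E = {s \<in> {t0..t}. X s \<notin> J}"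
    have E: "closed E" "t \<in> E" "bdd_below E"
      using closed[of t0 t] t0 t nt True by (auto simp: E_def bdd_below_def)
    define e where "e = Inf E"
    have eE: "e \<in> E" unfolding e_def using E by (intro closed_contains_Inf) auto
    then have e: "t0 \<le> e" "e \<le> t" "X e \<notin> J" by (auto simp: E_def)
    have "t0 < e" using e t0 by (cases "t0 = e") auto
    have before: "X s \<in> J" if "t0 \<le> s" "s < e" for s
      using cInf_lower[of s E] E(3) that e by (force simp: E_def e_def)
    define ts where "ts n = e - (e - t0) * (1 / real (Suc n))" for n
    have ts: "t0 \<le> ts n" "ts n < e" for n
      using \<open>t0 < e\<close> mult_left_le[of "1 / real (Suc n)" "e - t0"] by (auto simp: ts_def simp del: of_nat_Suc)
    have "ts \<longlonglongrightarrow> e - (e - t0) * 0" unfolding ts_def by (intro tendsto_intros inv)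
    then have "X e \<in> J"
    proof (intro no_exit[of e ts W])
      show "\<bar>H (ts n) (X (ts n))\<bar> \<le> W" for n
        unfolding W_def using ts[of n] t0 t e before by (intro transformed_path_bound(1)) auto
      show "X (ts n) \<in> J" for n using ts before by blast
      show "ts n \<in> {0..1}" for n using ts[of n] t0 t e by auto
    qed (use t0 t e in auto)
    then show False using e by simp
  next
    case False
    define E where "E = {s \<in> {t..t0}. X s \<notin> J}"
    have E: "closed E" "t \<in> E" "bdd_above E"
      using closed[of t t0] t0 t nt False by (auto simp: E_def bdd_above_def)
    define e where "e = Sup E"
    have eE: "e \<in> E" unfolding e_def using E by (intro closed_contains_Sup) auto
    then have e: "t \<le> e" "e \<le> t0" "X e \<notin> J" by (auto simp: E_def)
    have "e < t0" using e t0 by (cases "t0 = e") auto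
    have after: "X s \<in> J" if "s \<le> t0" "e < s" for s
      using cSup_upper[of s E] E(3) that e by (force simp: E_def e_def)
    define ts where "ts n = e + (t0 - e) * (1 / real (Suc n))" for n
    have ts: "ts n \<le> t0" "e < ts n" for n
      using \<open>e < t0\<close> mult_left_le[of "1 / real (Suc n)" "t0 - e"] by (auto simp: ts_def simp del: of_nat_Suc)
    have "ts \<longlonglongrightarrow> e + (t0 - e) * 0" unfolding ts_def by (intro tendsto_intros inv)
    then have "X e \<in> J"
    proof (intro no_exit[of e ts W])
      show "\<bar>H (ts n) (X (ts n))\<bar> \<le> W" for n
        unfolding W_def using ts[of n] t0 t e after by (intro transformed_path_bound(2)) auto
      show "X (ts n) \<in> J" for n using ts after by blast
      show "ts n \<in> {0..1}" for n using ts[of n] t0 t e by auto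
    qed (use t0 t e in auto)
    then show False using e by simp
  qed
qed

end

end

text \<open>The difference of the transforms satisfies Gronwall's inequality: the noise cancels, \<open>Ht\<close> is
  Lipschitz continuous with respect to \<open>H\<close>, and so is the drift, because \<open>X\<close> is recovered from its
  transform with Lipschitz constant \<open>sup \<bar>\<sigma>\<bar>\<close> over a compact part of the component.\<close>
lemma path_solution_unique:
  assumes X: "path_solution \<xi> b X" and X': "path_solution \<xi> b' X'"
    and b: "b \<in> borel_measurable borel" "\<And>t. t \<in> {0..1} \<Longrightarrow> \<bar>b t\<bar> \<le> K0"
    and b': "b' \<in> borel_measurable borel" "\<And>t. t \<in> {0..1} \<Longrightarrow> \<bar>b' t\<bar> \<le> K0"
    and lip: "\<And>t. t \<in> {0..1} \<Longrightarrow> \<bar>b t - b' t\<bar> \<le> L * \<bar>X t - X' t\<bar>"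
    and XJ: "\<And>t. t \<in> {0..1} \<Longrightarrow> X t \<in> J" and X'J: "\<And>t. t \<in> {0..1} \<Longrightarrow> X' t \<in> J"
    and init: "X 0 = X' 0" and t: "t \<in> {0..1}"
  shows "X t = X' t"
proof -
  have cont: "continuous_on {0..1} X" "continuous_on {0..1} X'"
    using X X' hoelder_imp_continuous_on[OF \<gamma>(1)] unfolding path_solution_def by metis+
  have comp: "continuous_on {0..1} (\<lambda>t. f t (w t))"
    if "continuous_on ({0..1} \<times> J) (\<lambda>(t, x). f t x)" "continuous_on {0..1} w" "\<And>t. t \<in> {0..1} \<Longrightarrow> w t \<in> J"
    for f :: "real \<Rightarrow> real \<Rightarrow> real" and w
    by (rule continuous_on_case_prod_compose[OF that(1)]) (use that(2,3) in \<open>auto intro!: continuous_intros\<close>)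
  obtain l1 r1 where lr1: "{l1..r1} \<subseteq> J" "\<And>t. t \<in> {0..1} \<Longrightarrow> X t \<in> {l1..r1}"
    using path_in_compact_subinterval[OF cont(1) _ _ XJ closed_interval_subset_J] by auto
  obtain l2 r2 where lr2: "{l2..r2} \<subseteq> J" "\<And>t. t \<in> {0..1} \<Longrightarrow> X' t \<in> {l2..r2}"
    using path_in_compact_subinterval[OF cont(2) _ _ X'J closed_interval_subset_J] by auto
  define l where "l = min l1 l2"
  define r where "r = max r1 r2"
  have ne: "l1 \<le> r1" "l2 \<le> r2" using lr1(2)[of 0] lr2(2)[of 0] by auto
  then have "l1 \<in> J" "l2 \<in> J" "r1 \<in> J" "r2 \<in> J" using lr1(1) lr2(1) by auto
  then have lr: "{l..r} \<subseteq> J"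
    unfolding l_def r_def by (intro closed_interval_subset_J) (auto simp: min_def max_def)
  have Xlr: "X t \<in> {l..r}" "X' t \<in> {l..r}" if "t \<in> {0..1}" for t
    using lr1(2)[OF that] lr2(2)[OF that] by (auto simp: l_def r_def)
  obtain M where M: "M > 0" "\<And>t x. t \<in> {0..1} \<Longrightarrow> x \<in> {l..r} \<Longrightarrow> \<bar>\<sigma> t x\<bar> \<le> M"
    using \<sigma>_bounds[OF lr] by metis
  define Z where "Z t = \<bar>H t (X t) - H t (X' t)\<bar>" for t
  have dist: "\<bar>X t - X' t\<bar> \<le> M * Z t" if "t \<in> {0..1}" for t
    unfolding Z_def using dist_le_H_dist[OF that lr Xlr[OF that]] M(2)[OF that] by blast
  have Zc: "continuous_on {0..1} Z"
    unfolding Z_def[abs_def] by (intro continuous_intros comp[OF H_cont cont(1) XJ] comp[OF H_cont cont(2) X'J])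
  have Zi: "Z integrable_on {0..1}" using Zc by (rule integrable_continuous_interval)
  obtain W where W: "\<And>t. t \<in> {0..1} \<Longrightarrow> \<bar>Z t\<bar> \<le> W"
    using continuous_on_Icc_bounded[OF Zc] by metis
  define A where "A = \<bar>L\<bar> * M + a"
  have "Z t \<le> 0 * exp (A * (t - 0))"
  proof (rule gronwall[OF Zi abs_le_D1[OF W]])
    show "0 \<le> A" using a M(1) by (simp add: A_def)
    fix t :: real assume t: "t \<in> {0..1}"
    have sub: "{0..t} \<subseteq> {0..1}" using t by auto
    have i: "(\<lambda>r. Ht r (w r)) integrable_on {0..t}"
      if "continuous_on {0..1} w" "\<And>t. t \<in> {0..1} \<Longrightarrow> w t \<in> J" for w
      using that sub by (intro integrable_continuous_interval continuous_on_subset[OF comp[OF Ht_cont]])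
    have ib: "b integrable_on {0..t}" "b' integrable_on {0..t}"
      using b b' sub by (auto intro!: bounded_measurable_integral(2)[where B = K0])
    have "H t (X t) - H 0 (X 0) = (\<xi> t - \<xi> 0) + integral {0..t} b + integral {0..t} (\<lambda>r. Ht r (X r))"
      using t by (intro transformed_increment[OF X b] XJ) auto
    moreover have "H t (X' t) - H 0 (X' 0) = (\<xi> t - \<xi> 0) + integral {0..t} b' + integral {0..t} (\<lambda>r. Ht r (X' r))"
      using t by (intro transformed_increment[OF X' b'] X'J) auto
    ultimately have diff1: "H t (X t) - H t (X' t) = (integral {0..t} b + integral {0..t} (\<lambda>r. Ht r (X r)))
        - (integral {0..t} b' + integral {0..t} (\<lambda>r. Ht r (X' r)))"
      unfolding init by linarith
    have diff2: "(integral {0..t} b + integral {0..t} (\<lambda>r. Ht r (X r)))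
        - (integral {0..t} b' + integral {0..t} (\<lambda>r. Ht r (X' r)))
      = integral {0..t} (\<lambda>r. (b r + Ht r (X r)) - (b' r + Ht r (X' r)))"
      using ib i[OF cont(1) XJ] i[OF cont(2) X'J]
      by (simp add: Henstock_Kurzweil_Integration.integral_diff Henstock_Kurzweil_Integration.integral_add
          integrable_add)
    have "norm (integral {0..t} (\<lambda>r. (b r + Ht r (X r)) - (b' r + Ht r (X' r)))) \<le> integral {0..t} (\<lambda>r. A * Z r)"
    proof (rule integral_norm_bound_integral)
      show "(\<lambda>r. (b r + Ht r (X r)) - (b' r + Ht r (X' r))) integrable_on {0..t}"
        using ib i[OF cont(1) XJ] i[OF cont(2) X'J] by (intro integrable_diff integrable_add)
      show "(\<lambda>r. A * Z r) integrable_on {0..t}"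
        using t by (intro integrable_on_mult_right integrable_subinterval_real[OF Zi]) auto
      fix r assume "r \<in> {0..t}"
      then have r: "r \<in> {0..1}" using sub by auto
      have "\<bar>b r - b' r\<bar> \<le> L * \<bar>X r - X' r\<bar>" by (rule lip[OF r])
      also have "\<dots> \<le> \<bar>L\<bar> * (M * Z r)" using dist[OF r] by (intro mult_mono) auto
      finally have "\<bar>b r - b' r\<bar> \<le> \<bar>L\<bar> * (M * Z r)" .
      moreover have "\<bar>Ht r (X r) - Ht r (X' r)\<bar> \<le> a * Z r"
        unfolding Z_def by (intro Ht_lipschitz_wrt_H r XJ X'J)
      ultimately show "norm ((b r + Ht r (X r)) - (b' r + Ht r (X' r))) \<le> A * Z r"
        by (simp add: A_def algebra_simps)
    qed
    then have "\<bar>H t (X t) - H t (X' t)\<bar> \<le> integral {0..t} (\<lambda>r. A * Z r)"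
      unfolding diff1 diff2 real_norm_def .
    then show "Z t \<le> 0 + A * integral {0..t} Z" unfolding Z_def[of t] by simp
  qed (use t in auto)
  then show ?thesis using dist[OF t] M(1) by (smt (verit) mult_nonneg_nonpos mult_zero_left)
qed

text \<open>The right-hand side of the transformed equation as a function of \<open>y = H s x\<close>.\<close>
definition transformed_drift :: "(real \<Rightarrow> real \<Rightarrow> real) \<Rightarrow> real \<Rightarrow> real \<Rightarrow> real" where
  "transformed_drift \<alpha> s y = \<alpha> (proj01 s) (K (proj01 s) y) + Ht (proj01 s) (K (proj01 s) y)"

lemma continuous_on_K_proj01: "continuous_on UNIV (\<lambda>q. K (proj01 (fst q)) (snd q))"
  by (rule continuous_on_case_prod_compose[OF K_cont])
    (auto intro!: continuous_intros continuous_on_compose2[OF continuous_on_proj01[of UNIV]])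

lemma continuous_on_Ht_K_proj01: "continuous_on UNIV (\<lambda>q. Ht (proj01 (fst q)) (K (proj01 (fst q)) (snd q)))"
  by (rule continuous_on_case_prod_compose[OF Ht_cont])
    (auto intro!: continuous_intros continuous_on_K_proj01 K_in
      continuous_on_compose2[OF continuous_on_proj01[of UNIV]])

text \<open>The transformed equation is solved by Picard iteration and \<open>K\<close> maps its solution back. The result
  is a limit of explicit iterates, to keep track of measurability in a random parameter, and it
  satisfies the equation with any \<open>I\<close> that has the expansion of the symmetric integral.\<close>
lemma path_solution_exists:
  assumes \<xi>': "\<exists>B. \<forall>s\<in>{0..1}. \<forall>t\<in>{0..1}. \<bar>\<xi> s - \<xi> t\<bar> \<le> B * \<bar>s - t\<bar> powr \<gamma>"
    and \<alpha>_meas': "\<forall>x\<in>borel_measurable borel. (\<lambda>s. \<alpha> (proj01 s) (x s)) \<in> borel_measurable borel"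
    and \<alpha>_bound': "\<exists>K0. \<forall>t\<in>{0..1}. \<forall>x. \<bar>\<alpha> t x\<bar> \<le> K0"
    and \<alpha>_lip': "\<forall>R. \<exists>L. \<forall>t\<in>{0..1}. \<forall>x y. \<bar>x\<bar> \<le> R \<longrightarrow> \<bar>y\<bar> \<le> R \<longrightarrow> \<bar>\<alpha> t x - \<alpha> t y\<bar> \<le> L * \<bar>x - y\<bar>"
    and x0: "x0 \<in> J"
  shows "\<exists>Y. (\<forall>t\<in>{0..1}. (\<lambda>k. picard (\<lambda>t. H 0 x0 + (\<xi> (proj01 t) - \<xi> 0)) (transformed_drift \<alpha>) k t) \<longlonglongrightarrow> Y t) \<and>
    (\<exists>B. \<forall>s\<in>{0..1}. \<forall>t\<in>{0..1}. \<bar>K s (Y s) - K t (Y t)\<bar> \<le> B * \<bar>s - t\<bar> powr \<gamma>) \<and>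
    (\<forall>I. negligible_incr 0 1 (\<lambda>u v. I v - I u - \<sigma> u (K u (Y u)) * (\<xi> v - \<xi> u)) \<longrightarrow>
       (\<forall>t\<in>{0..1}. K t (Y t) = x0 + (I t - I 0) + integral {0..t} (\<lambda>r. \<sigma> r (K r (Y r)) * \<alpha> r (K r (Y r)))))"
proof -
  obtain B\<xi> where \<xi>: "\<And>s t. s \<in> {0..1} \<Longrightarrow> t \<in> {0..1} \<Longrightarrow> \<bar>\<xi> s - \<xi> t\<bar> \<le> B\<xi> * \<bar>s - t\<bar> powr \<gamma>"
    using \<xi>' by blast
  obtain K0 where \<alpha>_bound: "\<And>t x. t \<in> {0..1} \<Longrightarrow> \<bar>\<alpha> t x\<bar> \<le> K0"
    using \<alpha>_bound' by blast
  have \<alpha>_meas: "(\<lambda>s. \<alpha> (proj01 s) (x s)) \<in> borel_measurable borel" if "x \<in> borel_measurable borel" for x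
    using \<alpha>_meas' that by blast
  let ?z = "\<lambda>t. H 0 x0 + (\<xi> (proj01 t) - \<xi> 0)"
  let ?b = "transformed_drift \<alpha>"
  have K_meas: "(\<lambda>s. K (proj01 s) (y s)) \<in> borel_measurable borel"
    "(\<lambda>s. Ht (proj01 s) (K (proj01 s) (y s))) \<in> borel_measurable borel"
    if y: "y \<in> borel_measurable borel" for y
  proof -
    have p: "(\<lambda>s. (s, y s)) \<in> borel \<rightarrow>\<^sub>M (borel :: (real \<times> real) measure)"
      unfolding borel_prod[symmetric] using y by simp
    show "(\<lambda>s. K (proj01 s) (y s)) \<in> borel_measurable borel"
      using measurable_compose[OF p borel_measurable_continuous_onI[OF continuous_on_K_proj01]] by simp
    show "(\<lambda>s. Ht (proj01 s) (K (proj01 s) (y s))) \<in> borel_measurable borel"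
      using measurable_compose[OF p borel_measurable_continuous_onI[OF continuous_on_Ht_K_proj01]] by simp
  qed
  have K0: "0 \<le> K0" using \<alpha>_bound[of 0 0] by simp
  have image: "\<exists>l r. {l..r} \<subseteq> J \<and> (\<forall>t\<in>{0..1}. \<forall>y. \<bar>y\<bar> \<le> R \<longrightarrow> K t y \<in> {l..r})" for R
  proof (cases "R \<ge> 0")
    case True
    define T where "T = {0..1::real} \<times> {-R..R}"
    have T: "compact T" "T \<noteq> {}" using True by (auto simp: T_def compact_Times)
    have kc: "continuous_on T (\<lambda>q. K (fst q) (snd q))"
      using continuous_on_subset[OF K_cont, of T] by (auto simp: T_def case_prod_beta)
    obtain q1 where q1: "q1 \<in> T" "\<And>q. q \<in> T \<Longrightarrow> K (fst q1) (snd q1) \<le> K (fst q) (snd q)"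
      using continuous_attains_inf[OF T kc] by blast
    obtain q2 where q2: "q2 \<in> T" "\<And>q. q \<in> T \<Longrightarrow> K (fst q) (snd q) \<le> K (fst q2) (snd q2)"
      using continuous_attains_sup[OF T kc] by blast
    have "K (fst q1) (snd q1) \<in> J" "K (fst q2) (snd q2) \<in> J"
      using q1(1) q2(1) by (auto simp: T_def intro!: K_in)
    then have "{K (fst q1) (snd q1)..K (fst q2) (snd q2)} \<subseteq> J" by (rule closed_interval_subset_J)
    moreover have "K t y \<in> {K (fst q1) (snd q1)..K (fst q2) (snd q2)}" if "t \<in> {0..1}" "\<bar>y\<bar> \<le> R" for t y
      using q1(2)[of "(t, y)"] q2(2)[of "(t, y)"] that by (auto simp: T_def abs_le_iff)
    ultimately show ?thesis by blast
  next
    case False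
    then have "\<not> \<bar>y\<bar> \<le> R" for y :: real by linarith
    then show ?thesis by (intro exI[of _ 1] exI[of _ 0]) auto
  qed
  have z_cont: "continuous_on UNIV ?z"
    by (intro continuous_intros continuous_on_comp_proj01 hoelder_imp_continuous_on[OF \<gamma>(1) \<xi>])
  have b_meas0: "(\<lambda>s. ?b s (y s)) \<in> borel_measurable borel" if "y \<in> borel_measurable borel" for y
    unfolding transformed_drift_def using K_meas[OF that] \<alpha>_meas by (intro borel_measurable_add) auto
  have growth: "\<bar>?b s y\<bar> \<le> K0 + a * \<bar>y\<bar>" if "s \<in> {0..1}" for s y
    using \<alpha>_bound[OF that, of "K s y"] Ht_bound[OF that K_in[OF that], of y] H_K[OF that, of y]
    by (simp add: transformed_drift_def proj01_id[OF that])
  have lip: "\<exists>L. \<forall>s\<in>{0..1}. \<forall>y y'. \<bar>y\<bar> \<le> R \<longrightarrow> \<bar>y'\<bar> \<le> R \<longrightarrow> \<bar>?b s y - ?b s y'\<bar> \<le> L * \<bar>y - y'\<bar>" for R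
  proof -
    obtain l r where lr: "{l..r} \<subseteq> J" "\<And>t y. t \<in> {0..1} \<Longrightarrow> \<bar>y\<bar> \<le> R \<Longrightarrow> K t y \<in> {l..r}"
      using image[of R] by metis
    obtain M where M: "M > 0" "\<And>t x. t \<in> {0..1} \<Longrightarrow> x \<in> {l..r} \<Longrightarrow> \<bar>\<sigma> t x\<bar> \<le> M"
      using \<sigma>_bounds[OF lr(1)] by metis
    obtain L where L: "\<forall>t\<in>{0..1}. \<forall>x y. \<bar>x\<bar> \<le> max \<bar>l\<bar> \<bar>r\<bar> \<longrightarrow> \<bar>y\<bar> \<le> max \<bar>l\<bar> \<bar>r\<bar> \<longrightarrow>
        \<bar>\<alpha> t x - \<alpha> t y\<bar> \<le> L * \<bar>x - y\<bar>"
      using \<alpha>_lip'[rule_format, of "max \<bar>l\<bar> \<bar>r\<bar>"] by metis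
    have "\<bar>?b s y - ?b s y'\<bar> \<le> (\<bar>L\<bar> * M + a) * \<bar>y - y'\<bar>"
      if s: "s \<in> {0..1}" and y: "\<bar>y\<bar> \<le> R" "\<bar>y'\<bar> \<le> R" for s y y'
    proof -
      have "\<bar>K s y - K s y'\<bar> \<le> M * \<bar>H s (K s y) - H s (K s y')\<bar>"
        by (intro dist_le_H_dist[OF s lr(1)] lr(2) s y M(2))
      then have KK: "\<bar>K s y - K s y'\<bar> \<le> M * \<bar>y - y'\<bar>" by (simp add: H_K[OF s])
      have "\<bar>\<alpha> s (K s y) - \<alpha> s (K s y')\<bar> \<le> L * \<bar>K s y - K s y'\<bar>"
        using L s lr(2)[OF s y(1)] lr(2)[OF s y(2)] by auto
      also have "\<dots> \<le> \<bar>L\<bar> * (M * \<bar>y - y'\<bar>)" using KK by (intro mult_mono) auto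
      finally have "\<bar>\<alpha> s (K s y) - \<alpha> s (K s y')\<bar> \<le> \<bar>L\<bar> * (M * \<bar>y - y'\<bar>)" .
      moreover have "\<bar>Ht s (K s y) - Ht s (K s y')\<bar> \<le> a * \<bar>y - y'\<bar>"
        using Ht_lipschitz_wrt_H[OF s K_in[OF s] K_in[OF s]] by (simp add: H_K[OF s])
      ultimately show ?thesis by (simp add: transformed_drift_def proj01_id[OF s] algebra_simps)
    qed
    then show ?thesis by blast
  qed
  obtain Y where Y_lim: "\<And>t. t \<in> {0..1} \<Longrightarrow> (\<lambda>k. picard ?z ?b k t) \<longlonglongrightarrow> Y t"
    and Y_meas: "Y \<in> borel_measurable borel" and Y_cont: "continuous_on {0..1} Y"
    and Y_eq: "\<And>t. t \<in> {0..1} \<Longrightarrow> Y t = ?z t + integral {0..t} (\<lambda>s. ?b s (Y s))"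
    using picard_converges[OF z_cont b_meas0 a growth lip] by blast
  define X where "X t = K t (Y t)" for t
  have HX: "H t (X t) = Y t" if "t \<in> {0..1}" for t using H_K[OF that] by (simp add: X_def)
  have XJ: "X t \<in> J" if "t \<in> {0..1}" for t using K_in[OF that] by (simp add: X_def)
  obtain R where R: "\<And>t. t \<in> {0..1} \<Longrightarrow> \<bar>Y t\<bar> \<le> R"
    using continuous_on_Icc_bounded[OF Y_cont] by metis
  obtain l r where lr: "{l..r} \<subseteq> J" "\<And>t. t \<in> {0..1} \<Longrightarrow> X t \<in> {l..r}"
    unfolding X_def using image[of R] R by metis
  obtain M where M: "M > 0" "\<And>t x. t \<in> {0..1} \<Longrightarrow> x \<in> {l..r} \<Longrightarrow> \<bar>\<sigma> t x\<bar> \<le> M"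
    using \<sigma>_bounds[OF lr(1)] by metis
  have "continuous_on ({0..1} \<times> {l..r}) (\<lambda>(t, x). Ht t x)"
    using lr(1) by (intro continuous_on_subset[OF Ht_cont]) auto
  then obtain N where N: "N > 0" "\<And>t x. t \<in> {0..1} \<Longrightarrow> x \<in> {l..r} \<Longrightarrow> \<bar>Ht t x\<bar> \<le> N"
    using bounded_on_rectangle by metis
  define b where "b s = \<alpha> (proj01 s) (K (proj01 s) (Y s))" for s
  have b_meas: "b \<in> borel_measurable borel"
    unfolding b_def[abs_def] by (intro \<alpha>_meas K_meas Y_meas)
  have b_bound: "\<bar>b s\<bar> \<le> K0" if "s \<in> {0..1}" for s
    unfolding b_def by (intro \<alpha>_bound) auto
  have Ht_meas: "(\<lambda>s. Ht (proj01 s) (K (proj01 s) (Y s))) \<in> borel_measurable borel"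
    by (intro K_meas Y_meas)
  have Ht_bd: "\<bar>Ht (proj01 s) (K (proj01 s) (Y s))\<bar> \<le> N" if "s \<in> {0..1}" for s
    using N(2)[OF that lr(2)[OF that]] proj01_id[OF that] by (simp add: X_def)
  have drift_eq: "?b s (Y s) = b s + Ht (proj01 s) (K (proj01 s) (Y s))" for s
    by (simp add: b_def transformed_drift_def)
  have i: "b integrable_on {u..v}" "(\<lambda>s. Ht (proj01 s) (K (proj01 s) (Y s))) integrable_on {u..v}"
    if "0 \<le> u" "v \<le> 1" for u v
    using that b_bound Ht_bd
    by (auto intro!: bounded_measurable_integral(2)[OF b_meas, of _ _ K0] bounded_measurable_integral(2)[OF Ht_meas, of _ _ N])
  have HX_eq: "Y t = H 0 x0 + (\<xi> t - \<xi> 0) + integral {0..t} b + integral {0..t} (\<lambda>s. Ht s (X s))"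
    if t: "t \<in> {0..1}" for t
  proof -
    have "integral {0..t} (\<lambda>s. ?b s (Y s)) = integral {0..t} b + integral {0..t} (\<lambda>s. Ht (proj01 s) (K (proj01 s) (Y s)))"
      unfolding drift_eq using i[of 0 t] t by (simp add: Henstock_Kurzweil_Integration.integral_add)
    also have "integral {0..t} (\<lambda>s. Ht (proj01 s) (K (proj01 s) (Y s))) = integral {0..t} (\<lambda>s. Ht s (X s))"
      using t by (intro Henstock_Kurzweil_Integration.integral_cong) (simp add: X_def proj01_id)
    finally show ?thesis using Y_eq[OF t] proj01_id[OF t] by simp
  qed
  have Y0: "Y 0 = H 0 x0" using HX_eq[of 0] by simp
  have X0: "X 0 = x0" unfolding X_def Y0 by (rule K_H[OF _ x0]) simp
  define B where "B = M * (\<bar>B\<xi>\<bar> + K0 + 2 * N)"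
  have hoelder1: "\<bar>X v - X u\<bar> \<le> B * \<bar>v - u\<bar> powr \<gamma>" if uv: "0 \<le> u" "u \<le> v" "v \<le> 1" for u v
  proof -
    have u: "u \<in> {0..1}" and v: "v \<in> {0..1}" using uv by auto
    have le: "v - u \<le> (v - u) powr \<gamma>" using uv \<gamma> by (intro le_powr_of_le_one) auto
    have Ht_bd': "norm (integral {u..v} (\<lambda>s. Ht s (X s))) \<le> integral {u..v} (\<lambda>s. N)"
    proof (rule integral_norm_bound_integral)
      show "(\<lambda>s. Ht s (X s)) integrable_on {u..v}"
        using i(2)[OF uv(1,3)] by (rule integrable_eq) (use uv in \<open>auto simp: X_def proj01_id\<close>)
      show "norm (Ht s (X s)) \<le> N" if "s \<in> {u..v}" for s
        using N(2)[OF _ lr(2)] that uv by auto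
    qed (rule integrable_const_ivl)
    have "Y v - Y u = (\<xi> v - \<xi> u) + integral {u..v} b + integral {u..v} (\<lambda>s. Ht s (X s))"
    proof -
      have "(\<lambda>s. Ht s (X s)) integrable_on {0..v}"
        by (rule integrable_eq[OF i(2)[of 0 v]]) (use uv in \<open>auto simp: X_def proj01_id\<close>)
      from Henstock_Kurzweil_Integration.integral_combine[OF uv(1,2) this]
        Henstock_Kurzweil_Integration.integral_combine[OF uv(1,2) i(1)[OF order_refl uv(3)]]
      show ?thesis using HX_eq[OF u] HX_eq[OF v] by simp
    qed
    moreover have "\<bar>\<xi> v - \<xi> u\<bar> \<le> \<bar>B\<xi>\<bar> * (v - u) powr \<gamma>"
    proof -
      have "\<bar>\<xi> v - \<xi> u\<bar> \<le> B\<xi> * \<bar>v - u\<bar> powr \<gamma>" by (intro \<xi> u v)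
      also have "\<dots> \<le> \<bar>B\<xi>\<bar> * \<bar>v - u\<bar> powr \<gamma>" by (intro mult_right_mono) auto
      finally show ?thesis using uv by simp
    qed
    moreover have "\<bar>integral {u..v} b\<bar> \<le> K0 * (v - u)"
      using uv b_bound by (intro bounded_measurable_integral(4) b_meas) auto
    moreover have "K0 * (v - u) \<le> K0 * (v - u) powr \<gamma>" using K0 le by (intro mult_left_mono)
    moreover have "\<bar>integral {u..v} (\<lambda>s. Ht s (X s))\<bar> \<le> N * (v - u)"
      using Ht_bd' uv by (simp add: mult.commute)
    moreover have "N * (v - u) \<le> N * (v - u) powr \<gamma>" using N le by (intro mult_left_mono) auto
    ultimately have dY: "\<bar>Y v - Y u\<bar> \<le> (\<bar>B\<xi>\<bar> + K0 + N) * (v - u) powr \<gamma>" by (simp add: algebra_simps)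
    have "norm (H v (X v) - H u (X v)) \<le> N * norm (v - u)"
      by (rule field_differentiable_bound[OF _ H_deriv_t])
        (use u v lr N XJ in \<open>auto intro!: N(2)\<close>)
    then have "\<bar>H v (X v) - H u (X v)\<bar> \<le> N * (v - u)" using uv by simp
    also have "\<dots> \<le> N * (v - u) powr \<gamma>" using N(1) le by (intro mult_left_mono) auto
    finally have "\<bar>H v (X v) - H u (X v)\<bar> \<le> N * (v - u) powr \<gamma>" .
    then have "\<bar>H u (X v) - H u (X u)\<bar> \<le> (\<bar>B\<xi>\<bar> + K0 + 2 * N) * (v - u) powr \<gamma>"
      using dY HX[OF u] HX[OF v] by (simp add: algebra_simps)
    then have "M * \<bar>H u (X v) - H u (X u)\<bar> \<le> B * (v - u) powr \<gamma>"
      unfolding B_def using M(1) by (simp add: mult.assoc)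
    moreover have "\<bar>X v - X u\<bar> \<le> M * \<bar>H u (X v) - H u (X u)\<bar>"
      by (intro dist_le_H_dist[OF u lr(1)] lr(2) u v M(2))
    ultimately show ?thesis using uv by simp
  qed
  have hoelder: "\<bar>X s - X t\<bar> \<le> B * \<bar>s - t\<bar> powr \<gamma>" if "s \<in> {0..1}" "t \<in> {0..1}" for s t
    using hoelder1[of s t] hoelder1[of t s] that by (cases "s \<le> t") (auto simp: abs_minus_commute)
  have sol: "X t = x0 + (I t - I 0) + integral {0..t} (\<lambda>r. \<sigma> r (X r) * \<alpha> r (X r))"
    if I: "negligible_incr 0 1 (\<lambda>u v. I v - I u - \<sigma> u (X u) * (\<xi> v - \<xi> u))" and t: "t \<in> {0..1}" for I t
  proof -
    have "X t = X 0 + (I t - I 0) + integral {0..t} (\<lambda>r. \<sigma> r (X r) * b r)"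
    proof (rule transformed_ode_imp_sde[OF _ _ _ hoelder XJ I b_meas b_bound _ t])
      show "H t (X t) = H 0 (X 0) + (\<xi> t - \<xi> 0) + integral {0..t} b + integral {0..t} (\<lambda>r. Ht r (X r))"
        if "t \<in> {0..1}" for t using HX_eq[OF that] HX[OF that] X0 by simp
    qed auto
    also have "integral {0..t} (\<lambda>r. \<sigma> r (X r) * b r) = integral {0..t} (\<lambda>r. \<sigma> r (X r) * \<alpha> r (X r))"
      using t by (intro Henstock_Kurzweil_Integration.integral_cong) (simp add: X_def b_def proj01_id)
    finally show ?thesis using X0 by simp
  qed
  show ?thesis
  proof (intro exI[of _ Y] conjI ballI allI impI)
    show "(\<lambda>k. picard ?z ?b k t) \<longlonglongrightarrow> Y t" if "t \<in> {0..1}" for t by (rule Y_lim[OF that])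
    show "\<exists>B. \<forall>s\<in>{0..1}. \<forall>t\<in>{0..1}. \<bar>K s (Y s) - K t (Y t)\<bar> \<le> B * \<bar>s - t\<bar> powr \<gamma>"
      using hoelder unfolding X_def by blast
  qed (rule sol[unfolded X_def])
qed

end

section \<open>Measurability of continuous processes\<close>

lemma proj01_borel: "proj01 \<in> borel_measurable borel"
  by (intro borel_measurable_continuous_onI continuous_on_proj01)

lemma abs_proj01_diff_le: "\<bar>proj01 s - proj01 t\<bar> \<le> \<bar>s - t\<bar>"
  by (auto simp: proj01_def min_def max_def)

text \<open>By continuity in time, \<open>X\<close> is the limit of its piecewise constant discretisations, each of which
  uses only countably many of its time points.\<close>
lemma continuous_process_jointly_measurable:
  assumes X: "continuous_process M X"
  shows "(\<lambda>p. X (proj01 (fst p)) (snd p)) \<in> borel_measurable (borel \<Otimes>\<^sub>M M)"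
proof (rule borel_measurable_LIMSEQ_metric)
  fix k :: nat
  have "(\<lambda>p. X (proj01 (real_of_int i / real (Suc k))) (snd p)) \<in> borel_measurable (borel \<Otimes>\<^sub>M M)" for i :: int
    using X by (intro measurable_compose[OF measurable_snd]) (auto simp: continuous_process_def)
  moreover have "(\<lambda>p. \<lfloor>fst p * real (Suc k)\<rfloor>) \<in> (borel \<Otimes>\<^sub>M M) \<rightarrow>\<^sub>M count_space UNIV"
    by measurable
  ultimately show "(\<lambda>p. X (proj01 (real_of_int \<lfloor>fst p * real (Suc k)\<rfloor> / real (Suc k))) (snd p))
      \<in> borel_measurable (borel \<Otimes>\<^sub>M M)"
    by (rule measurable_compose_countable)
next
  fix p :: "real \<times> 'a" assume "p \<in> space (borel \<Otimes>\<^sub>M M)"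
  then have \<omega>: "snd p \<in> space M" by (auto simp: space_pair_measure)
  define s where "s = fst p"
  have "(\<lambda>k. s + (-1) * (1 / real (Suc k))) \<longlonglongrightarrow> s + (-1) * 0"
    by (intro tendsto_intros LIMSEQ_Suc[OF lim_1_over_n])
  then have l: "(\<lambda>k. s + (-1) * (1 / real (Suc k))) \<longlonglongrightarrow> s" by simp
  have lim: "(\<lambda>k. real_of_int \<lfloor>s * real (Suc k)\<rfloor> / real (Suc k)) \<longlonglongrightarrow> s"
  proof (rule tendsto_sandwich[OF _ _ l tendsto_const])
    show "\<forall>\<^sub>F k in sequentially. s + (-1) * (1 / real (Suc k)) \<le> real_of_int \<lfloor>s * real (Suc k)\<rfloor> / real (Suc k)"
    proof (intro always_eventually allI)
      fix k
      have "(s * real (Suc k) - 1) / real (Suc k) \<le> real_of_int \<lfloor>s * real (Suc k)\<rfloor> / real (Suc k)"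
        by (intro divide_right_mono) linarith+
      moreover have "(s * real (Suc k) - 1) / real (Suc k) = s + (-1) * (1 / real (Suc k))"
        by (simp add: diff_divide_distrib del: of_nat_Suc)
      ultimately show "s + (-1) * (1 / real (Suc k)) \<le> real_of_int \<lfloor>s * real (Suc k)\<rfloor> / real (Suc k)" by simp
    qed
    have "real_of_int \<lfloor>s * real (Suc k)\<rfloor> \<le> s * real (Suc k)" for k by linarith
    then show "\<forall>\<^sub>F k in sequentially. real_of_int \<lfloor>s * real (Suc k)\<rfloor> / real (Suc k) \<le> s"
      by (auto simp: field_simps simp del: of_nat_Suc)
  qed
  have "continuous_on UNIV (\<lambda>t. X (proj01 t) (snd p))"
    using X \<omega> by (intro continuous_on_comp_proj01) (auto simp: continuous_process_def)
  then have "isCont (\<lambda>t. X (proj01 t) (snd p)) s" by (simp add: continuous_on_eq_continuous_at)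
  from isCont_tendsto_compose[OF this lim]
  show "(\<lambda>k. X (proj01 (real_of_int \<lfloor>fst p * real (Suc k)\<rfloor> / real (Suc k))) (snd p)) \<longlonglongrightarrow> X (proj01 (fst p)) (snd p)"
    by (simp add: s_def)
qed

text \<open>For continuous paths it is enough that \<open>\<delta>\<close> is exceeded at the projection of a rational time.\<close>
lemma exceedance_measurable:
  assumes D: "continuous_process M D"
  shows "{\<omega> \<in> space M. \<exists>t\<in>{0..1}. \<delta> < \<bar>D t \<omega>\<bar>} \<in> sets M"
proof -
  have "{\<omega> \<in> space M. \<exists>t\<in>{0..1}. \<delta> < \<bar>D t \<omega>\<bar>}
      = (\<Union>q::rat. {\<omega> \<in> space M. \<delta> < \<bar>D (proj01 (of_rat q)) \<omega>\<bar>})"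
  proof (intro set_eqI iffI)
    fix \<omega> assume "\<omega> \<in> {\<omega> \<in> space M. \<exists>t\<in>{0..1}. \<delta> < \<bar>D t \<omega>\<bar>}"
    then obtain t where \<omega>: "\<omega> \<in> space M" and t: "t \<in> {0..1}" "\<delta> < \<bar>D t \<omega>\<bar>" by auto
    have "continuous_on UNIV (\<lambda>t. \<bar>D (proj01 t) \<omega>\<bar>)"
      using D \<omega> by (intro continuous_intros continuous_on_comp_proj01) (auto simp: continuous_process_def)
    then have "open {s. \<delta> < \<bar>D (proj01 s) \<omega>\<bar>}"
      by (intro open_Collect_less continuous_on_const)
    moreover have "t \<in> {s. \<delta> < \<bar>D (proj01 s) \<omega>\<bar>}" using t by (simp add: proj01_id)
    ultimately obtain e where e: "e > 0" "ball t e \<subseteq> {s. \<delta> < \<bar>D (proj01 s) \<omega>\<bar>}"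
      using open_contains_ball by blast
    obtain q :: rat where "t < of_rat q" "of_rat q < t + e"
      using of_rat_dense[of t "t + e"] e by auto
    then have "of_rat q \<in> ball t e" by (auto simp: dist_real_def)
    then show "\<omega> \<in> (\<Union>q::rat. {\<omega> \<in> space M. \<delta> < \<bar>D (proj01 (of_rat q)) \<omega>\<bar>})"
      using e(2) \<omega> by auto
  next
    fix \<omega> assume "\<omega> \<in> (\<Union>q::rat. {\<omega> \<in> space M. \<delta> < \<bar>D (proj01 (of_rat q)) \<omega>\<bar>})"
    then obtain q :: rat where "\<omega> \<in> space M" "\<delta> < \<bar>D (proj01 (of_rat q)) \<omega>\<bar>" by auto
    then show "\<omega> \<in> {\<omega> \<in> space M. \<exists>t\<in>{0..1}. \<delta> < \<bar>D t \<omega>\<bar>}"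
      by (auto intro!: bexI[of _ "proj01 (of_rat q)"])
  qed
  also have "\<dots> \<in> sets M"
  proof (intro sets.countable_UN image_subsetI)
    fix q :: rat
    have [measurable]: "D (proj01 (of_rat q)) \<in> borel_measurable M"
      using D by (auto simp: continuous_process_def)
    show "{\<omega> \<in> space M. \<delta> < \<bar>D (proj01 (of_rat q)) \<omega>\<bar>} \<in> sets M" by measurable
  qed
  finally show ?thesis .
qed

lemma sym_integrand_continuous:
  assumes Y: "continuous_process M Y" and X: "continuous_process M X" and \<omega>: "\<omega> \<in> space M"
  shows "continuous_on {0..1} (\<lambda>s. Y s \<omega> * (X (proj01 (s + \<epsilon>)) \<omega> - X (proj01 (s - \<epsilon>)) \<omega>))"
proof -
  have "continuous_on {0..1} (\<lambda>s. X (proj01 (s + e)) \<omega>)" for e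
    using X \<omega> by (intro continuous_on_compose2[OF continuous_on_comp_proj01[of "\<lambda>t. X t \<omega>" UNIV]])
      (auto simp: continuous_process_def intro!: continuous_intros)
  from this[of \<epsilon>] this[of "- \<epsilon>"] show ?thesis
    using Y \<omega> by (intro continuous_intros) (auto simp: continuous_process_def)
qed

lemma sym_approx_eq_integral:
  assumes Y: "continuous_process M Y" and X: "continuous_process M X" and \<omega>: "\<omega> \<in> space M" and t: "t \<in> {0..1}"
  shows "sym_approx Y X \<epsilon> t \<omega> =
    1 / (2 * \<epsilon>) * integral {0..t} (\<lambda>s. Y s \<omega> * (X (proj01 (s + \<epsilon>)) \<omega> - X (proj01 (s - \<epsilon>)) \<omega>))"
proof -
  have "set_integrable lborel {0..t} (\<lambda>s. Y s \<omega> * (X (proj01 (s + \<epsilon>)) \<omega> - X (proj01 (s - \<epsilon>)) \<omega>))"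
    using t by (intro borel_integrable_atLeastAtMost' continuous_on_subset[OF sym_integrand_continuous[OF Y X \<omega>]]) auto
  then show ?thesis by (simp add: sym_approx_def set_borel_integral_eq_integral)
qed

lemma sym_approx_continuous_process:
  assumes Y: "continuous_process M Y" and X: "continuous_process M X"
  shows "continuous_process M (sym_approx Y X \<epsilon>)"
  unfolding continuous_process_def
proof (intro conjI ballI)
  fix t :: real assume t: "t \<in> {0..1}"
  have m: "(\<lambda>p. Z (proj01 (snd p + e)) (fst p)) \<in> borel_measurable (M \<Otimes>\<^sub>M lborel)"
    if "continuous_process M Z" for Z e
  proof -
    have "(\<lambda>p. (snd p + e, fst p)) \<in> (M \<Otimes>\<^sub>M lborel) \<rightarrow>\<^sub>M (borel \<Otimes>\<^sub>M M)" by measurable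
    from measurable_compose[OF this continuous_process_jointly_measurable[OF that]] show ?thesis by simp
  qed
  have [measurable]: "(\<lambda>p. Y (proj01 (snd p)) (fst p)) \<in> borel_measurable (M \<Otimes>\<^sub>M lborel)"
    "(\<lambda>p. X (proj01 (snd p + \<epsilon>)) (fst p)) \<in> borel_measurable (M \<Otimes>\<^sub>M lborel)"
    "(\<lambda>p. X (proj01 (snd p - \<epsilon>)) (fst p)) \<in> borel_measurable (M \<Otimes>\<^sub>M lborel)"
    using m[OF Y, of 0] m[OF X, of \<epsilon>] m[OF X, of "- \<epsilon>"] by simp_all
  let ?f = "\<lambda>\<omega> s. indicat_real {0..t} s * (Y (proj01 s) \<omega> * (X (proj01 (s + \<epsilon>)) \<omega> - X (proj01 (s - \<epsilon>)) \<omega>))"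
  have "(\<lambda>\<omega>. \<integral>s. ?f \<omega> s \<partial>lborel) \<in> borel_measurable M"
  proof (rule lborel.borel_measurable_lebesgue_integral)
    show "case_prod ?f \<in> borel_measurable (M \<Otimes>\<^sub>M lborel)"
      unfolding case_prod_beta' by measurable
  qed
  moreover have "sym_approx Y X \<epsilon> t = (\<lambda>\<omega>. 1 / (2 * \<epsilon>) * (\<integral>s. ?f \<omega> s \<partial>lborel))"
    unfolding fun_eq_iff sym_approx_def set_lebesgue_integral_def
    using t by (intro allI arg_cong2[of _ _ _ _ "(*)"] Bochner_Integration.integral_cong refl)
      (auto simp: indicator_def proj01_id)
  ultimately show "sym_approx Y X \<epsilon> t \<in> borel_measurable M"
    by (simp only: borel_measurable_times borel_measurable_const)
next
  fix \<omega> assume \<omega>: "\<omega> \<in> space M"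
  have "continuous_on {0..1} (\<lambda>t. 1 / (2 * \<epsilon>) * integral {0..t} (\<lambda>s. Y s \<omega> * (X (proj01 (s + \<epsilon>)) \<omega> - X (proj01 (s - \<epsilon>)) \<omega>)))"
    by (intro continuous_intros indefinite_integral_continuous_1 integrable_continuous_interval
        sym_integrand_continuous[OF Y X \<omega>])
  then show "continuous_on {0..1} (\<lambda>t. sym_approx Y X \<epsilon> t \<omega>)"
    by (rule continuous_on_eq) (simp add: sym_approx_eq_integral[OF Y X \<omega>])
qed

lemma continuous_process_diff:
  "continuous_process M X \<Longrightarrow> continuous_process M Y \<Longrightarrow> continuous_process M (\<lambda>t \<omega>. X t \<omega> - Y t \<omega>)"
  unfolding continuous_process_def by (auto intro!: continuous_intros borel_measurable_diff)

section \<open>Pathwise convergence and convergence in probability\<close>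

text \<open>A sequence of events with vanishing probabilities almost surely fails infinitely often. Hence
  there are, for almost every path, arbitrarily small \<open>\<epsilon>\<close> for which the approximation is uniformly
  close to \<open>I\<close>, and for small \<open>\<epsilon>\<close> it is also close to \<open>L\<close>.\<close>
lemma symmetric_integral_eq_pathwise_limit:
  assumes M: "prob_space M" and I: "is_symmetric_integral M Y X I"
    and lim: "AE \<omega> in M. uniform_limit {0..1} (\<lambda>\<epsilon> t. sym_approx Y X \<epsilon> t \<omega>) (L \<omega>) (at_right 0)"
  shows "AE \<omega> in M. \<forall>t\<in>{0..1}. I t \<omega> = L \<omega> t"
proof -
  interpret prob_space M by (rule M)
  have Y: "continuous_process M Y" and X: "continuous_process M X" and Ic: "continuous_process M I"
    and conv: "\<And>\<delta>. \<delta> > 0 \<Longrightarrow> ((\<lambda>\<epsilon>. measure M {\<omega> \<in> space M. \<exists>t\<in>{0..1}. \<delta> < \<bar>sym_approx Y X \<epsilon> t \<omega> - I t \<omega>\<bar>})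
               \<longlongrightarrow> 0) (at_right 0)"
    using I by (auto simp: is_symmetric_integral_def)
  define \<epsilon> where "\<epsilon> k = 1 / real (Suc k)" for k
  have \<epsilon>: "filterlim \<epsilon> (at_right 0) sequentially"
    unfolding \<epsilon>_def[abs_def] by (rule filterlim_inverse_Suc_at_right)
  define E where "E j k = {\<omega> \<in> space M. \<exists>t\<in>{0..1}. 1 / real (Suc j) < \<bar>sym_approx Y X (\<epsilon> k) t \<omega> - I t \<omega>\<bar>}" for j k
  have E_sets: "E j k \<in> sets M" for j k
    unfolding E_def by (intro exceedance_measurable continuous_process_diff sym_approx_continuous_process X Y Ic)
  have E_lim: "(\<lambda>k. measure M (E j k)) \<longlonglongrightarrow> 0" for j
    unfolding E_def using filterlim_compose[OF conv[of "1 / real (Suc j)"] \<epsilon>] by simp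
  have null: "(\<Inter>k\<in>{m..}. E j k) \<in> null_sets M" for j m
  proof -
    have s: "(\<Inter>k\<in>{m..}. E j k) \<in> sets M" by (intro sets.countable_INT') (use E_sets in auto)
    have "measure M (\<Inter>k\<in>{m..}. E j k) \<le> 0"
    proof (rule LIMSEQ_le_const[OF E_lim[of j]], intro exI allI impI)
      fix k assume "m \<le> k"
      then show "measure M (\<Inter>k\<in>{m..}. E j k) \<le> measure M (E j k)"
        by (intro finite_measure_mono E_sets) auto
    qed
    then have "measure M (\<Inter>k\<in>{m..}. E j k) = 0" by (simp add: measure_le_0_iff)
    then show ?thesis using s by (simp add: null_sets_def emeasure_eq_measure)
  qed
  have "AE \<omega> in M. \<forall>j m. \<omega> \<notin> (\<Inter>k\<in>{m..}. E j k)"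
    unfolding AE_all_countable by (intro allI AE_not_in null)
  with lim AE_space show ?thesis
  proof eventually_elim
    case (elim \<omega>)
    show ?case
    proof
      fix t :: real assume t: "t \<in> {0..1}"
      have "\<bar>I t \<omega> - L \<omega> t\<bar> \<le> 0"
      proof (rule LIMSEQ_le_const)
        show "(\<lambda>j. 2 * (1 / real (Suc j))) \<longlonglongrightarrow> 0"
          using tendsto_mult[OF tendsto_const LIMSEQ_Suc[OF lim_1_over_n], of 2] by simp
        have "\<bar>I t \<omega> - L \<omega> t\<bar> \<le> 2 * (1 / real (Suc j))" for j
        proof -
          have "\<forall>\<^sub>F k in sequentially. \<forall>t\<in>{0..1}. dist (sym_approx Y X (\<epsilon> k) t \<omega>) (L \<omega> t) < 1 / real (Suc j)"
            using uniform_limitD[OF elim(1), of "1 / real (Suc j)"]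
            by (intro eventually_compose_filterlim[OF _ \<epsilon>]) simp
          then obtain m where "\<forall>k\<ge>m. \<forall>t\<in>{0..1}. dist (sym_approx Y X (\<epsilon> k) t \<omega>) (L \<omega> t) < 1 / real (Suc j)"
            unfolding eventually_sequentially by blast
          then have m: "dist (sym_approx Y X (\<epsilon> k) t \<omega>) (L \<omega> t) < 1 / real (Suc j)" if "k \<ge> m" for k
            using that t by blast
          obtain k where k: "k \<ge> m" "\<omega> \<notin> E j k" using elim(3) by blast
          have "\<bar>sym_approx Y X (\<epsilon> k) t \<omega> - I t \<omega>\<bar> \<le> 1 / real (Suc j)"
            using k(2) elim(2) t by (auto simp: E_def not_less simp del: of_nat_Suc)
          then show ?thesis using m[OF k(1)] by (simp add: dist_real_def)
        qed
        then show "\<exists>N. \<forall>n\<ge>N. \<bar>I t \<omega> - L \<omega> t\<bar> \<le> 2 * (1 / real (Suc n))" by blast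
      qed
      then show "I t \<omega> = L \<omega> t" by simp
    qed
  qed
qed

text \<open>Almost every path leaves the exceedance events eventually, so their probabilities vanish by
  dominated convergence.\<close>
lemma symmetric_integral_of_pathwise_limit:
  assumes M: "prob_space M"
    and Y: "continuous_process M Y" and X: "continuous_process M X" and I: "continuous_process M I"
    and lim: "AE \<omega> in M. uniform_limit {0..1} (\<lambda>\<epsilon> t. sym_approx Y X \<epsilon> t \<omega>) (\<lambda>t. I t \<omega>) (at_right 0)"
  shows "is_symmetric_integral M Y X I"
  unfolding is_symmetric_integral_def
proof (intro conjI Y X I allI impI)
  interpret prob_space M by (rule M)
  fix \<delta> :: real assume \<delta>: "\<delta> > 0"
  define E where "E \<epsilon> = {\<omega> \<in> space M. \<exists>t\<in>{0..1}. \<delta> < \<bar>sym_approx Y X \<epsilon> t \<omega> - I t \<omega>\<bar>}" for \<epsilon>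
  have E: "E \<epsilon> \<in> sets M" for \<epsilon>
    unfolding E_def by (intro exceedance_measurable continuous_process_diff sym_approx_continuous_process X Y I)
  have "((\<lambda>\<epsilon>. measure M (E \<epsilon>)) \<longlongrightarrow> 0) (at_right 0)"
  proof (rule tendsto_at_right_sequentially[of 0 1])
    fix \<epsilon> :: "nat \<Rightarrow> real" assume \<epsilon>: "\<And>n. 0 < \<epsilon> n" "\<epsilon> \<longlonglongrightarrow> 0"
    then have fl: "filterlim \<epsilon> (at_right 0) sequentially"
      by (auto simp: filterlim_at less_imp_neq[symmetric])
    have "(\<lambda>n. \<integral>\<omega>. indicat_real (E (\<epsilon> n)) \<omega> \<partial>M) \<longlonglongrightarrow> (\<integral>\<omega>. 0 \<partial>M)"
    proof (rule integral_dominated_convergence[where w = "\<lambda>_. 1"])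
      show "AE \<omega> in M. (\<lambda>n. indicat_real (E (\<epsilon> n)) \<omega>) \<longlonglongrightarrow> 0"
        using lim
      proof eventually_elim
        case (elim \<omega>)
        have "\<forall>\<^sub>F n in sequentially. \<forall>t\<in>{0..1}. dist (sym_approx Y X (\<epsilon> n) t \<omega>) (I t \<omega>) < \<delta>"
          by (intro eventually_compose_filterlim[OF uniform_limitD[OF elim \<delta>] fl])
        then have "\<forall>\<^sub>F n in sequentially. indicat_real (E (\<epsilon> n)) \<omega> = 0"
          by eventually_elim (auto simp: E_def dist_real_def indicator_def)
        then show ?case by (rule tendsto_eventually)
      qed
    qed (use E in \<open>auto simp: indicator_def\<close>)
    then show "(\<lambda>n. measure M (E (\<epsilon> n))) \<longlonglongrightarrow> 0" using E by simp
  qed simp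
  then show "((\<lambda>\<epsilon>. measure M {\<omega> \<in> space M. \<exists>t\<in>{0..1}. \<delta> < \<bar>sym_approx Y X \<epsilon> t \<omega> - I t \<omega>\<bar>}) \<longlongrightarrow> 0) (at_right 0)"
    by (simp add: E_def)
qed

text \<open>The extension of \<open>X\<close> beyond \<open>{0..1}\<close> by constants keeps its Hoelder constant, so the convergence
  theorem for Young integrals applies to the symmetric approximations.\<close>
lemma pathwise_symmetric_integral:
  assumes Y: "continuous_process M Y" and X: "continuous_process M X" and \<omega>: "\<omega> \<in> space M"
    and \<theta>: "1 < \<beta> + \<gamma>" and \<beta>: "0 < \<beta>" and \<gamma>: "0 < \<gamma>"
    and Yh: "\<And>s t. s \<in> {0..1} \<Longrightarrow> t \<in> {0..1} \<Longrightarrow> \<bar>Y s \<omega> - Y t \<omega>\<bar> \<le> A * \<bar>s - t\<bar> powr \<beta>"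
    and Xh: "\<And>s t. s \<in> {0..1} \<Longrightarrow> t \<in> {0..1} \<Longrightarrow> \<bar>X s \<omega> - X t \<omega>\<bar> \<le> B * \<bar>s - t\<bar> powr \<gamma>"
  obtains I where "uniform_limit {0..1} (\<lambda>\<epsilon> t. sym_approx Y X \<epsilon> t \<omega>) I (at_right 0)"
    "negligible_incr 0 1 (\<lambda>u v. I v - I u - Y u \<omega> * (X v \<omega> - X u \<omega>))" "I 0 = 0"
proof -
  have g: "\<bar>X (proj01 s) \<omega> - X (proj01 t) \<omega>\<bar> \<le> \<bar>B\<bar> * \<bar>s - t\<bar> powr \<gamma>" for s t
  proof -
    have "\<bar>X (proj01 s) \<omega> - X (proj01 t) \<omega>\<bar> \<le> B * \<bar>proj01 s - proj01 t\<bar> powr \<gamma>" by (intro Xh) auto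
    also have "\<dots> \<le> \<bar>B\<bar> * \<bar>s - t\<bar> powr \<gamma>"
      using \<gamma> by (intro mult_mono powr_mono2 abs_proj01_diff_le) auto
    finally show ?thesis .
  qed
  obtain I C where ul: "uniform_limit {0..1} (\<lambda>\<epsilon> t. 1 / (2 * \<epsilon>) * integral {0..t}
      (\<lambda>r. Y r \<omega> * (X (proj01 (r + \<epsilon>)) \<omega> - X (proj01 (r - \<epsilon>)) \<omega>))) I (at_right 0)"
    and est: "\<And>u v. 0 \<le> u \<Longrightarrow> u \<le> v \<Longrightarrow> v \<le> 1 \<Longrightarrow>
      \<bar>I v - I u - Y u \<omega> * (X (proj01 v) \<omega> - X (proj01 u) \<omega>)\<bar> \<le> C * (v - u) powr (\<beta> + \<gamma>)"
    using young_symmetric_integral[where f = "\<lambda>s. Y s \<omega>" and g = "\<lambda>s. X (proj01 s) \<omega>",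
        OF \<theta> \<beta> \<gamma> Yh g] by blast
  have ul': "uniform_limit {0..1} (\<lambda>\<epsilon> t. sym_approx Y X \<epsilon> t \<omega>) I (at_right 0)"
    using ul by (rule uniform_limit_cong'[THEN iffD2, rotated 2])
      (simp_all add: sym_approx_eq_integral[OF Y X \<omega>])
  have "negligible_incr 0 1 (\<lambda>u v. I v - I u - Y u \<omega> * (X (proj01 v) \<omega> - X (proj01 u) \<omega>))"
    using \<theta> est by (rule negligible_incr_powr)
  then have "negligible_incr 0 1 (\<lambda>u v. I v - I u - Y u \<omega> * (X v \<omega> - X u \<omega>))"
    by (rule negligible_incr_cong) (simp add: proj01_id)
  moreover have "I 0 = 0"
  proof (rule tendsto_unique[OF _ tendsto_uniform_limitI[OF ul'] ])
    have "sym_approx Y X \<epsilon> 0 \<omega> = 0" for \<epsilon>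
      using sym_approx_eq_integral[OF Y X \<omega>, of 0 \<epsilon>] by simp
    then show "((\<lambda>\<epsilon>. sym_approx Y X \<epsilon> 0 \<omega>) \<longlongrightarrow> 0) (at_right 0)" by simp
  qed auto
  ultimately show ?thesis using ul' that by blast
qed

section \<open>Solutions of the stochastic equation\<close>

lemma coefficient_along_path_measurable:
  fixes x :: "real \<Rightarrow> real"
  assumes "(\<lambda>p. \<alpha> (proj01 (fst p)) (fst (snd p)) (snd (snd p))) \<in> borel_measurable (borel \<Otimes>\<^sub>M (borel \<Otimes>\<^sub>M M))"
    and "x \<in> borel_measurable borel" "\<omega> \<in> space M"
  shows "(\<lambda>s. \<alpha> (proj01 s) (x s) \<omega>) \<in> borel_measurable borel"
proof -
  have "(\<lambda>s. (s, (x s, \<omega>))) \<in> borel \<rightarrow>\<^sub>M (borel \<Otimes>\<^sub>M (borel \<Otimes>\<^sub>M M))"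
    using assms(2,3) by measurable
  from measurable_compose[OF this assms(1)] show ?thesis by simp
qed

context component
begin

text \<open>Fubini's theorem, by induction: the integral over time of a jointly measurable function is
  measurable in its parameters, which here are the random parameter and the upper limit.\<close>
lemma picard_jointly_measurable:
  assumes z: "(\<lambda>p. z (snd p) (fst p)) \<in> borel_measurable (borel \<Otimes>\<^sub>M M)"
    and \<alpha>: "(\<lambda>p. \<alpha> (proj01 (fst p)) (fst (snd p)) (snd (snd p))) \<in> borel_measurable (borel \<Otimes>\<^sub>M (borel \<Otimes>\<^sub>M M))"
  shows "(\<lambda>p. picard (z (snd p)) (transformed_drift (\<lambda>s x. \<alpha> s x (snd p))) k (fst p)) \<in> borel_measurable (borel \<Otimes>\<^sub>M M)"
proof (induction k)
  case 0
  show ?case by simp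
next
  case (Suc k)
  let ?N = "(borel \<Otimes>\<^sub>M M) \<Otimes>\<^sub>M (lborel :: real measure)"
  define y where "y q = picard (z (snd (fst q))) (transformed_drift (\<lambda>s x. \<alpha> s x (snd (fst q)))) k (snd q)"
    for q :: "(real \<times> 'a) \<times> real"
  have "(\<lambda>q. (snd q, snd (fst q))) \<in> ?N \<rightarrow>\<^sub>M (borel \<Otimes>\<^sub>M M)" by measurable
  from measurable_compose[OF this Suc] have y: "y \<in> borel_measurable ?N" by (simp add: y_def[abs_def])
  have p: "(\<lambda>q. (snd q, y q)) \<in> ?N \<rightarrow>\<^sub>M (borel :: (real \<times> real) measure)"
    unfolding borel_prod[symmetric] using y by measurable
  define x where "x q = K (proj01 (snd q)) (y q)" for q
  have x: "x \<in> borel_measurable ?N"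
    unfolding x_def[abs_def]
    using measurable_compose[OF p borel_measurable_continuous_onI[OF continuous_on_K_proj01]] by simp
  have Hx: "(\<lambda>q. Ht (proj01 (snd q)) (x q)) \<in> borel_measurable ?N"
    unfolding x_def[abs_def]
    using measurable_compose[OF p borel_measurable_continuous_onI[OF continuous_on_Ht_K_proj01]] by simp
  have "(\<lambda>q. (snd q, (x q, snd (fst q)))) \<in> ?N \<rightarrow>\<^sub>M (borel \<Otimes>\<^sub>M (borel \<Otimes>\<^sub>M M))"
    using x by measurable
  from measurable_compose[OF this \<alpha>]
  have \<alpha>x: "(\<lambda>q. \<alpha> (proj01 (snd q)) (x q) (snd (fst q))) \<in> borel_measurable ?N" by simp
  define f where "f q = indicat_real {0..proj01 (fst (fst q))} (snd q)
      * (\<alpha> (proj01 (snd q)) (x q) (snd (fst q)) + Ht (proj01 (snd q)) (x q))" for q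
  have ind: "(\<lambda>q. indicat_real {0..proj01 (fst (fst q))} (snd q)) \<in> borel_measurable ?N"
  proof -
    have [measurable]: "(\<lambda>q. proj01 (fst (fst q))) \<in> borel_measurable ?N"
      by (intro measurable_compose[OF _ proj01_borel]) measurable
    have "(\<lambda>q. indicat_real {0..proj01 (fst (fst q))} (snd q))
        = (\<lambda>q. if 0 \<le> snd q \<and> snd q \<le> proj01 (fst (fst q)) then 1 else 0)"
      by (auto simp: indicator_def)
    also have "\<dots> \<in> borel_measurable ?N" by measurable
    finally show ?thesis .
  qed
  have f: "f \<in> borel_measurable ?N"
    unfolding f_def[abs_def] by (intro borel_measurable_times borel_measurable_add ind \<alpha>x Hx)
  have "(\<lambda>p. \<integral>s. f (p, s) \<partial>lborel) \<in> borel_measurable (borel \<Otimes>\<^sub>M M)"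
    using f by (intro lborel.borel_measurable_lebesgue_integral) (simp add: case_prod_beta')
  moreover have "picard (z (snd p)) (transformed_drift (\<lambda>s x. \<alpha> s x (snd p))) (Suc k) (fst p)
      = z (snd p) (fst p) + (\<integral>s. f (p, s) \<partial>lborel)" for p
    by (simp add: f_def x_def y_def transformed_drift_def set_lebesgue_integral_def)
  ultimately show ?case using z by simp
qed

text \<open>The Picard iterates are formed for all \<open>\<omega>\<close>, with \<open>c\<close> as initial value where \<open>\<eta>\<close> lies outside the
  component; their limit is measurable everywhere and is a solution where it should be.\<close>
lemma measurable_solution_process:
  assumes \<xi>: "continuous_process M \<xi>" and \<eta>: "\<eta> \<in> borel_measurable M"
    and \<alpha>: "(\<lambda>p. \<alpha> (proj01 (fst p)) (fst (snd p)) (snd (snd p))) \<in> borel_measurable (borel \<Otimes>\<^sub>M (borel \<Otimes>\<^sub>M M))"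
    and G: "\<And>\<omega>. \<omega> \<in> G \<Longrightarrow> \<omega> \<in> space M"
    and \<xi>_hoelder: "\<And>\<omega>. \<omega> \<in> G \<Longrightarrow> \<exists>B. \<forall>s\<in>{0..1}. \<forall>t\<in>{0..1}. \<bar>\<xi> s \<omega> - \<xi> t \<omega>\<bar> \<le> B * \<bar>s - t\<bar> powr \<gamma>"
    and \<alpha>_bound: "\<And>\<omega>. \<omega> \<in> G \<Longrightarrow> \<exists>K0. \<forall>t\<in>{0..1}. \<forall>x. \<bar>\<alpha> t x \<omega>\<bar> \<le> K0"
    and \<alpha>_lip: "\<And>\<omega> R. \<omega> \<in> G \<Longrightarrow> \<exists>L. \<forall>t\<in>{0..1}. \<forall>x y. \<bar>x\<bar> \<le> R \<longrightarrow> \<bar>y\<bar> \<le> R \<longrightarrow> \<bar>\<alpha> t x \<omega> - \<alpha> t y \<omega>\<bar> \<le> L * \<bar>x - y\<bar>"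
  shows "\<exists>X. (\<forall>t\<in>{0..1}. X t \<in> borel_measurable M) \<and>
    (\<forall>\<omega>\<in>G. \<eta> \<omega> \<in> J \<longrightarrow>
      (\<exists>B. \<forall>s\<in>{0..1}. \<forall>t\<in>{0..1}. \<bar>X s \<omega> - X t \<omega>\<bar> \<le> B * \<bar>s - t\<bar> powr \<gamma>) \<and>
      (\<forall>I. negligible_incr 0 1 (\<lambda>u v. I v - I u - \<sigma> u (X u \<omega>) * (\<xi> v \<omega> - \<xi> u \<omega>)) \<longrightarrow>
       (\<forall>t\<in>{0..1}. X t \<omega> = \<eta> \<omega> + (I t - I 0) + integral {0..t} (\<lambda>r. \<sigma> r (X r \<omega>) * \<alpha> r (X r \<omega>) \<omega>))))"
proof -
  define x0 where "x0 \<omega> = (if \<eta> \<omega> \<in> J then \<eta> \<omega> else c)" for \<omega>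
  define z where "z \<omega> t = H 0 (x0 \<omega>) + (\<xi> (proj01 t) \<omega> - \<xi> 0 \<omega>)" for \<omega> t
  define Yk where "Yk k t \<omega> = picard (z \<omega>) (transformed_drift (\<lambda>s x. \<alpha> s x \<omega>)) k t" for k t \<omega>
  define X where "X t \<omega> = K t (lim (\<lambda>k. Yk k t \<omega>))" for t \<omega>
  have J_borel: "J \<in> sets borel" by simp
  have x0: "x0 \<in> borel_measurable M"
    unfolding x0_def[abs_def] using \<eta> J_borel by measurable
  have H0: "(\<lambda>\<omega>. H 0 (x0 \<omega>)) \<in> borel_measurable M"
  proof -
    have "(\<lambda>x. indicator J x *\<^sub>R H 0 x) \<in> borel_measurable borel"
      by (intro borel_measurable_continuous_on_indicator J_borel continuous_on_section[OF H_cont]) simp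
    from measurable_compose[OF x0 this] have "(\<lambda>\<omega>. indicator J (x0 \<omega>) *\<^sub>R H 0 (x0 \<omega>)) \<in> borel_measurable M" .
    moreover have "x0 \<omega> \<in> J" for \<omega> using c by (simp add: x0_def)
    ultimately show ?thesis by simp
  qed
  have z_meas: "(\<lambda>p. z (snd p) (fst p)) \<in> borel_measurable (borel \<Otimes>\<^sub>M M)"
  proof -
    have "\<xi> 0 \<in> borel_measurable M" using \<xi> by (auto simp: continuous_process_def)
    then show ?thesis
      unfolding z_def
      by (intro borel_measurable_add borel_measurable_diff continuous_process_jointly_measurable[OF \<xi>]
          measurable_compose[OF measurable_snd H0] measurable_compose[OF measurable_snd])
  qed
  have X_meas: "X t \<in> borel_measurable M" if t: "t \<in> {0..1}" for t
  proof -
    have "Yk k t \<in> borel_measurable M" for k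
    proof -
      have "(\<lambda>\<omega>. (t, \<omega>)) \<in> M \<rightarrow>\<^sub>M borel \<Otimes>\<^sub>M M" by measurable
      from measurable_compose[OF this picard_jointly_measurable[where z = z and k = k, OF z_meas \<alpha>]]
      show ?thesis by (simp add: Yk_def[abs_def])
    qed
    then have "(\<lambda>\<omega>. lim (\<lambda>k. Yk k t \<omega>)) \<in> borel_measurable M" by (intro borel_measurable_lim_metric)
    moreover have "K t \<in> borel_measurable borel"
      using continuous_on_section[OF K_cont t] by (intro borel_measurable_continuous_onI)
    ultimately show ?thesis unfolding X_def[abs_def] by (rule measurable_compose)
  qed
  have path: "(\<exists>B. \<forall>s\<in>{0..1}. \<forall>t\<in>{0..1}. \<bar>X s \<omega> - X t \<omega>\<bar> \<le> B * \<bar>s - t\<bar> powr \<gamma>) \<and>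
     (\<forall>I. negligible_incr 0 1 (\<lambda>u v. I v - I u - \<sigma> u (X u \<omega>) * (\<xi> v \<omega> - \<xi> u \<omega>)) \<longrightarrow>
       (\<forall>t\<in>{0..1}. X t \<omega> = \<eta> \<omega> + (I t - I 0) + integral {0..t} (\<lambda>r. \<sigma> r (X r \<omega>) * \<alpha> r (X r \<omega>) \<omega>)))"
    if \<omega>: "\<omega> \<in> G" and \<eta>J: "\<eta> \<omega> \<in> J" for \<omega>
  proof -
    have meas: "\<forall>x\<in>borel_measurable borel. (\<lambda>s. \<alpha> (proj01 s) (x s) \<omega>) \<in> borel_measurable borel"
      using coefficient_along_path_measurable[OF \<alpha> _ G[OF \<omega>]] by blast
    obtain Y where Y_lim: "\<forall>t\<in>{0..1}. (\<lambda>k. picard (\<lambda>t. H 0 (\<eta> \<omega>) + (\<xi> (proj01 t) \<omega> - \<xi> 0 \<omega>))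
          (transformed_drift (\<lambda>s x. \<alpha> s x \<omega>)) k t) \<longlonglongrightarrow> Y t"
      and B: "\<exists>B. \<forall>s\<in>{0..1}. \<forall>t\<in>{0..1}. \<bar>K s (Y s) - K t (Y t)\<bar> \<le> B * \<bar>s - t\<bar> powr \<gamma>"
      and eq: "\<forall>I. negligible_incr 0 1 (\<lambda>u v. I v - I u - \<sigma> u (K u (Y u)) * (\<xi> v \<omega> - \<xi> u \<omega>)) \<longrightarrow>
        (\<forall>t\<in>{0..1}. K t (Y t) = \<eta> \<omega> + (I t - I 0) + integral {0..t} (\<lambda>r. \<sigma> r (K r (Y r)) * \<alpha> r (K r (Y r)) \<omega>))"
      using path_solution_exists[where \<xi> = "\<lambda>t. \<xi> t \<omega>" and \<alpha> = "\<lambda>s x. \<alpha> s x \<omega>",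
          OF \<xi>_hoelder[OF \<omega>] meas \<alpha>_bound[OF \<omega>] allI[OF \<alpha>_lip[OF \<omega>]] \<eta>J]
      by (elim exE conjE) (rule that, assumption, rule exI, assumption+)
    have z_eq: "z \<omega> = (\<lambda>t. H 0 (\<eta> \<omega>) + (\<xi> (proj01 t) \<omega> - \<xi> 0 \<omega>))"
      by (rule ext) (simp add: z_def x0_def \<eta>J)
    have XY: "X t \<omega> = K t (Y t)" if "t \<in> {0..1}" for t
      unfolding X_def Yk_def z_eq using limI[OF Y_lim[rule_format, OF that]] by simp
    have "\<exists>B. \<forall>s\<in>{0..1}. \<forall>t\<in>{0..1}. \<bar>X s \<omega> - X t \<omega>\<bar> \<le> B * \<bar>s - t\<bar> powr \<gamma>"
      using B by (simp add: XY)
    moreover have "X t \<omega> = \<eta> \<omega> + (I t - I 0) + integral {0..t} (\<lambda>r. \<sigma> r (X r \<omega>) * \<alpha> r (X r \<omega>) \<omega>)"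
      if I: "negligible_incr 0 1 (\<lambda>u v. I v - I u - \<sigma> u (X u \<omega>) * (\<xi> v \<omega> - \<xi> u \<omega>))" and t: "t \<in> {0..1}" for I t
    proof -
      have "negligible_incr 0 1 (\<lambda>u v. I v - I u - \<sigma> u (K u (Y u)) * (\<xi> v \<omega> - \<xi> u \<omega>))"
        using I by (rule negligible_incr_cong) (simp add: XY)
      from eq[rule_format, OF this t]
      have "K t (Y t) = \<eta> \<omega> + (I t - I 0) + integral {0..t} (\<lambda>r. \<sigma> r (K r (Y r)) * \<alpha> r (K r (Y r)) \<omega>)" .
      also have "integral {0..t} (\<lambda>r. \<sigma> r (K r (Y r)) * \<alpha> r (K r (Y r)) \<omega>)
          = integral {0..t} (\<lambda>r. \<sigma> r (X r \<omega>) * \<alpha> r (X r \<omega>) \<omega>)"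
        using t by (intro Henstock_Kurzweil_Integration.integral_cong) (simp add: XY)
      finally show ?thesis by (simp add: XY[OF t])
    qed
    ultimately show ?thesis by blast
  qed
  show ?thesis
    using X_meas path by (intro exI[of _ X] conjI ballI impI) auto
qed

end

text \<open>All components of the set where \<open>\<sigma>\<close> does not vanish, each with its base point and its bound on the
  logarithmic time derivative.\<close>
locale singular_equation = young_coefficient +
  fixes S :: "real set" and N :: "nat set" and lo hi :: "nat \<Rightarrow> ereal" and c a :: "nat \<Rightarrow> real"
  assumes comp: "\<And>n. n \<in> N \<Longrightarrow> component \<sigma> \<sigma>' \<gamma> \<delta> (lo n) (hi n) (c n) (a n)"
    and S: "S = (\<Union>n\<in>N. einterval (lo n) (hi n))"
    and vanish: "\<And>t x. t \<in> {0..1} \<Longrightarrow> x \<notin> S \<Longrightarrow> \<sigma> t x = 0"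
begin

text \<open>A path that starts outside \<open>S\<close> can never enter a component, since it would then have been there from
  the start. Off \<open>S\<close> the coefficient vanishes, so the path does not move.\<close>
lemma path_solution_off_S:
  assumes sol: "path_solution \<xi> b X"
    and b: "b \<in> borel_measurable borel" "\<And>t. t \<in> {0..1} \<Longrightarrow> \<bar>b t\<bar> \<le> K0"
    and K\<xi>: "\<And>s t. s \<in> {0..1} \<Longrightarrow> t \<in> {0..1} \<Longrightarrow> \<bar>\<xi> s - \<xi> t\<bar> \<le> K\<xi>"
    and X0: "X 0 \<notin> S" and t: "t \<in> {0..1}"
  shows "X t = X 0"
proof -
  have off: "X s \<notin> S" if s: "s \<in> {0..1}" for s
  proof
    assume "X s \<in> S"
    then obtain n where n: "n \<in> N" "X s \<in> einterval (lo n) (hi n)" by (auto simp: S)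
    interpret component \<sigma> \<sigma>' \<gamma> \<delta> "lo n" "hi n" "c n" "a n" by (rule comp[OF n(1)])
    have "(0::real) \<in> {0..1}" by simp
    from stays_in_component[OF sol b K\<xi> s n(2) this] show False using X0 n(1) by (auto simp: S)
  qed
  obtain I where I: "negligible_incr 0 1 (\<lambda>u v. I v - I u - \<sigma> u (X u) * (\<xi> v - \<xi> u))"
    and eq: "X t = X 0 + (I t - I 0) + integral {0..t} (\<lambda>r. \<sigma> r (X r) * b r)"
    using sol t unfolding path_solution_def by blast
  have "negligible_incr 0 1 (\<lambda>u v. I v - I u)"
    using I by (rule negligible_incr_cong) (simp add: vanish[OF _ off])
  from negligible_incr_imp_constant[OF this t] have "I t = I 0" .
  moreover have "integral {0..t} (\<lambda>r. \<sigma> r (X r) * b r) = integral {0..t} (\<lambda>r. 0)"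
    using t by (intro Henstock_Kurzweil_Integration.integral_cong) (simp add: vanish[OF _ off])
  ultimately show ?thesis using eq by simp
qed

lemma path_solutions_coincide:
  assumes X: "path_solution \<xi> b X" and X': "path_solution \<xi> b' X'"
    and b: "b \<in> borel_measurable borel" "\<And>t. t \<in> {0..1} \<Longrightarrow> \<bar>b t\<bar> \<le> K0"
    and b': "b' \<in> borel_measurable borel" "\<And>t. t \<in> {0..1} \<Longrightarrow> \<bar>b' t\<bar> \<le> K0"
    and lip: "\<And>t. t \<in> {0..1} \<Longrightarrow> \<bar>b t - b' t\<bar> \<le> L * \<bar>X t - X' t\<bar>"
    and K\<xi>: "\<And>s t. s \<in> {0..1} \<Longrightarrow> t \<in> {0..1} \<Longrightarrow> \<bar>\<xi> s - \<xi> t\<bar> \<le> K\<xi>"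
    and init: "X 0 = X' 0" and t: "t \<in> {0..1}"
  shows "X t = X' t"
proof (cases "X 0 \<in> S")
  case True
  then obtain n where n: "n \<in> N" "X 0 \<in> einterval (lo n) (hi n)" by (auto simp: S)
  then have n': "X' 0 \<in> einterval (lo n) (hi n)" using init by simp
  interpret component \<sigma> \<sigma>' \<gamma> \<delta> "lo n" "hi n" "c n" "a n" by (rule comp[OF n(1)])
  have 0: "(0::real) \<in> {0..1}" by simp
  show ?thesis
    by (rule path_solution_unique[OF X X' b b' lip stays_in_component[OF X b K\<xi> 0 n(2)]
          stays_in_component[OF X' b' K\<xi> 0 n'] init t])
next
  case False
  then have False': "X' 0 \<notin> S" using init by simp
  show ?thesis
    using path_solution_off_S[OF X b K\<xi> False t] path_solution_off_S[OF X' b' K\<xi> False' t] init by metis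
qed

end

lemma hoelder_onD:
  assumes "hoelder_on \<gamma> T f"
  obtains B where "\<And>s t. s \<in> T \<Longrightarrow> t \<in> T \<Longrightarrow> \<bar>f s - f t\<bar> \<le> B * \<bar>s - t\<bar> powr \<gamma>"
  using assms unfolding hoelder_on_def by blast

context young_coefficient
begin

lemma coefficient_process_continuous:
  assumes X: "continuous_process M X"
  shows "continuous_process M (\<lambda>s \<omega>. \<sigma> s (X s \<omega>))"
  unfolding continuous_process_def
proof (intro conjI ballI)
  fix t :: real assume t: "t \<in> {0..1}"
  have "\<sigma> t \<in> borel_measurable borel"
    using continuous_on_section[OF \<sigma>_cont t] by (rule borel_measurable_continuous_onI)
  moreover have "X t \<in> borel_measurable M" using X t by (simp add: continuous_process_def)
  ultimately show "(\<lambda>\<omega>. \<sigma> t (X t \<omega>)) \<in> borel_measurable M" by (rule measurable_compose[rotated])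
next
  fix \<omega> assume \<omega>: "\<omega> \<in> space M"
  show "continuous_on {0..1} (\<lambda>s. \<sigma> s (X s \<omega>))"
    by (rule continuous_on_case_prod_compose[OF \<sigma>_cont])
      (use X \<omega> in \<open>auto intro!: continuous_intros simp: continuous_process_def\<close>)
qed

lemma pathwise_coefficient_integral:
  assumes X: "continuous_process M X" and \<xi>: "continuous_process M \<xi>" and \<omega>: "\<omega> \<in> space M"
    and Xh: "hoelder_on \<gamma> {0..1} (\<lambda>t. X t \<omega>)" and \<xi>h: "hoelder_on \<gamma> {0..1} (\<lambda>t. \<xi> t \<omega>)"
  obtains I where "uniform_limit {0..1} (\<lambda>\<epsilon> t. sym_approx (\<lambda>s \<omega>. \<sigma> s (X s \<omega>)) \<xi> \<epsilon> t \<omega>) I (at_right 0)"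
    "negligible_incr 0 1 (\<lambda>u v. I v - I u - \<sigma> u (X u \<omega>) * (\<xi> v \<omega> - \<xi> u \<omega>))" "I 0 = 0"
proof -
  obtain B where B: "\<And>s t. s \<in> {0..1} \<Longrightarrow> t \<in> {0..1} \<Longrightarrow> \<bar>X s \<omega> - X t \<omega>\<bar> \<le> B * \<bar>s - t\<bar> powr \<gamma>"
    using hoelder_onD[OF Xh] by blast
  obtain B' where B': "\<And>s t. s \<in> {0..1} \<Longrightarrow> t \<in> {0..1} \<Longrightarrow> \<bar>\<xi> s \<omega> - \<xi> t \<omega>\<bar> \<le> B' * \<bar>s - t\<bar> powr \<gamma>"
    using hoelder_onD[OF \<xi>h] by blast
  obtain A where A: "\<And>s t. s \<in> {0..1} \<Longrightarrow> t \<in> {0..1} \<Longrightarrow>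
      \<bar>\<sigma> s (X s \<omega>) - \<sigma> t (X t \<omega>)\<bar> \<le> A * \<bar>s - t\<bar> powr (\<gamma> * \<delta>)"
    using \<sigma>_along_path_hoelder[where X = "\<lambda>t. X t \<omega>", OF order_refl order_refl B] by blast
  have "1 < \<gamma> * \<delta> + \<gamma>" "0 < \<gamma> * \<delta>" using young \<gamma> \<delta> by auto
  from pathwise_symmetric_integral[OF coefficient_process_continuous[OF X] \<xi> \<omega> this \<gamma>(1) A B'] that
  show ?thesis by blast
qed

text \<open>The symmetric integral of a solution agrees almost surely with the pathwise limit of its
  approximations, and thus inherits the expansion of the Young integral. Its value at time \<open>0\<close> is
  zero, which identifies the initial value.\<close>
lemma integral_solution_imp_path_solution:
  assumes M: "prob_space M" and \<xi>: "hoelder_process M \<gamma> \<xi>"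
    and sol: "integral_solution M \<gamma> \<sigma> \<alpha> \<xi> \<eta> X"
  shows "AE \<omega> in M. path_solution (\<lambda>t. \<xi> t \<omega>) (\<lambda>r. \<alpha> (proj01 r) (X (proj01 r) \<omega>) \<omega>) (\<lambda>t. X t \<omega>) \<and> X 0 \<omega> = \<eta> \<omega>"
proof -
  have X: "continuous_process M X" and Xh: "AE \<omega> in M. hoelder_on \<gamma> {0..1} (\<lambda>t. X t \<omega>)"
    and int: "AE \<omega> in M. set_integrable lborel {0..1} (\<lambda>s. \<sigma> s (X s \<omega>) * \<alpha> s (X s \<omega>) \<omega>)"
    using sol by (auto simp: integral_solution_def hoelder_process_def)
  obtain I where I: "is_symmetric_integral M (\<lambda>s \<omega>. \<sigma> s (X s \<omega>)) \<xi> I"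
    and eq: "AE \<omega> in M. \<forall>t\<in>{0..1}. X t \<omega> = \<eta> \<omega> + I t \<omega> + (LINT s:{0..t}|lborel. \<sigma> s (X s \<omega>) * \<alpha> s (X s \<omega>) \<omega>)"
    using sol by (auto simp: integral_solution_def)
  have \<xi>c: "continuous_process M \<xi>" and \<xi>h: "AE \<omega> in M. hoelder_on \<gamma> {0..1} (\<lambda>t. \<xi> t \<omega>)"
    using \<xi> by (auto simp: hoelder_process_def)
  let ?P = "\<lambda>\<omega> L. uniform_limit {0..1} (\<lambda>\<epsilon> t. sym_approx (\<lambda>s \<omega>. \<sigma> s (X s \<omega>)) \<xi> \<epsilon> t \<omega>) L (at_right 0) \<and>
    negligible_incr 0 1 (\<lambda>u v. L v - L u - \<sigma> u (X u \<omega>) * (\<xi> v \<omega> - \<xi> u \<omega>)) \<and> L 0 = 0"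
  define L where "L \<omega> = (SOME L. ?P \<omega> L)" for \<omega>
  have L: "AE \<omega> in M. ?P \<omega> (L \<omega>)"
    using Xh \<xi>h AE_space
  proof eventually_elim
    case (elim \<omega>)
    have "\<exists>L. ?P \<omega> L"
      using pathwise_coefficient_integral[OF X \<xi>c elim(3,1,2)] by blast
    then show ?case unfolding L_def by (rule someI_ex)
  qed
  then have "AE \<omega> in M. uniform_limit {0..1} (\<lambda>\<epsilon> t. sym_approx (\<lambda>s \<omega>. \<sigma> s (X s \<omega>)) \<xi> \<epsilon> t \<omega>) (L \<omega>) (at_right 0)"
    by eventually_elim blast
  from symmetric_integral_eq_pathwise_limit[OF M I this]
  have IL: "AE \<omega> in M. \<forall>t\<in>{0..1}. I t \<omega> = L \<omega> t" .
  show ?thesis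
    using L IL eq int Xh
  proof eventually_elim
    case (elim \<omega>)
    have L0: "L \<omega> 0 = 0" using elim(1) by blast
    have eq': "X t \<omega> = \<eta> \<omega> + L \<omega> t + integral {0..t} (\<lambda>r. \<sigma> r (X r \<omega>) * \<alpha> (proj01 r) (X (proj01 r) \<omega>) \<omega>)"
      if t: "t \<in> {0..1}" for t
    proof -
      have "set_integrable lborel {0..t} (\<lambda>s. \<sigma> s (X s \<omega>) * \<alpha> s (X s \<omega>) \<omega>)"
        by (rule set_integrable_subset[OF elim(4)]) (use t in auto)
      then have "(LINT s:{0..t}|lborel. \<sigma> s (X s \<omega>) * \<alpha> s (X s \<omega>) \<omega>) = integral {0..t} (\<lambda>s. \<sigma> s (X s \<omega>) * \<alpha> s (X s \<omega>) \<omega>)"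
        by (rule set_borel_integral_eq_integral)
      also have "\<dots> = integral {0..t} (\<lambda>r. \<sigma> r (X r \<omega>) * \<alpha> (proj01 r) (X (proj01 r) \<omega>) \<omega>)"
        using t by (intro Henstock_Kurzweil_Integration.integral_cong) (simp add: proj01_id)
      finally show ?thesis using elim(2,3) t by simp
    qed
    have X0: "X 0 \<omega> = \<eta> \<omega>" using eq'[of 0] L0 by simp
    have "\<forall>t\<in>{0..1}. X t \<omega> = X 0 \<omega> + (L \<omega> t - L \<omega> 0) + integral {0..t} (\<lambda>r. \<sigma> r (X r \<omega>) * \<alpha> (proj01 r) (X (proj01 r) \<omega>) \<omega>)"
    proof
      fix t :: real assume "t \<in> {0..1}"
      from eq'[OF this] show "X t \<omega> = X 0 \<omega> + (L \<omega> t - L \<omega> 0)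
        + integral {0..t} (\<lambda>r. \<sigma> r (X r \<omega>) * \<alpha> (proj01 r) (X (proj01 r) \<omega>) \<omega>)"
        unfolding X0 L0 by linarith
    qed
    moreover have "\<exists>B. \<forall>s\<in>{0..1}. \<forall>t\<in>{0..1}. \<bar>X s \<omega> - X t \<omega>\<bar> \<le> B * \<bar>s - t\<bar> powr \<gamma>"
      using elim(5) by (simp add: hoelder_on_def)
    moreover have "negligible_incr 0 1 (\<lambda>u v. L \<omega> v - L \<omega> u - \<sigma> u (X u \<omega>) * (\<xi> v \<omega> - \<xi> u \<omega>))"
      using elim(1) by blast
    ultimately show ?case using X0 unfolding path_solution_def by blast
  qed
qed

end

context singular_equation
begin

text \<open>Both solutions stay in a ball that depends on the path. On it the drift coefficient is Lipschitz
  continuous in space, as pathwise uniqueness requires.\<close>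
lemma solutions_indistinguishable:
  assumes M: "prob_space M" and \<xi>: "hoelder_process M \<gamma> \<xi>"
    and \<alpha>: "(\<lambda>p. \<alpha> (proj01 (fst p)) (fst (snd p)) (snd (snd p))) \<in> borel_measurable (borel \<Otimes>\<^sub>M (borel \<Otimes>\<^sub>M M))"
    and bdd: "bounded_coeff M \<alpha>" and lip: "loc_lipschitz_coeff M \<alpha>"
    and X: "integral_solution M \<gamma> \<sigma> \<alpha> \<xi> \<eta> X" and X': "integral_solution M \<gamma> \<sigma> \<alpha> \<xi> \<eta> X'"
  shows "AE \<omega> in M. \<forall>t\<in>{0..1}. X t \<omega> = X' t \<omega>"
  using integral_solution_imp_path_solution[OF M \<xi> X] integral_solution_imp_path_solution[OF M \<xi> X']
    bdd[unfolded bounded_coeff_def] lip[unfolded loc_lipschitz_coeff_def] AE_space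
proof eventually_elim
  case (elim \<omega>)
  have cont: "continuous_on {0..1} (\<lambda>t. Z t \<omega>)" if "integral_solution M \<gamma> \<sigma> \<alpha> \<xi> \<eta> Z" for Z
    using that elim(5) by (auto simp: integral_solution_def hoelder_process_def continuous_process_def)
  have \<xi>_cont: "continuous_on {0..1} (\<lambda>t. \<xi> t \<omega>)"
    using \<xi> elim(5) by (auto simp: hoelder_process_def continuous_process_def)
  obtain K0 where K0: "\<forall>t\<in>{0..1}. \<forall>x. \<bar>\<alpha> t x \<omega>\<bar> \<le> K0" using elim(3) by blast
  obtain R1 where R1: "\<And>t. t \<in> {0..1} \<Longrightarrow> \<bar>X t \<omega>\<bar> \<le> R1"
    using continuous_on_Icc_bounded[OF cont[OF X]] by metis
  obtain R2 where R2: "\<And>t. t \<in> {0..1} \<Longrightarrow> \<bar>X' t \<omega>\<bar> \<le> R2"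
    using continuous_on_Icc_bounded[OF cont[OF X']] by metis
  obtain R3 where R3: "\<And>t. t \<in> {0..1} \<Longrightarrow> \<bar>\<xi> t \<omega>\<bar> \<le> R3"
    using continuous_on_Icc_bounded[OF \<xi>_cont] by metis
  define R where "R = max R1 R2"
  obtain L where L: "\<forall>t\<in>{0..1}. L-lipschitz_on {-R..R} (\<lambda>x. \<alpha> t x \<omega>)" using elim(4) by blast
  define b where "b Z r = \<alpha> (proj01 r) (Z (proj01 r) \<omega>) \<omega>" for Z :: "real \<Rightarrow> 'a \<Rightarrow> real" and r
  have b_meas: "b Z \<in> borel_measurable borel" if "continuous_on {0..1} (\<lambda>t. Z t \<omega>)" for Z
  proof -
    have "(\<lambda>s. Z (proj01 s) \<omega>) \<in> borel_measurable borel"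
      using that by (intro borel_measurable_continuous_onI continuous_on_comp_proj01)
    from coefficient_along_path_measurable[OF \<alpha> this elim(5)] show ?thesis by (simp add: b_def[abs_def])
  qed
  have b_bound: "\<bar>b Z t\<bar> \<le> K0" for Z t using K0 by (simp add: b_def)
  have b_lip: "\<bar>b X t - b X' t\<bar> \<le> L * \<bar>X t \<omega> - X' t \<omega>\<bar>" if t: "t \<in> {0..1}" for t
  proof -
    have "X t \<omega> \<in> {-R..R}" "X' t \<omega> \<in> {-R..R}"
      using R1[OF t] R2[OF t] by (auto simp: R_def)
    from lipschitz_onD[OF L[rule_format, OF t] this] show ?thesis
      by (simp add: b_def proj01_id[OF t] dist_real_def)
  qed
  have \<xi>_bound: "\<bar>\<xi> s \<omega> - \<xi> t \<omega>\<bar> \<le> 2 * R3" if "s \<in> {0..1}" "t \<in> {0..1}" for s t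
    using R3[OF that(1)] R3[OF that(2)] by linarith
  have sol: "path_solution (\<lambda>t. \<xi> t \<omega>) (b X) (\<lambda>t. X t \<omega>)" "path_solution (\<lambda>t. \<xi> t \<omega>) (b X') (\<lambda>t. X' t \<omega>)"
    and init: "X 0 \<omega> = X' 0 \<omega>"
    using elim(1,2) by (simp_all add: b_def[abs_def])
  show ?case
  proof
    fix t :: real assume t: "t \<in> {0..1}"
    show "X t \<omega> = X' t \<omega>"
      using sol b_meas[where Z = X, OF cont[OF X]] b_bound[of X] b_meas[where Z = X', OF cont[OF X']] b_bound[of X']
        b_lip \<xi>_bound init t
      by (rule path_solutions_coincide)
  qed
qed

text \<open>Where \<open>\<eta>\<close> is outside \<open>S\<close> the constant path solves the equation; elsewhere the solution for the
  component with the least index containing \<open>\<eta>\<close> is used, which is a measurable choice. On the null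
  set of paths without the required regularity the process is set to \<open>0\<close>, because solutions have
  continuous paths for every \<open>\<omega>\<close>.\<close>
lemma solution_exists:
  assumes M: "prob_space M" and \<xi>: "hoelder_process M \<gamma> \<xi>" and \<eta>: "\<eta> \<in> borel_measurable M"
    and \<alpha>: "(\<lambda>p. \<alpha> (proj01 (fst p)) (fst (snd p)) (snd (snd p))) \<in> borel_measurable (borel \<Otimes>\<^sub>M (borel \<Otimes>\<^sub>M M))"
    and bdd: "bounded_coeff M \<alpha>" and lip: "loc_lipschitz_coeff M \<alpha>"
  shows "\<exists>X. integral_solution M \<gamma> \<sigma> \<alpha> \<xi> \<eta> X"
proof -
  interpret prob_space M by (rule M)
  have \<xi>c: "continuous_process M \<xi>" and \<xi>h: "AE \<omega> in M. hoelder_on \<gamma> {0..1} (\<lambda>t. \<xi> t \<omega>)"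
    using \<xi> by (auto simp: hoelder_process_def)
  let ?P = "\<lambda>\<omega>. hoelder_on \<gamma> {0..1} (\<lambda>t. \<xi> t \<omega>) \<and> (\<exists>K. \<forall>t\<in>{0..1}. \<forall>x. \<bar>\<alpha> t x \<omega>\<bar> \<le> K) \<and>
    (\<forall>R. \<exists>L. \<forall>t\<in>{0..1}. L-lipschitz_on {-R..R} (\<lambda>x. \<alpha> t x \<omega>))"
  have "AE \<omega> in M. ?P \<omega>"
    using \<xi>h bdd[unfolded bounded_coeff_def] lip[unfolded loc_lipschitz_coeff_def] by eventually_elim blast
  then obtain N0 where N0: "\<And>\<omega>. \<omega> \<in> space M - N0 \<Longrightarrow> ?P \<omega>" "N0 \<in> null_sets M"
    by (rule AE_E3) blast
  define G where "G = space M - N0"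
  have G_sets: "G \<in> sets M" using N0(2) by (auto simp: G_def null_sets_def)
  have G_space: "\<omega> \<in> space M" if "\<omega> \<in> G" for \<omega> using that by (simp add: G_def)
  have AE_G: "AE \<omega> in M. \<omega> \<in> G"
    using AE_not_in[OF N0(2)] AE_space by eventually_elim (simp add: G_def)
  have G_hoelder: "hoelder_on \<gamma> {0..1} (\<lambda>t. \<xi> t \<omega>)" if "\<omega> \<in> G" for \<omega> using N0(1) that by (simp add: G_def)
  have G_bound: "\<exists>K0. \<forall>t\<in>{0..1}. \<forall>x. \<bar>\<alpha> t x \<omega>\<bar> \<le> K0" if "\<omega> \<in> G" for \<omega>
    using N0(1) that by (simp add: G_def)
  have G_lip: "\<exists>L. \<forall>t\<in>{0..1}. \<forall>x y. \<bar>x\<bar> \<le> R \<longrightarrow> \<bar>y\<bar> \<le> R \<longrightarrow> \<bar>\<alpha> t x \<omega> - \<alpha> t y \<omega>\<bar> \<le> L * \<bar>x - y\<bar>"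
    if "\<omega> \<in> G" for \<omega> R
  proof -
    obtain L where L: "\<forall>t\<in>{0..1}. L-lipschitz_on {-R..R} (\<lambda>x. \<alpha> t x \<omega>)"
      using N0(1)[of \<omega>] \<open>\<omega> \<in> G\<close> unfolding G_def by blast
    show ?thesis
    proof (intro exI[of _ L] ballI allI impI)
      fix t x y :: real assume t: "t \<in> {0..1}" and "\<bar>x\<bar> \<le> R" "\<bar>y\<bar> \<le> R"
      then have "x \<in> {-R..R}" "y \<in> {-R..R}" by auto
      from lipschitz_onD[OF L[rule_format, OF t] this]
      show "\<bar>\<alpha> t x \<omega> - \<alpha> t y \<omega>\<bar> \<le> L * \<bar>x - y\<bar>" by (simp add: dist_real_def)
    qed
  qed
  let ?eq = "\<lambda>X \<omega>. \<forall>I. negligible_incr 0 1 (\<lambda>u v. I v - I u - \<sigma> u (X u \<omega>) * (\<xi> v \<omega> - \<xi> u \<omega>)) \<longrightarrow>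
     (\<forall>t\<in>{0..1}. X t \<omega> = \<eta> \<omega> + (I t - I 0) + integral {0..t} (\<lambda>r. \<sigma> r (X r \<omega>) * \<alpha> r (X r \<omega>) \<omega>))"
  let ?hoelder = "\<lambda>X \<omega>. \<exists>B. \<forall>s\<in>{0..1}. \<forall>t\<in>{0..1}. \<bar>X s \<omega> - X t \<omega>\<bar> \<le> B * \<bar>s - t\<bar> powr \<gamma>"
  have "\<forall>n\<in>N. \<exists>X. (\<forall>t\<in>{0..1}. X t \<in> borel_measurable M) \<and>
      (\<forall>\<omega>\<in>G. \<eta> \<omega> \<in> einterval (lo n) (hi n) \<longrightarrow> ?hoelder X \<omega> \<and> ?eq X \<omega>)"
  proof
    fix n assume n: "n \<in> N"
    interpret component \<sigma> \<sigma>' \<gamma> \<delta> "lo n" "hi n" "c n" "a n" by (rule comp[OF n])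
    show "\<exists>X. (\<forall>t\<in>{0..1}. X t \<in> borel_measurable M) \<and>
      (\<forall>\<omega>\<in>G. \<eta> \<omega> \<in> einterval (lo n) (hi n) \<longrightarrow> ?hoelder X \<omega> \<and> ?eq X \<omega>)"
      by (rule measurable_solution_process[OF \<xi>c \<eta> \<alpha>])
        (use G_space G_hoelder[unfolded hoelder_on_def] G_bound G_lip in blast)+
  qed
  then obtain Xs where Xs: "\<forall>n\<in>N. (\<forall>t\<in>{0..1}. Xs n t \<in> borel_measurable M) \<and>
      (\<forall>\<omega>\<in>G. \<eta> \<omega> \<in> einterval (lo n) (hi n) \<longrightarrow> ?hoelder (Xs n) \<omega> \<and> ?eq (Xs n) \<omega>)"
    by (rule bchoice[THEN exE])
  define idx where "idx \<omega> = (LEAST n. n \<in> N \<and> \<eta> \<omega> \<in> einterval (lo n) (hi n))" for \<omega>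
  have idx: "idx \<omega> \<in> N" "\<eta> \<omega> \<in> einterval (lo (idx \<omega>)) (hi (idx \<omega>))" if "\<eta> \<omega> \<in> S" for \<omega>
  proof -
    have "\<exists>n. n \<in> N \<and> \<eta> \<omega> \<in> einterval (lo n) (hi n)" using that by (auto simp: S)
    from LeastI_ex[OF this] show "idx \<omega> \<in> N" "\<eta> \<omega> \<in> einterval (lo (idx \<omega>)) (hi (idx \<omega>))"
      by (auto simp: idx_def)
  qed
  have [measurable]: "\<eta> \<in> borel_measurable M" by (rule \<eta>)
  have [measurable]: "G \<in> sets M" by (rule G_sets)
  have [measurable]: "S \<in> sets borel" unfolding S by (intro borel_open open_UN) simp
  have [measurable]: "idx \<in> M \<rightarrow>\<^sub>M count_space UNIV"
    unfolding idx_def[abs_def] by measurable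
  define X where "X t \<omega> = (if \<omega> \<in> G then if \<eta> \<omega> \<in> S then (if idx \<omega> \<in> N then Xs (idx \<omega>) t \<omega> else 0) else \<eta> \<omega> else 0)" for t \<omega>
  have X_meas: "X t \<in> borel_measurable M" if t: "t \<in> {0..1}" for t
  proof -
    have "(\<lambda>\<omega>. if n \<in> N then Xs n t \<omega> else 0) \<in> borel_measurable M" for n
      using Xs t by (cases "n \<in> N") auto
    then have [measurable]: "(\<lambda>\<omega>. if idx \<omega> \<in> N then Xs (idx \<omega>) t \<omega> else 0) \<in> borel_measurable M"
      by (rule measurable_compose_countable[where f = "\<lambda>n \<omega>. if n \<in> N then Xs n t \<omega> else 0"]) measurable
    show ?thesis unfolding X_def[abs_def] by measurable
  qed
  have X_good: "?hoelder X \<omega> \<and> ?eq X \<omega>" if \<omega>: "\<omega> \<in> G" for \<omega>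
  proof (cases "\<eta> \<omega> \<in> S")
    case True
    have "X t \<omega> = Xs (idx \<omega>) t \<omega>" for t using True \<omega> idx[OF True] by (simp add: X_def)
    then show ?thesis using Xs[rule_format, OF idx(1)[OF True]] \<omega> idx(2)[OF True] by simp
  next
    case False
    have X: "X t \<omega> = \<eta> \<omega>" for t using False \<omega> by (simp add: X_def)
    have eq: "\<eta> \<omega> = \<eta> \<omega> + (I t - I 0) + integral {0..t} (\<lambda>r. \<sigma> r (\<eta> \<omega>) * \<alpha> r (\<eta> \<omega>) \<omega>)"
      if I: "negligible_incr 0 1 (\<lambda>u v. I v - I u - \<sigma> u (\<eta> \<omega>) * (\<xi> v \<omega> - \<xi> u \<omega>))" and t: "t \<in> {0..1}" for I t
    proof -
      have "negligible_incr 0 1 (\<lambda>u v. I v - I u)"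
        using I by (rule negligible_incr_cong) (simp add: vanish[OF _ False])
      from negligible_incr_imp_constant[OF this t] have "I t = I 0" .
      moreover have "integral {0..t} (\<lambda>r. \<sigma> r (\<eta> \<omega>) * \<alpha> r (\<eta> \<omega>) \<omega>) = integral {0..t} (\<lambda>r. 0)"
        using t by (intro Henstock_Kurzweil_Integration.integral_cong) (simp add: vanish[OF _ False])
      ultimately show ?thesis by simp
    qed
    show ?thesis unfolding X using eq by (intro conjI exI[of _ 0] allI impI ballI) auto
  qed
  have X_hoelder: "hoelder_on \<gamma> {0..1} (\<lambda>t. X t \<omega>)" if "\<omega> \<in> G" for \<omega>
    using X_good[OF that] by (simp add: hoelder_on_def)
  have X_off: "X t \<omega> = 0" if "\<omega> \<notin> G" for t \<omega> using that by (simp add: X_def)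
  have Xc: "continuous_process M X"
    unfolding continuous_process_def
  proof (intro conjI ballI X_meas)
    fix \<omega> assume "\<omega> \<in> space M"
    show "continuous_on {0..1} (\<lambda>t. X t \<omega>)"
    proof (cases "\<omega> \<in> G")
      case True
      then obtain B where "\<forall>s\<in>{0..1}. \<forall>t\<in>{0..1}. \<bar>X s \<omega> - X t \<omega>\<bar> \<le> B * \<bar>s - t\<bar> powr \<gamma>"
        using X_good by blast
      then show ?thesis
        using hoelder_imp_continuous_on[where f = "\<lambda>t. X t \<omega>" and T = "{0..1}" and A = B, OF \<gamma>(1)] by simp
    qed (simp add: X_off)
  qed
  let ?\<sigma>X = "\<lambda>s \<omega>. \<sigma> s (X s \<omega>)"
  have \<sigma>Xc: "continuous_process M ?\<sigma>X" using Xc by (rule coefficient_process_continuous)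
  define I where "I t \<omega> = (if \<omega> \<in> G then lim (\<lambda>k. sym_approx ?\<sigma>X \<xi> (1 / real (Suc k)) t \<omega>) else 0)" for t \<omega>
  have I_good: "uniform_limit {0..1} (\<lambda>\<epsilon> t. sym_approx ?\<sigma>X \<xi> \<epsilon> t \<omega>) (\<lambda>t. I t \<omega>) (at_right 0) \<and>
      negligible_incr 0 1 (\<lambda>u v. I v \<omega> - I u \<omega> - \<sigma> u (X u \<omega>) * (\<xi> v \<omega> - \<xi> u \<omega>)) \<and> I 0 \<omega> = 0"
    if \<omega>: "\<omega> \<in> G" for \<omega>
  proof -
    obtain L where L: "uniform_limit {0..1} (\<lambda>\<epsilon> t. sym_approx ?\<sigma>X \<xi> \<epsilon> t \<omega>) L (at_right 0)"
      "negligible_incr 0 1 (\<lambda>u v. L v - L u - \<sigma> u (X u \<omega>) * (\<xi> v \<omega> - \<xi> u \<omega>))" "L 0 = 0"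
      using pathwise_coefficient_integral[OF Xc \<xi>c G_space[OF \<omega>] X_hoelder[OF \<omega>] G_hoelder[OF \<omega>]] by blast
    have IL: "I t \<omega> = L t" if t: "t \<in> {0..1}" for t
      using limI[OF filterlim_compose[OF tendsto_uniform_limitI[OF L(1) t] filterlim_inverse_Suc_at_right]] \<omega> by (simp add: I_def)
    have "uniform_limit {0..1} (\<lambda>\<epsilon> t. sym_approx ?\<sigma>X \<xi> \<epsilon> t \<omega>) (\<lambda>t. I t \<omega>) (at_right 0)"
      using L(1) by (rule uniform_limit_cong'[THEN iffD2, rotated 2]) (simp_all add: IL)
    moreover have "negligible_incr 0 1 (\<lambda>u v. I v \<omega> - I u \<omega> - \<sigma> u (X u \<omega>) * (\<xi> v \<omega> - \<xi> u \<omega>))"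
      using L(2) by (rule negligible_incr_cong) (simp add: IL)
    ultimately show ?thesis using L(3) IL by simp
  qed
  have Ic: "continuous_process M I"
    unfolding continuous_process_def
  proof (intro conjI ballI)
    fix t :: real assume t: "t \<in> {0..1}"
    have "sym_approx ?\<sigma>X \<xi> \<epsilon> t \<in> borel_measurable M" for \<epsilon>
      using sym_approx_continuous_process[OF \<sigma>Xc \<xi>c] t by (simp add: continuous_process_def)
    then have [measurable]: "(\<lambda>\<omega>. lim (\<lambda>k. sym_approx ?\<sigma>X \<xi> (1 / real (Suc k)) t \<omega>)) \<in> borel_measurable M"
      by (intro borel_measurable_lim_metric)
    show "I t \<in> borel_measurable M" unfolding I_def[abs_def] by measurable
  next
    fix \<omega> assume \<omega>: "\<omega> \<in> space M"
    show "continuous_on {0..1} (\<lambda>t. I t \<omega>)"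
    proof (cases "\<omega> \<in> G")
      case True
      have "continuous_on {0..1} (\<lambda>t. sym_approx ?\<sigma>X \<xi> \<epsilon> t \<omega>)" for \<epsilon>
        using sym_approx_continuous_process[OF \<sigma>Xc \<xi>c] \<omega> by (simp add: continuous_process_def)
      then show ?thesis
        using I_good[OF True] by (intro uniform_limit_theorem[where F = "at_right (0::real)"]) auto
    qed (simp add: I_def)
  qed
  have sym: "is_symmetric_integral M ?\<sigma>X \<xi> I"
    by (rule symmetric_integral_of_pathwise_limit[OF M \<sigma>Xc \<xi>c Ic])
      (use AE_G in \<open>eventually_elim, use I_good in blast\<close>)
  have drift: "set_integrable lborel {0..t} (\<lambda>s. \<sigma> s (X s \<omega>) * \<alpha> s (X s \<omega>) \<omega>)"
    if \<omega>: "\<omega> \<in> G" and t: "t \<in> {0..1}" for \<omega> t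
  proof -
    let ?f = "\<lambda>s. \<sigma> (proj01 s) (X (proj01 s) \<omega>) * \<alpha> (proj01 s) (X (proj01 s) \<omega>) \<omega>"
    have Xc': "continuous_on {0..1} (\<lambda>t. X t \<omega>)" and \<sigma>Xc': "continuous_on {0..1} (\<lambda>t. \<sigma> t (X t \<omega>))"
      using Xc \<sigma>Xc G_space[OF \<omega>] by (auto simp: continuous_process_def)
    have "(\<lambda>s. X (proj01 s) \<omega>) \<in> borel_measurable borel"
      by (intro borel_measurable_continuous_onI continuous_on_comp_proj01 Xc')
    from coefficient_along_path_measurable[OF \<alpha> this G_space[OF \<omega>]]
    have "(\<lambda>s. \<alpha> (proj01 s) (X (proj01 s) \<omega>) \<omega>) \<in> borel_measurable borel" .
    moreover have "(\<lambda>s. \<sigma> (proj01 s) (X (proj01 s) \<omega>)) \<in> borel_measurable borel"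
      by (intro borel_measurable_continuous_onI continuous_on_comp_proj01[OF \<sigma>Xc'])
    ultimately have f: "?f \<in> borel_measurable borel" by (intro borel_measurable_times)
    obtain K0 where K0: "\<forall>t\<in>{0..1}. \<forall>x. \<bar>\<alpha> t x \<omega>\<bar> \<le> K0" using G_bound[OF \<omega>] by blast
    obtain Q where Q: "\<And>s. s \<in> {0..1} \<Longrightarrow> \<bar>\<sigma> s (X s \<omega>)\<bar> \<le> Q"
      using continuous_on_Icc_bounded[OF \<sigma>Xc'] by metis
    have "\<bar>?f s\<bar> \<le> Q * K0" for s
    proof -
      have "\<bar>\<sigma> (proj01 s) (X (proj01 s) \<omega>)\<bar> \<le> Q" by (rule Q) auto
      moreover have "\<bar>\<alpha> (proj01 s) (X (proj01 s) \<omega>) \<omega>\<bar> \<le> K0" using K0 by auto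
      ultimately show ?thesis unfolding abs_mult by (intro mult_mono) auto
    qed
    then have "set_integrable lborel {0..t} ?f" by (intro bounded_measurable_integral(1)[OF f])
    then show ?thesis
      by (rule set_integrable_cong[THEN iffD1, rotated -1]) (use t in \<open>auto simp: proj01_id\<close>)
  qed
  have "integral_solution M \<gamma> \<sigma> \<alpha> \<xi> \<eta> X"
    unfolding integral_solution_def hoelder_process_def
  proof (intro conjI exI[of _ I] Xc sym)
    show "AE \<omega> in M. hoelder_on \<gamma> {0..1} (\<lambda>t. X t \<omega>)"
      using AE_G by eventually_elim (rule X_hoelder)
    show "AE \<omega> in M. set_integrable lborel {0..1} (\<lambda>s. \<sigma> s (X s \<omega>) * \<alpha> s (X s \<omega>) \<omega>)"
      using AE_G by eventually_elim (rule drift, auto)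
    show "AE \<omega> in M. \<forall>t\<in>{0..1}. X t \<omega> = \<eta> \<omega> + I t \<omega> + (LINT s:{0..t}|lborel. \<sigma> s (X s \<omega>) * \<alpha> s (X s \<omega>) \<omega>)"
      using AE_G
    proof eventually_elim
      case (elim \<omega>)
      show ?case
      proof
        fix t :: real assume t: "t \<in> {0..1}"
        have "negligible_incr 0 1 (\<lambda>u v. I v \<omega> - I u \<omega> - \<sigma> u (X u \<omega>) * (\<xi> v \<omega> - \<xi> u \<omega>))"
          using I_good[OF elim] by blast
        from X_good[OF elim, THEN conjunct2, THEN spec, THEN mp, OF this, THEN bspec, OF t]
        have "X t \<omega> = \<eta> \<omega> + (I t \<omega> - I 0 \<omega>) + integral {0..t} (\<lambda>r. \<sigma> r (X r \<omega>) * \<alpha> r (X r \<omega>) \<omega>)" .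
        then show "X t \<omega> = \<eta> \<omega> + I t \<omega> + (LINT s:{0..t}|lborel. \<sigma> s (X s \<omega>) * \<alpha> s (X s \<omega>) \<omega>)"
          using I_good[OF elim] set_borel_integral_eq_integral(2)[OF drift[OF elim t]] by linarith
      qed
    qed
  qed
  then show ?thesis by blast
qed

end

lemma dt_log_abs_eq:
  assumes t: "t \<in> {0..1}" and nz: "\<sigma> t x \<noteq> 0"
    and d: "((\<lambda>s. \<sigma> s x) has_real_derivative \<sigma>' t x) (at t within {0..1})"
  shows "dt_log_abs \<sigma> t x = \<sigma>' t x / \<sigma> t x"
proof -
  \<comment> \<open>Squaring covers both signs of \<open>\<sigma>\<close> at once.\<close>
  have eq: "ln \<bar>y\<bar> = ln (y\<^sup>2) / 2" for y :: real
    using ln_realpow[of "\<bar>y\<bar>" 2] by (cases "y = 0") auto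
  have "((\<lambda>s. ln ((\<sigma> s x)\<^sup>2) / 2) has_real_derivative \<sigma>' t x / \<sigma> t x) (at t within {0..1})"
  proof -
    have pos: "0 < (\<sigma> t x)\<^sup>2" using nz by simp
    have "((\<lambda>s. (\<sigma> s x)\<^sup>2) has_real_derivative 2 * \<sigma> t x * \<sigma>' t x) (at t within {0..1})"
      by (auto intro!: derivative_eq_intros d)
    from DERIV_cdivide[OF DERIV_chain2[OF DERIV_ln_divide[OF pos] this], of 2] show ?thesis
      using nz by (simp add: power2_eq_square)
  qed
  then have "((\<lambda>s. ln \<bar>\<sigma> s x\<bar>) has_vector_derivative \<sigma>' t x / \<sigma> t x) (at t within {0..1})"
    unfolding eq by (simp add: has_real_derivative_iff_has_vector_derivative)
  then show ?thesis
    unfolding dt_log_abs_def using t by (intro vector_derivative_within_closed_interval) auto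
qed

theorem corollary4p32:
  fixes M :: "'w measure"
    and F :: "real \<Rightarrow> 'w measure"
    and \<xi> :: "real \<Rightarrow> 'w \<Rightarrow> real"
    and \<sigma> :: "real \<Rightarrow> real \<Rightarrow> real"
    and \<alpha> :: "real \<Rightarrow> real \<Rightarrow> 'w \<Rightarrow> real"
    and \<eta> :: "'w \<Rightarrow> real"
    and \<gamma> :: real
    and S :: "real set" and N :: "nat set"
    and lo hi :: "nat \<Rightarrow> ereal" and c :: "nat \<Rightarrow> real" and a :: "nat \<Rightarrow> real"
  assumes "filtered_prob_space M F"
    and "adapted F \<xi>" and "AE \<omega> in M. \<xi> 0 \<omega> = 0"
    and "continuous_on ({0..1} \<times> UNIV) (\<lambda>(t, x). \<sigma> t x)"
    and "progressively_measurable F \<alpha>" and "loc_bounded_coeff M \<alpha>"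
    and "\<eta> \<in> borel_measurable (F 0)"
    and "1 / 2 < \<gamma>" and "\<gamma> < 1"
    and "hoelder_process M \<gamma> \<xi>"
    and "cond_H1 \<sigma> S N lo hi" and "\<forall>n\<in>N. c n \<in> comp_interval lo hi n"
    and "cond_H1' \<gamma> \<sigma>"
    and "cond_H2 \<sigma> N lo hi c"
    and "measure M {\<omega> \<in> space M. \<eta> \<omega> \<in> S} = 1 \<or>
         ((\<forall>\<omega>\<in>space M. autonomous (\<lambda>t x. \<alpha> t x \<omega>)) \<and> autonomous \<sigma>)"
    and "bounded_coeff M \<alpha>" and "loc_lipschitz_coeff M \<alpha>"
    and "\<forall>n\<in>N. a n > 0 \<and>
           (\<forall>t\<in>{0..1}. \<forall>x\<in>comp_interval lo hi n. \<bar>dt_log_abs \<sigma> t x\<bar> \<le> a n)"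
  shows "(\<exists>X. integral_solution M \<gamma> \<sigma> \<alpha> \<xi> \<eta> X) \<and>
         (\<forall>X Y. integral_solution M \<gamma> \<sigma> \<alpha> \<xi> \<eta> X \<and> integral_solution M \<gamma> \<sigma> \<alpha> \<xi> \<eta> Y \<longrightarrow>
            (AE \<omega> in M. \<forall>t\<in>{0..1}. X t \<omega> = Y t \<omega>))"
proof -
  note fps = assms(1) and prog = assms(5) and \<eta>F = assms(7) and \<gamma> = assms(8,9) and \<xi> = assms(10)
    and H1 = assms(11) and c = assms(12) and H1' = assms(13) and H2 = assms(14)
    and bdd = assms(16) and lip = assms(17) and log_bound = assms(18)
  have M: "prob_space M" and filt: "filtration (space M) (\<lambda>t. F (proj01 t))" and F1: "sets (F 1) = sets M"
    using fps by (auto simp: filtered_prob_space_def)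
  have p0: "proj01 0 = 0" and p1: "proj01 1 = 1" by (auto simp: proj01_def)
  have \<eta>: "\<eta> \<in> borel_measurable M"
  proof (rule measurable_from_subalg[OF _ \<eta>F])
    show "subalgebra M (F 0)"
      using filtration.space_F[OF filt, of 0] filtration.sets_F_mono[OF filt, of 0 1] F1
      by (simp add: subalgebra_def p0 p1)
  qed
  have \<alpha>: "(\<lambda>p. \<alpha> (proj01 (fst p)) (fst (snd p)) (snd (snd p))) \<in> borel_measurable (borel \<Otimes>\<^sub>M (borel \<Otimes>\<^sub>M M))"
  proof -
    have "(\<lambda>(s, x, \<omega>). \<alpha> s x \<omega>) \<in> borel_measurable (restrict_space borel {0..1} \<Otimes>\<^sub>M (borel \<Otimes>\<^sub>M F 1))"
      using prog by (auto simp: progressively_measurable_def)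
    moreover have "sets (restrict_space borel {0..1} \<Otimes>\<^sub>M (borel \<Otimes>\<^sub>M F 1))
        = sets (restrict_space borel {0..1::real} \<Otimes>\<^sub>M ((borel :: real measure) \<Otimes>\<^sub>M M))"
      by (intro sets_pair_measure_cong F1 refl)
    ultimately have *: "(\<lambda>(s, x, \<omega>). \<alpha> s x \<omega>) \<in> borel_measurable (restrict_space borel {0..1} \<Otimes>\<^sub>M (borel \<Otimes>\<^sub>M M))"
      by (simp cong: measurable_cong_sets)
    have [measurable]: "proj01 \<in> borel \<rightarrow>\<^sub>M restrict_space borel {0..1}"
      by (intro measurable_restrict_space2 proj01_borel) auto
    have "(\<lambda>p. (proj01 (fst p), snd p)) \<in> (borel \<Otimes>\<^sub>M (borel \<Otimes>\<^sub>M M)) \<rightarrow>\<^sub>M (restrict_space borel {0..1} \<Otimes>\<^sub>M (borel \<Otimes>\<^sub>M M))"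
      by measurable
    from measurable_compose[OF this *] show ?thesis by (simp add: case_prod_beta)
  qed
  obtain \<sigma>' where \<sigma>_cont: "continuous_on ({0..1} \<times> UNIV) (\<lambda>(t, x). \<sigma> t x)"
    and \<sigma>'_cont: "continuous_on ({0..1} \<times> UNIV) (\<lambda>(t, x). \<sigma>' t x)"
    and \<sigma>_deriv: "\<And>t x. t \<in> {0..1} \<Longrightarrow> ((\<lambda>s. \<sigma> s x) has_real_derivative \<sigma>' t x) (at t within {0..1})"
    using H1' unfolding cond_H1'_def C10_def by blast
  obtain \<delta>0 C where \<delta>0: "\<delta>0 > 1 / \<gamma> - 1" and C: "\<And>n :: nat. C n > 0"
    "\<And>(n :: nat) t x y. t \<in> {0..1} \<Longrightarrow> \<bar>x\<bar> + \<bar>y\<bar> \<le> real n \<Longrightarrow> \<bar>\<sigma> t x - \<sigma> t y\<bar> \<le> C n * \<bar>x - y\<bar> powr \<delta>0"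
    using H1' unfolding cond_H1'_def by blast
  \<comment> \<open>Capping the exponent at \<open>1\<close> costs only a constant on bounded sets and preserves Young's condition, because \<open>\<gamma> > 1 / 2\<close>.\<close>
  define \<delta> where "\<delta> = min \<delta>0 1"
  have inv_\<gamma>: "1 / \<gamma> > 1" "1 / \<gamma> < 2" using \<gamma> by (auto simp: field_simps)
  have \<delta>: "0 < \<delta>" "\<delta> \<le> 1" using inv_\<gamma> \<delta>0 by (auto simp: \<delta>_def)
  have "1 / \<gamma> < 1 + \<delta>" using inv_\<gamma> \<delta>0 by (auto simp: \<delta>_def)
  then have young: "1 < \<gamma> + \<gamma> * \<delta>" using \<gamma> by (simp add: field_simps)
  have \<sigma>_hoelder: "\<exists>C. \<forall>t\<in>{0..1}. \<forall>x y. \<bar>x\<bar> \<le> R \<longrightarrow> \<bar>y\<bar> \<le> R \<longrightarrow> \<bar>\<sigma> t x - \<sigma> t y\<bar> \<le> C * \<bar>x - y\<bar> powr \<delta>" for R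
  proof -
    define n where "n = nat \<lceil>2 * \<bar>R\<bar>\<rceil>"
    have n: "2 * \<bar>R\<bar> \<le> real n" by (simp add: n_def)
    define C' where "C' = C n * (2 * \<bar>R\<bar>) powr (\<delta>0 - \<delta>)"
    have "\<bar>\<sigma> t x - \<sigma> t y\<bar> \<le> C' * \<bar>x - y\<bar> powr \<delta>"
      if t: "t \<in> {0..1}" and xy: "\<bar>x\<bar> \<le> R" "\<bar>y\<bar> \<le> R" for t x y
    proof -
      have "\<bar>\<sigma> t x - \<sigma> t y\<bar> \<le> C n * \<bar>x - y\<bar> powr \<delta>0" using xy n by (intro C(2) t) linarith
      also have "\<bar>x - y\<bar> powr \<delta>0 = \<bar>x - y\<bar> powr (\<delta>0 - \<delta>) * \<bar>x - y\<bar> powr \<delta>"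
        by (simp flip: powr_add)
      also have "C n * (\<bar>x - y\<bar> powr (\<delta>0 - \<delta>) * \<bar>x - y\<bar> powr \<delta>) \<le> C n * ((2 * \<bar>R\<bar>) powr (\<delta>0 - \<delta>) * \<bar>x - y\<bar> powr \<delta>)"
        using C(1)[of n] xy by (intro mult_left_mono mult_right_mono powr_mono2) (auto simp: \<delta>_def)
      finally show ?thesis by (simp add: C'_def mult.assoc)
    qed
    then show ?thesis by blast
  qed
  have coeff: "young_coefficient \<sigma> \<sigma>' \<gamma> \<delta>"
    by unfold_locales (use \<sigma>_cont \<sigma>'_cont \<sigma>_deriv \<gamma> \<delta> young \<sigma>_hoelder in auto)
  have ci: "comp_interval lo hi n = einterval (lo n) (hi n)" for n
    by (auto simp: comp_interval_def einterval_def)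
  have zeros: "\<sigma> t x \<noteq> 0 \<longleftrightarrow> x \<in> S" if "t \<in> {0..1}" for t x
  proof -
    have "(t, x) \<in> {(t, x). t \<in> {0..1} \<and> \<sigma> t x \<noteq> 0} \<longleftrightarrow> (t, x) \<in> {0..1} \<times> S"
      using H1 by (simp add: cond_H1_def)
    then show ?thesis using that by simp
  qed
  have S: "S = (\<Union>n\<in>N. einterval (lo n) (hi n))"
  proof -
    have "components S = comp_interval lo hi ` N"
      using H1 by (auto simp: cond_H1_def bij_betw_def)
    then have "\<Union>(components S) = (\<Union>n\<in>N. einterval (lo n) (hi n))" by (simp add: ci)
    then show ?thesis by (simp add: Union_components)
  qed
  have comp: "component \<sigma> \<sigma>' \<gamma> \<delta> (lo n) (hi n) (c n) (a n)" if n: "n \<in> N" for n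
  proof (intro component.intro coeff component_axioms.intro)
    show nz: "\<sigma> t x \<noteq> 0" if "t \<in> {0..1}" "x \<in> einterval (lo n) (hi n)" for t x
      using zeros[OF that(1)] that(2) n S by blast
    show "c n \<in> einterval (lo n) (hi n)" using c n by (simp add: ci)
    show "0 \<le> a n" using log_bound n by (simp add: less_imp_le)
    show "\<bar>\<sigma>' t x\<bar> \<le> a n * \<bar>\<sigma> t x\<bar>" if tx: "t \<in> {0..1}" "x \<in> einterval (lo n) (hi n)" for t x
    proof -
      have "\<bar>dt_log_abs \<sigma> t x\<bar> \<le> a n" using log_bound n tx by (simp add: ci)
      then have "\<bar>\<sigma>' t x / \<sigma> t x\<bar> \<le> a n"
        by (simp only: dt_log_abs_eq[where \<sigma> = \<sigma> and \<sigma>' = \<sigma>' and x = x, OF tx(1) nz[OF tx] \<sigma>_deriv[OF tx(1)]])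
      then show ?thesis using nz[OF tx] by (simp add: divide_le_eq)
    qed
    show "filterlim (\<lambda>(s, x). \<bar>H_fun \<sigma> (c n) s (real_of_ereal x)\<bar>) at_top (at (t, e) within {0..1} \<times> {lo n<..<hi n})"
      if "t \<in> {0..1}" "e \<in> {lo n, hi n}" for t e
      using H2 n that unfolding cond_H2_def by blast
  qed
  have "singular_equation \<sigma> \<sigma>' \<gamma> \<delta> S N lo hi c a"
    by (intro singular_equation.intro coeff singular_equation_axioms.intro comp S) (use zeros in blast)+
  then interpret singular_equation \<sigma> \<sigma>' \<gamma> \<delta> S N lo hi c a .
  show ?thesis
    using solution_exists[OF M \<xi> \<eta> \<alpha> bdd lip] solutions_indistinguishable[OF M \<xi> \<alpha> bdd lip] by blast
qed

end
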